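(* Let $S_r$ be a submonoid of $\bar\tau_r$ with $S_r\supseteq\Re_r$ and let $k$ be a field of positive characteristic $p$. Let $B_R$ be the right generalized Schur algebra of $S_r$ over $k$. There is one isomorphism class of irreducible left $B_R$-modules for each choice of the following data (i.e. the isomorphism classes are in bijection with the set of such choices): 1. a decomposition $r=\sum_{i\ge 0}s_ip^i$ with integers $s_i\ge 0$; and 2. a $p$-regular partition of $s_i$ for each $i>0$ with $s_i>0$; and 3. an integer $j$ with $0\le j\le s_0$; and 4. a $p$-regular partition of $j$ if $j>0$.
   Context: Fix integers $r\ge 1$ and $n\ge r$. $\bar\tau_r$ is the monoid, under composition $(\alpha\beta)(x)=\alpha(\beta(x))$, of all maps $\alpha:\{0,1,\dots,r\}\to\{0,1,\dots,r\}$ with $\alpha(0)=0$. The symmetric group $\mathfrak S_r$ on $\{1,\dots,r\}$ is regarded as a submonoid of $\bar\tau_r$ by extending each map by $0\mapsto 0$. The rook monoid is $\Re_r=\{\alpha\in\bar\tau_r:|\alpha^{-1}(i)|\le 1\text{ for }i=1,\dots,r\}$; it contains $\mathfrak S_r$. $\Lambda$ is the set of compositions $\lambda=(\lambda_1,\dots,\lambda_n)$ of $r$ ($\lambda_i\ge 0$ integers, $\sum\lambda_i=r$). The $\lambda$-blocks are $b_i^\lambda=\{k:\lambda_1+\dots+\lambda_{i-1}<k\le\lambda_1+\dots+\lambda_i\}$, and $G_\lambda=\mathfrak S_\lambda\subseteq\mathfrak S_r$ is the Young subgroup of all permutations mapping each $\lambda$-block to itself. ${}_\lambda M_\mu$ is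 the set of double cosets $G_\lambda\alpha G_\mu$, $\alpha\in S_r$. For $\alpha\in S_r$ put $G_R(\lambda,\alpha,\mu)=\{\sigma\in G_\lambda:\exists\pi\in G_\mu,\ \sigma\alpha=\alpha\pi\}$; its order $n_R(\lambda,\alpha,\mu)$ depends only on $D=G_\lambda\alpha G_\mu$ and is also written $n_R(D)$. For $D_\alpha=G_\lambda\alpha G_\nu$, $D_\beta=G_\nu\beta G_\mu$, $D\in{}_\lambda M_\mu$ let $N(D_\alpha,D_\beta,D)=\#\{\rho\in G_\nu:\alpha\rho\beta\in D\}$ (independent of representatives). The right generalized Schur algebra $B_R$ is the $k$-algebra with $k$-basis $\{f(\lambda,D,\mu):\lambda,\mu\in\Lambda,\ D\in{}_\lambda M_\mu\}$, writing $f(\lambda,\alpha,\mu)=f(\lambda,G_\lambda\alpha G_\mu,\mu)$, and product given by $f(\lambda,\alpha,\nu)*_R f(\omega,\beta,\mu)=0$ if $\nu\ne\omega$ and $$f(\lambda,\alpha,\nu)*_R f(\nu,\beta,\mu)=\sum_{D\in{}_\lambda M_\mu}\frac{n_R(D)\,N(D_\alpha,D_\beta,D)}{n_R(\lambda,\alpha,\nu)\,n_R(\nu,\beta,\mu)}f(\lambda,D,\mu);$$ the coefficients are nonnegative integers, read in $k$. This is an associative algebra with identity $\sum_{\lambda\in\Lambda}f(\lambda,1,\lambda)$. A partition is $p$-regular if no nonzero part is repeated $p$ or more times. *)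

theory Defs
  imports
    "HOL-Algebra.Algebra"
    "HOL-Computational_Algebra.Computational_Algebra"
    "HOL-Combinatorics.Permutations"
    "HOL-Library.Multiset"
begin

subsection \<open>Transformation monoids\<close>

text \<open>
  A self-map of \<open>{0,\<dots>,r}\<close> is encoded as a function on \<open>nat\<close> that is the identity above \<open>r\<close>.
  Thus composition is \<open>(\<circ>)\<close>, the unit is \<open>id\<close>, and the symmetric group on \<open>{1,\<dots>,r}\<close> is
  \<open>{\<pi>. \<pi> permutes {1..r}}\<close>.
\<close>

definition tau_bar :: "nat \<Rightarrow> (nat \<Rightarrow> nat) monoid" where
  "tau_bar r =
     \<lparr>carrier = {\<alpha>. \<alpha> 0 = 0 \<and> \<alpha> ` {0..r} \<subseteq> {0..r} \<and> (\<forall>x>r. \<alpha> x = x)},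
      monoid.mult = (\<circ>), one = id\<rparr>"

definition rook_monoid :: "nat \<Rightarrow> (nat \<Rightarrow> nat) set" where
  "rook_monoid r =
     {\<alpha> \<in> carrier (tau_bar r). \<forall>i\<in>{1..r}. card {x\<in>{0..r}. \<alpha> x = i} \<le> 1}"


subsection \<open>Compositions, Young subgroups and double cosets\<close>

definition weak_compositions :: "nat \<Rightarrow> nat \<Rightarrow> nat list set" where
  "weak_compositions n r = {l. length l = n \<and> sum_list l = r}"

text \<open>Blocks are indexed from \<open>0\<close>, following list indexing.\<close>

definition block :: "nat list \<Rightarrow> nat \<Rightarrow> nat set" where
  "block l i = {k. sum_list (take i l) < k \<and> k \<le> sum_list (take (Suc i) l)}"

definition young_subgroup :: "nat list \<Rightarrow> (nat \<Rightarrow> nat) set" where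
  "young_subgroup l =
     {\<pi>. \<pi> permutes {1..sum_list l} \<and> (\<forall>i<length l. \<pi> ` block l i = block l i)}"

definition double_coset :: "nat list \<Rightarrow> (nat \<Rightarrow> nat) \<Rightarrow> nat list \<Rightarrow> (nat \<Rightarrow> nat) set" where
  "double_coset l \<alpha> m = {\<sigma> \<circ> \<alpha> \<circ> \<pi> | \<sigma> \<pi>. \<sigma> \<in> young_subgroup l \<and> \<pi> \<in> young_subgroup m}"

definition double_cosets :: "(nat \<Rightarrow> nat) set \<Rightarrow> nat list \<Rightarrow> nat list \<Rightarrow> (nat \<Rightarrow> nat) set set" where
  "double_cosets S l m = (\<lambda>\<alpha>. double_coset l \<alpha> m) ` S"

definition G_R :: "nat list \<Rightarrow> (nat \<Rightarrow> nat) \<Rightarrow> nat list \<Rightarrow> (nat \<Rightarrow> nat) set" where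
  "G_R l \<alpha> m = {\<sigma> \<in> young_subgroup l. \<exists>\<pi>\<in>young_subgroup m. \<sigma> \<circ> \<alpha> = \<alpha> \<circ> \<pi>}"

definition n_R :: "nat list \<Rightarrow> (nat \<Rightarrow> nat) \<Rightarrow> nat list \<Rightarrow> nat" where
  "n_R l \<alpha> m = card (G_R l \<alpha> m)"

text \<open>
  The numbers attached to double cosets do not depend on the representatives, which are
  therefore selected by an arbitrary choice.
\<close>

definition coset_rep :: "(nat \<Rightarrow> nat) set \<Rightarrow> nat \<Rightarrow> nat" where
  "coset_rep D = (SOME \<alpha>. \<alpha> \<in> D)"

definition n_R_coset :: "nat list \<Rightarrow> (nat \<Rightarrow> nat) set \<Rightarrow> nat list \<Rightarrow> nat" where
  "n_R_coset l D m = n_R l (coset_rep D) m"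

definition N_coset ::
  "nat list \<Rightarrow> (nat \<Rightarrow> nat) set \<Rightarrow> (nat \<Rightarrow> nat) set \<Rightarrow> (nat \<Rightarrow> nat) set \<Rightarrow> nat" where
  "N_coset v D1 D2 D = card {\<rho> \<in> young_subgroup v. coset_rep D1 \<circ> \<rho> \<circ> coset_rep D2 \<in> D}"


subsection \<open>The right generalized Schur algebra\<close>

type_synonym schur_index = "nat list \<times> (nat \<Rightarrow> nat) set \<times> nat list"

definition schur_basis :: "(nat \<Rightarrow> nat) set \<Rightarrow> nat \<Rightarrow> nat \<Rightarrow> schur_index set" where
  "schur_basis S n r =
     {(l, D, m). l \<in> weak_compositions n r \<and> m \<in> weak_compositions n r \<and> D \<in> double_cosets S l m}"

text \<open>
  \<open>schur_coeff a b c\<close> is the coefficient of \<open>f c\<close> in \<open>f a *\<^sub>R f b\<close>, for basis indices \<open>a\<close>, \<open>b\<close>, \<open>c\<close>.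
  The division is exact there.
\<close>

fun schur_coeff :: "schur_index \<Rightarrow> schur_index \<Rightarrow> schur_index \<Rightarrow> nat" where
  "schur_coeff (l, D1, v) (w, D2, m) (l', D, m') =
     (if v = w \<and> l' = l \<and> m' = m
      then (n_R_coset l D m * N_coset v D1 D2 D) div (n_R_coset l D1 v * n_R_coset v D2 m)
      else 0)"

text \<open>
  Elements are coefficient functions supported on the (finite) basis index set, with the
  bilinear extension of the product of basis elements.
\<close>

definition schur_algebra ::
  "(nat \<Rightarrow> nat) set \<Rightarrow> nat \<Rightarrow> nat \<Rightarrow> (schur_index \<Rightarrow> 'k::field) ring" where
  "schur_algebra S n r =
     \<lparr>carrier = {x. \<forall>c. c \<notin> schur_basis S n r \<longrightarrow> x c = 0},
      monoid.mult = (\<lambda>x y c.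
        if c \<in> schur_basis S n r
        then \<Sum>a\<in>schur_basis S n r. \<Sum>b\<in>schur_basis S n r. x a * y b * of_nat (schur_coeff a b c)
        else 0),
      one = (\<lambda>c. if c \<in> (\<lambda>l. (l, double_coset l id l, l)) ` weak_compositions n r then 1 else 0),
      ring.zero = (\<lambda>c. 0),
      ring.add = (\<lambda>x y c. x c + y c)\<rparr>"


subsection \<open>Left modules over a not necessarily commutative ring\<close>

text \<open>
  The locale \<open>module\<close> of the library requires a commutative ring of scalars.  As there, the
  multiplicative fields of the record \<open>M\<close> are irrelevant.
\<close>

locale left_module = R?: ring R + M?: abelian_group M
  for R :: "('a, 'c) ring_scheme" (structure) and M :: "('a, 'b, 'd) module_scheme" (structure) +
  assumes smult_closed [simp, intro]:
      "\<lbrakk>a \<in> carrier R; x \<in> carrier M\<rbrakk> \<Longrightarrow> a \<odot>\<^bsub>M\<^esub> x \<in> carrier M"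
    and smult_l_distr:
      "\<lbrakk>a \<in> carrier R; b \<in> carrier R; x \<in> carrier M\<rbrakk> \<Longrightarrow>
       (a \<oplus>\<^bsub>R\<^esub> b) \<odot>\<^bsub>M\<^esub> x = a \<odot>\<^bsub>M\<^esub> x \<oplus>\<^bsub>M\<^esub> b \<odot>\<^bsub>M\<^esub> x"
    and smult_r_distr:
      "\<lbrakk>a \<in> carrier R; x \<in> carrier M; y \<in> carrier M\<rbrakk> \<Longrightarrow>
       a \<odot>\<^bsub>M\<^esub> (x \<oplus>\<^bsub>M\<^esub> y) = a \<odot>\<^bsub>M\<^esub> x \<oplus>\<^bsub>M\<^esub> a \<odot>\<^bsub>M\<^esub> y"
    and smult_assoc1:
      "\<lbrakk>a \<in> carrier R; b \<in> carrier R; x \<in> carrier M\<rbrakk> \<Longrightarrow>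
       (a \<otimes>\<^bsub>R\<^esub> b) \<odot>\<^bsub>M\<^esub> x = a \<odot>\<^bsub>M\<^esub> (b \<odot>\<^bsub>M\<^esub> x)"
    and smult_one [simp]:
      "x \<in> carrier M \<Longrightarrow> \<one>\<^bsub>R\<^esub> \<odot>\<^bsub>M\<^esub> x = x"

definition irreducible_module :: "('a, 'c) ring_scheme \<Rightarrow> ('a, 'b, 'd) module_scheme \<Rightarrow> bool" where
  "irreducible_module R M \<longleftrightarrow>
     left_module R M \<and> carrier M \<noteq> {\<zero>\<^bsub>M\<^esub>} \<and>
     (\<forall>H. submodule H R M \<longrightarrow> H = {\<zero>\<^bsub>M\<^esub>} \<or> H = carrier M)"

definition module_isomorphic ::
  "('a, 'c) ring_scheme \<Rightarrow> ('a, 'b, 'd) module_scheme \<Rightarrow> ('a, 'e, 'f) module_scheme \<Rightarrow> bool" where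
  "module_isomorphic R M N \<longleftrightarrow>
     (\<exists>h. bij_betw h (carrier M) (carrier N) \<and>
          (\<forall>x\<in>carrier M. \<forall>y\<in>carrier M. h (x \<oplus>\<^bsub>M\<^esub> y) = h x \<oplus>\<^bsub>N\<^esub> h y) \<and>
          (\<forall>a\<in>carrier R. \<forall>x\<in>carrier M. h (a \<odot>\<^bsub>M\<^esub> x) = a \<odot>\<^bsub>N\<^esub> h x))"

text \<open>
  Isomorphism classes of irreducible left modules whose carriers are subsets of the type \<open>'b\<close>.
  Every irreducible module is isomorphic to a quotient of the regular module, so
  \<open>'b = 'a set\<close> is large enough to contain a copy of each of them.
\<close>

definition irreducible_classes :: "('a, 'c) ring_scheme \<Rightarrow> ('a, 'b) module set set" where
  "irreducible_classes R =
     {{N. irreducible_module R N \<and> module_isomorphic R M N} | M :: ('a, 'b) module.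
        irreducible_module R M}"


subsection \<open>The labelling data\<close>

definition is_partition :: "nat \<Rightarrow> nat multiset \<Rightarrow> bool" where
  "is_partition m \<pi> \<longleftrightarrow> 0 \<notin># \<pi> \<and> sum_mset \<pi> = m"

definition p_regular :: "nat \<Rightarrow> nat multiset \<Rightarrow> bool" where
  "p_regular p \<pi> \<longleftrightarrow> (\<forall>x>0. count \<pi> x < p)"

text \<open>
  A label \<open>(s, P, j, Q)\<close> consists of the decomposition \<open>s\<close>, the partial map \<open>P\<close> giving a
  partition of \<open>s i\<close> for exactly those \<open>i > 0\<close> with \<open>s i > 0\<close>, the integer \<open>j\<close>, and the partition
  \<open>Q\<close> of \<open>j\<close>, present exactly if \<open>j > 0\<close>.
\<close>

definition irreducible_labels ::
  "nat \<Rightarrow> nat \<Rightarrow> ((nat \<Rightarrow> nat) \<times> (nat \<rightharpoonup> nat multiset) \<times> nat \<times> nat multiset option) set" where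
  "irreducible_labels p r =
     {(s, P, j, Q).
        finite {i. s i \<noteq> 0} \<and> (\<Sum>i | s i \<noteq> 0. s i * p ^ i) = r \<and>
        dom P = {i. 0 < i \<and> 0 < s i} \<and>
        (\<forall>i \<pi>. P i = Some \<pi> \<longrightarrow> is_partition (s i) \<pi> \<and> p_regular p \<pi>) \<and>
        j \<le> s 0 \<and>
        (Q \<noteq> None \<longleftrightarrow> 0 < j) \<and>
        (\<forall>\<pi>. Q = Some \<pi> \<longrightarrow> is_partition j \<pi> \<and> p_regular p \<pi>)}"

end

(*
  In the group algebra of the monoid S over the rationals, f(l, a, m) is a multiple of
  e_l a e_m, where e_l averages over the Young subgroup of l; this explains why the algebra is
  associative, and the structure constants are computed by counting pairs of Young subgroup elements.

  For every partition nu of some m <= r there is an idempotent e_nu = f(nu^, eps_m, nu^), where nu^ is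
  nu padded by parts 1 and 0 and eps_m kills the points above m.  Order these by increasing m and, for
  fixed m, by decreasing nu.  Let J_nu be the ideal generated by the idempotents before e_nu.  Then
  all e_nu together generate the algebra (every basis element factors through some e_nu);
  e_nu B e_nu is spanned by e_nu modulo J_nu (straightening, as for the classical Schur algebra);
  and e_nu is not in J_nu (a signed sum over a column stabiliser vanishes on J_nu).  Hence
  the simple modules correspond to the partitions of the numbers m <= r, the module of nu being
  characterised by e_nu being the first idempotent that does not annihilate it.  Finally, the p-adic
  digits of the multiplicities of the parts turn a partition of some m <= r into a label.
*)

theory Submission
  imports Defs "HOL-Library.Multiset_Order"
begin

subsection \<open>Modules over a noncommutative ring\<close>

lemma (in left_module) submoduleI':
  assumes "H \<subseteq> carrier M" "H \<noteq> {}"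
    and "\<And>x y. x \<in> H \<Longrightarrow> y \<in> H \<Longrightarrow> x \<oplus>\<^bsub>M\<^esub> y \<in> H"
    and "\<And>a x. a \<in> carrier R \<Longrightarrow> x \<in> H \<Longrightarrow> a \<odot>\<^bsub>M\<^esub> x \<in> H"
    and "\<And>x. x \<in> H \<Longrightarrow> \<ominus>\<^bsub>M\<^esub> x \<in> H"
  shows "submodule H R M"
proof -
  have "subgroup H (add_monoid M)"
    by (rule group.subgroupI[OF M.a_group]) (use assms in \<open>auto simp: a_inv_def\<close>)
  then show ?thesis
    using assms by (simp add: submodule_def submodule_axioms_def)
qed

context left_module
begin

lemma smult_zero_left: "x \<in> carrier M \<Longrightarrow> \<zero> \<odot>\<^bsub>M\<^esub> x = \<zero>\<^bsub>M\<^esub>"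
  by (metis M.add.l_cancel_one R.l_zero R.zero_closed smult_closed smult_l_distr)

lemma smult_zero_right: "a \<in> carrier R \<Longrightarrow> a \<odot>\<^bsub>M\<^esub> \<zero>\<^bsub>M\<^esub> = \<zero>\<^bsub>M\<^esub>"
  by (metis M.add.l_cancel_one M.l_zero M.zero_closed smult_closed smult_r_distr)

lemma smult_minus_left:
  assumes "a \<in> carrier R" "x \<in> carrier M" shows "(\<ominus> a) \<odot>\<^bsub>M\<^esub> x = \<ominus>\<^bsub>M\<^esub> (a \<odot>\<^bsub>M\<^esub> x)"
proof -
  have "(\<ominus> a) \<odot>\<^bsub>M\<^esub> x \<oplus>\<^bsub>M\<^esub> a \<odot>\<^bsub>M\<^esub> x = \<zero>\<^bsub>M\<^esub>"
    using assms by (metis R.a_inv_closed R.l_neg smult_l_distr smult_zero_left)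
  then show ?thesis using assms by (metis M.minus_equality R.a_inv_closed smult_closed)
qed

lemma smult_diff_eq_zero_iff:
  assumes "a \<in> carrier R" "b \<in> carrier R" "x \<in> carrier M"
  shows "(a \<ominus> b) \<odot>\<^bsub>M\<^esub> x = \<zero>\<^bsub>M\<^esub> \<longleftrightarrow> a \<odot>\<^bsub>M\<^esub> x = b \<odot>\<^bsub>M\<^esub> x"
  using assms
  by (metis M.minus_unique M.r_neg R.a_inv_closed R.minus_eq M.minus_minus
      smult_closed smult_l_distr smult_minus_left M.a_inv_closed M.add.m_comm)

lemma cyclic_submodule:
  assumes "v \<in> carrier M" shows "submodule ((\<lambda>a. a \<odot>\<^bsub>M\<^esub> v) ` carrier R) R M"
proof (rule submoduleI')
  fix x y assume "x \<in> (\<lambda>a. a \<odot>\<^bsub>M\<^esub> v) ` carrier R" "y \<in> (\<lambda>a. a \<odot>\<^bsub>M\<^esub> v) ` carrier R"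
  then show "x \<oplus>\<^bsub>M\<^esub> y \<in> (\<lambda>a. a \<odot>\<^bsub>M\<^esub> v) ` carrier R"
    using assms by (auto simp: smult_l_distr[symmetric])
next
  fix a x assume "a \<in> carrier R" "x \<in> (\<lambda>a. a \<odot>\<^bsub>M\<^esub> v) ` carrier R"
  then show "a \<odot>\<^bsub>M\<^esub> x \<in> (\<lambda>a. a \<odot>\<^bsub>M\<^esub> v) ` carrier R"
    using assms by (auto simp: smult_assoc1[symmetric])
next
  fix x assume "x \<in> (\<lambda>a. a \<odot>\<^bsub>M\<^esub> v) ` carrier R"
  then show "\<ominus>\<^bsub>M\<^esub> x \<in> (\<lambda>a. a \<odot>\<^bsub>M\<^esub> v) ` carrier R"
    using assms by (auto simp: smult_minus_left[symmetric])
qed (use assms in auto)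

lemma annihilator_ideal: "ideal {a \<in> carrier R. \<forall>x\<in>carrier M. a \<odot>\<^bsub>M\<^esub> x = \<zero>\<^bsub>M\<^esub>} R"
proof (rule idealI)
  show "subgroup {a \<in> carrier R. \<forall>x\<in>carrier M. a \<odot>\<^bsub>M\<^esub> x = \<zero>\<^bsub>M\<^esub>} (add_monoid R)"
    by (rule group.subgroupI[OF R.a_group])
      (auto simp: smult_l_distr smult_minus_left smult_zero_left a_inv_def[symmetric] intro!: exI[of _ \<zero>])
qed (auto simp: smult_assoc1 smult_zero_right intro: R.ring_axioms)

end

lemma module_isomorphic_refl: "module_isomorphic R M M"
  unfolding module_isomorphic_def by (rule exI[of _ id]) auto

lemma module_isomorphic_trans:
  assumes "module_isomorphic R M N" "module_isomorphic R N L"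
  shows "module_isomorphic R M L"
proof -
  obtain h where h: "bij_betw h (carrier M) (carrier N)"
    "\<forall>x\<in>carrier M. \<forall>y\<in>carrier M. h (x \<oplus>\<^bsub>M\<^esub> y) = h x \<oplus>\<^bsub>N\<^esub> h y"
    "\<forall>a\<in>carrier R. \<forall>x\<in>carrier M. h (a \<odot>\<^bsub>M\<^esub> x) = a \<odot>\<^bsub>N\<^esub> h x"
    using assms(1) unfolding module_isomorphic_def by blast
  obtain g where g: "bij_betw g (carrier N) (carrier L)"
    "\<forall>x\<in>carrier N. \<forall>y\<in>carrier N. g (x \<oplus>\<^bsub>N\<^esub> y) = g x \<oplus>\<^bsub>L\<^esub> g y"
    "\<forall>a\<in>carrier R. \<forall>x\<in>carrier N. g (a \<odot>\<^bsub>N\<^esub> x) = a \<odot>\<^bsub>L\<^esub> g x"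
    using assms(2) unfolding module_isomorphic_def by blast
  have "\<And>x. x \<in> carrier M \<Longrightarrow> h x \<in> carrier N" using h(1) bij_betwE by blast
  then show ?thesis unfolding module_isomorphic_def
    by (intro exI[of _ "g \<circ> h"]) (use h g in \<open>auto intro: bij_betw_trans\<close>)
qed

lemma module_isomorphic_sym:
  assumes "left_module R M" "module_isomorphic R M N" shows "module_isomorphic R N M"
proof -
  interpret left_module R M by fact
  obtain h where h: "bij_betw h (carrier M) (carrier N)"
    "\<And>x y. x \<in> carrier M \<Longrightarrow> y \<in> carrier M \<Longrightarrow> h (x \<oplus>\<^bsub>M\<^esub> y) = h x \<oplus>\<^bsub>N\<^esub> h y"
    "\<And>a x. a \<in> carrier R \<Longrightarrow> x \<in> carrier M \<Longrightarrow> h (a \<odot>\<^bsub>M\<^esub> x) = a \<odot>\<^bsub>N\<^esub> h x"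
    using assms(2) unfolding module_isomorphic_def by blast
  let ?g = "inv_into (carrier M) h"
  have g: "bij_betw ?g (carrier N) (carrier M)" using h(1) by (rule bij_betw_inv_into)
  have gin: "?g x \<in> carrier M" if "x \<in> carrier N" for x using g that bij_betwE by blast
  have hg: "h (?g x) = x" if "x \<in> carrier N" for x using h(1) that by (rule bij_betw_inv_into_right)
  have gh: "?g (h x) = x" if "x \<in> carrier M" for x using h(1) that by (rule bij_betw_inv_into_left)
  have "?g (x \<oplus>\<^bsub>N\<^esub> y) = ?g x \<oplus>\<^bsub>M\<^esub> ?g y" if "x \<in> carrier N" "y \<in> carrier N" for x y
    using gh[of "?g x \<oplus>\<^bsub>M\<^esub> ?g y"] h(2)[of "?g x" "?g y"] gin hg that by simp
  moreover have "?g (a \<odot>\<^bsub>N\<^esub> x) = a \<odot>\<^bsub>M\<^esub> ?g x" if "a \<in> carrier R" "x \<in> carrier N" for a x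
    using gh[of "a \<odot>\<^bsub>M\<^esub> ?g x"] h(3)[of a "?g x"] gin hg that by simp
  ultimately show ?thesis unfolding module_isomorphic_def using g by blast
qed

definition left_quotient :: "('a, 'c) ring_scheme \<Rightarrow> 'a set \<Rightarrow> ('a, 'a set) module" where
  "left_quotient R K =
     \<lparr>carrier = a_rcosets\<^bsub>R\<^esub> K, monoid.mult = undefined, one = undefined,
      ring.zero = K, ring.add = (<+>\<^bsub>R\<^esub>),
      module.smult = (\<lambda>a Y. \<Union> ((\<lambda>x. a_r_coset R K (a \<otimes>\<^bsub>R\<^esub> x)) ` Y))\<rparr>"

locale left_ideal = ring R for R (structure) + fixes K
  assumes K_subgroup: "subgroup K (add_monoid R)"
    and K_smult: "a \<in> carrier R \<Longrightarrow> x \<in> K \<Longrightarrow> a \<otimes> x \<in> K"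
begin

sublocale abelian_subgroup K R
  by (rule abelian_subgroupI3) (use K_subgroup is_abelian_group in \<open>auto intro: additive_subgroup.intro\<close>)

lemma quotient_smult:
  assumes "a \<in> carrier R" "x \<in> carrier R"
  shows "a \<odot>\<^bsub>left_quotient R K\<^esub> (K +> x) = K +> (a \<otimes> x)"
proof -
  have "K +> (a \<otimes> y) = K +> (a \<otimes> x)" if y: "y \<in> K +> x" for y
  proof -
    have yR: "y \<in> carrier R" using y assms a_r_coset_subset_G a_subset by blast
    have "y \<ominus> x \<in> K" using a_rcos_module_imp[OF assms(2) y] yR assms(2) by (simp add: minus_eq)
    then have "a \<otimes> (y \<ominus> x) \<in> K" using assms K_smult by simp
    then have "a \<otimes> y \<ominus> a \<otimes> x \<in> K" using assms yR by (simp add: minus_eq r_distr r_minus)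
    then have "a \<otimes> y \<in> K +> (a \<otimes> x)"
      using a_rcos_module_rev[of "a \<otimes> x" "a \<otimes> y"] assms yR by (simp add: minus_eq)
    then show ?thesis using a_repr_independence'[of "a \<otimes> y" "a \<otimes> x"] assms by simp
  qed
  then have "(\<lambda>y. K +> (a \<otimes> y)) ` (K +> x) = (\<lambda>_. K +> (a \<otimes> x)) ` (K +> x)"
    by (rule image_cong[OF refl])
  also have "\<dots> = {K +> (a \<otimes> x)}"
    using a_rcos_self[OF assms(2)] by (rule image_constant)
  finally show ?thesis unfolding left_quotient_def by simp
qed

lemma quotient_carrier: "carrier (left_quotient R K) = (\<lambda>x. K +> x) ` carrier R"
  unfolding left_quotient_def by (auto simp: A_RCOSETS_def RCOSETS_def a_r_coset_def)

lemma quotient_zero: "\<zero>\<^bsub>left_quotient R K\<^esub> = K"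
  unfolding left_quotient_def by simp

lemma quotient_add:
  assumes "x \<in> carrier R" "y \<in> carrier R"
  shows "(K +> x) \<oplus>\<^bsub>left_quotient R K\<^esub> (K +> y) = K +> (x \<oplus> y)"
  unfolding left_quotient_def using a_rcos_sum[OF assms] by simp

lemma coset_eq_iff:
  assumes "x \<in> carrier R" "y \<in> carrier R"
  shows "K +> x = K +> y \<longleftrightarrow> x \<ominus> y \<in> K"
  using a_rcos_module_rev[OF assms(2) assms(1)] a_rcos_module_imp[OF assms(2), of x] assms
    a_repr_independence'[of x y] a_rcos_self[of x]
  by (metis minus_eq)

lemma coset_eq_K_iff: "x \<in> carrier R \<Longrightarrow> K +> x = K \<longleftrightarrow> x \<in> K"
  by (metis a_coset_join1 a_coset_join2 additive_subgroup_axioms a_subgroup)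

lemma quotient_left_module: "left_module R (left_quotient R K)"
proof -
  have zero: "\<zero>\<^bsub>left_quotient R K\<^esub> = K +> \<zero>"
    using coset_eq_K_iff[of \<zero>] a_subgroup additive_subgroup.zero_closed[OF additive_subgroup_axioms]
    by (simp add: quotient_zero)
  have ab: "abelian_group (left_quotient R K)"
  proof (rule abelian_groupI)
    fix x assume "x \<in> carrier (left_quotient R K)"
    then obtain a where a: "a \<in> carrier R" "x = K +> a" by (auto simp: quotient_carrier)
    then have "(K +> \<ominus> a) \<oplus>\<^bsub>left_quotient R K\<^esub> x = \<zero>\<^bsub>left_quotient R K\<^esub>"
      by (simp add: quotient_add zero l_neg)
    then show "\<exists>y\<in>carrier (left_quotient R K). y \<oplus>\<^bsub>left_quotient R K\<^esub> x = \<zero>\<^bsub>left_quotient R K\<^esub>"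
      using a by (auto simp: quotient_carrier)
  qed (auto simp: quotient_carrier quotient_add zero add.m_ac)
  show ?thesis
    by (intro left_module.intro left_module_axioms.intro ab ring_axioms)
      (auto simp: quotient_carrier quotient_smult quotient_add l_distr r_distr m_assoc)
qed

end

context left_module
begin

lemma left_ideal_annihilator:
  assumes "v \<in> carrier M" shows "left_ideal R {a \<in> carrier R. a \<odot>\<^bsub>M\<^esub> v = \<zero>\<^bsub>M\<^esub>}"
proof (intro left_ideal.intro left_ideal_axioms.intro R.ring_axioms)
  show "subgroup {a \<in> carrier R. a \<odot>\<^bsub>M\<^esub> v = \<zero>\<^bsub>M\<^esub>} (add_monoid R)"
    by (rule group.subgroupI[OF R.a_group])
      (use assms in \<open>auto simp: smult_l_distr smult_minus_left smult_zero_left a_inv_def[symmetric] intro!: exI[of _ \<zero>]\<close>)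
qed (use assms in \<open>auto simp: smult_assoc1 smult_zero_right\<close>)

lemma cyclic_module_isomorphic:
  assumes v: "v \<in> carrier M" and gen: "(\<lambda>a. a \<odot>\<^bsub>M\<^esub> v) ` carrier R = carrier M"
    and K: "K = {a \<in> carrier R. a \<odot>\<^bsub>M\<^esub> v = \<zero>\<^bsub>M\<^esub>}"
  shows "module_isomorphic R (left_quotient R K) M"
proof -
  interpret K: left_ideal R K unfolding K using v by (rule left_ideal_annihilator)
  define h where "h Y = (SOME y. \<exists>a\<in>carrier R. Y = K +> a \<and> y = a \<odot>\<^bsub>M\<^esub> v)" for Y
  have eq: "K +> a = K +> b \<longleftrightarrow> a \<odot>\<^bsub>M\<^esub> v = b \<odot>\<^bsub>M\<^esub> v" if "a \<in> carrier R" "b \<in> carrier R" for a b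
  proof -
    have "a \<ominus> b \<in> K \<longleftrightarrow> a \<odot>\<^bsub>M\<^esub> v = b \<odot>\<^bsub>M\<^esub> v"
      using smult_diff_eq_zero_iff[OF that v] that K by blast
    then show ?thesis by (simp only: K.coset_eq_iff[OF that])
  qed
  have h: "h (K +> a) = a \<odot>\<^bsub>M\<^esub> v" if "a \<in> carrier R" for a
    unfolding h_def
  proof (rule some_equality)
    show "\<exists>b\<in>carrier R. K +> a = K +> b \<and> a \<odot>\<^bsub>M\<^esub> v = b \<odot>\<^bsub>M\<^esub> v"
      using that by blast
    fix y assume "\<exists>b\<in>carrier R. K +> a = K +> b \<and> y = b \<odot>\<^bsub>M\<^esub> v"
    then show "y = a \<odot>\<^bsub>M\<^esub> v" using eq[OF that] by metis
  qed
  have "inj_on h (carrier (left_quotient R K))"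
    unfolding K.quotient_carrier by (rule inj_onI) (clarsimp simp: h, simp only: eq)
  moreover have "h ` carrier (left_quotient R K) = carrier M"
    unfolding K.quotient_carrier gen[symmetric] image_image by (rule image_cong) (auto simp: h)
  ultimately show ?thesis
    unfolding module_isomorphic_def bij_betw_def
    by (intro exI[of _ h])
      (auto simp: K.quotient_carrier K.quotient_add K.quotient_smult h smult_l_distr smult_assoc1 v)
qed

end

lemma (in left_module) irreducible_cyclic:
  assumes "irreducible_module R M" "v \<in> carrier M" "v \<noteq> \<zero>\<^bsub>M\<^esub>"
  shows "(\<lambda>a. a \<odot>\<^bsub>M\<^esub> v) ` carrier R = carrier M"
proof -
  have "v \<in> (\<lambda>a. a \<odot>\<^bsub>M\<^esub> v) ` carrier R"
    using assms(2) by (intro image_eqI[of _ _ \<one>]) auto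
  then show ?thesis
    using assms cyclic_submodule[OF assms(2)] unfolding irreducible_module_def by blast
qed

subsection \<open>Chains of idempotents\<close>

locale idempotent_chain = ring R for R (structure) +
  fixes I :: "'i set" and lt :: "'i \<Rightarrow> 'i \<Rightarrow> bool" and e :: "'i \<Rightarrow> 'a"
  assumes finite_I: "finite I"
    and lt_irrefl: "\<not> lt i i"
    and lt_trans: "lt i j \<Longrightarrow> lt j k \<Longrightarrow> lt i k"
    and lt_total: "i \<in> I \<Longrightarrow> j \<in> I \<Longrightarrow> i \<noteq> j \<Longrightarrow> lt i j \<or> lt j i"
    and e_closed: "i \<in> I \<Longrightarrow> e i \<in> carrier R"
    and e_idem: "i \<in> I \<Longrightarrow> e i \<otimes> e i = e i"
    and e_full: "Idl (e ` I) = carrier R"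
    and e_local: "i \<in> I \<Longrightarrow> x \<in> carrier R \<Longrightarrow>
          e i \<otimes> x \<otimes> e i \<in> Idl (e ` {j \<in> I. lt j i}) \<or>
          (\<exists>y\<in>carrier R. y \<otimes> (e i \<otimes> x \<otimes> e i) \<ominus> e i \<in> Idl (e ` {j \<in> I. lt j i}))"
    and e_nontrivial: "i \<in> I \<Longrightarrow> e i \<notin> Idl (e ` {j \<in> I. lt j i})"
begin

definition J where "J i = Idl (e ` {j \<in> I. lt j i})"

definition K where "K i = {a \<in> carrier R. \<forall>b\<in>carrier R. e i \<otimes> b \<otimes> a \<otimes> e i \<in> J i}"

lemma J_ideal: "ideal (J i) R"
  unfolding J_def by (rule genideal_ideal) (auto simp: e_closed)

lemma left_ideal_K:
  assumes i: "i \<in> I" shows "left_ideal R (K i)"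
proof (intro left_ideal.intro left_ideal_axioms.intro ring_axioms)
  interpret J: ideal "J i" R by (rule J_ideal)
  note ei = e_closed[OF i]
  show "subgroup (K i) (add_monoid R)"
  proof (rule group.subgroupI[OF a_group])
    show "K i \<noteq> {}" using ei by (auto simp: K_def intro!: exI[of _ \<zero>])
    fix a b assume "a \<in> K i" "b \<in> K i"
    then show "a \<otimes>\<^bsub>add_monoid R\<^esub> b \<in> K i"
      using ei by (auto simp: K_def r_distr l_distr)
  next
    fix a assume "a \<in> K i"
    then show "inv\<^bsub>add_monoid R\<^esub> a \<in> K i"
      using ei by (auto simp: K_def a_inv_def[symmetric] r_minus l_minus)
  qed (auto simp: K_def)
  fix a x assume "a \<in> carrier R" "x \<in> K i"
  then show "a \<otimes> x \<in> K i"
    using ei unfolding K_def by (simp add: m_assoc) (metis m_assoc m_closed)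
qed

lemma J_subset_K: "i \<in> I \<Longrightarrow> J i \<subseteq> K i"
proof
  fix a assume i: "i \<in> I" and a: "a \<in> J i"
  interpret J: ideal "J i" R by (rule J_ideal)
  note ei = e_closed[OF i]
  have "a \<in> carrier R" using a J.a_subset by blast
  then show "a \<in> K i" unfolding K_def using ei a J.I_l_closed J.I_r_closed by simp
qed

lemma e_notin_K: "i \<in> I \<Longrightarrow> e i \<notin> K i"
  using e_nontrivial[of i] e_closed[of i] e_idem[of i]
  unfolding K_def J_def[symmetric] by (auto intro!: bexI[of _ "e i"])

lemma left_inverse_mod_J:
  assumes i: "i \<in> I" and a: "a \<in> carrier R" "a \<notin> K i"
  shows "\<exists>y\<in>carrier R. y \<otimes> a \<otimes> e i \<ominus> e i \<in> J i"
proof -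
  note ei = e_closed[OF i]
  obtain b where b: "b \<in> carrier R" "e i \<otimes> b \<otimes> a \<otimes> e i \<notin> J i"
    using a unfolding K_def by auto
  then have "e i \<otimes> (b \<otimes> a) \<otimes> e i \<notin> J i" using a ei by (simp add: m_assoc)
  then obtain y where y: "y \<in> carrier R" "y \<otimes> (e i \<otimes> (b \<otimes> a) \<otimes> e i) \<ominus> e i \<in> J i"
    using e_local[OF i, of "b \<otimes> a"] a b unfolding J_def by auto
  then have "(y \<otimes> e i \<otimes> b) \<otimes> a \<otimes> e i \<ominus> e i \<in> J i" using a b ei by (simp add: m_assoc)
  then show ?thesis using y b ei by blast
qed

lemma diff_mult_e_in_K:
  assumes i: "i \<in> I" and a: "a \<in> carrier R" shows "a \<ominus> a \<otimes> e i \<in> K i"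
proof -
  interpret J: ideal "J i" R by (rule J_ideal)
  note ei = e_closed[OF i]
  have "e i \<otimes> b \<otimes> (a \<ominus> a \<otimes> e i) \<otimes> e i = \<zero>" if "b \<in> carrier R" for b
    using ei a that e_idem[OF i] by (simp add: m_assoc minus_eq l_distr r_distr l_minus r_minus r_neg)
  then show ?thesis unfolding K_def using a ei by simp
qed

definition V where "V i = left_quotient R (K i)"

lemma V_irreducible:
  assumes i: "i \<in> I" shows "irreducible_module R (V i)"
proof -
  interpret K: left_ideal R "K i" using left_ideal_K[OF i] .
  interpret V: left_module R "V i" unfolding V_def by (rule K.quotient_left_module)
  note ei = e_closed[OF i]
  have "H = carrier (V i)" if H: "submodule H R (V i)" and ne: "H \<noteq> {\<zero>\<^bsub>V i\<^esub>}" for H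
  proof -
    have HV: "H \<subseteq> carrier (V i)" "\<zero>\<^bsub>V i\<^esub> \<in> H" using H
      by (auto dest!: submodule.axioms(1) simp: subgroup_def)
    then obtain Z where Z: "Z \<in> H" "Z \<noteq> \<zero>\<^bsub>V i\<^esub>" using ne by blast
    then obtain a where a: "a \<in> carrier R" "Z = K i +> a"
      using HV(1) unfolding V_def K.quotient_carrier by blast
    have "a \<notin> K i" using Z a K.coset_eq_K_iff[of a] by (auto simp: V_def K.quotient_zero)
    then obtain y where y: "y \<in> carrier R" "y \<otimes> a \<otimes> e i \<ominus> e i \<in> J i"
      using left_inverse_mod_J[OF i a(1)] by blast
    have "K i +> (y \<otimes> a) = K i +> (y \<otimes> a \<otimes> e i)"
      using diff_mult_e_in_K[OF i, of "y \<otimes> a"] K.coset_eq_iff[of "y \<otimes> a" "y \<otimes> a \<otimes> e i"] y a ei by simp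
    also have "\<dots> = K i +> e i"
      using y a ei K.coset_eq_iff[of "y \<otimes> a \<otimes> e i" "e i"] J_subset_K[OF i] by auto
    also have "\<dots> = K i +> \<one>"
      using diff_mult_e_in_K[OF i, of \<one>] K.coset_eq_iff[of \<one> "e i"] ei by simp
    finally have 1: "y \<odot>\<^bsub>V i\<^esub> Z = K i +> \<one>"
      using a y unfolding V_def by (simp add: K.quotient_smult)
    have "b \<odot>\<^bsub>V i\<^esub> (y \<odot>\<^bsub>V i\<^esub> Z) \<in> H" if "b \<in> carrier R" for b
      using H that y Z by (simp add: submodule.smult_closed)
    then have "K i +> b \<in> H" if "b \<in> carrier R" for b
      using that K.quotient_smult[of b \<one>] unfolding 1 by (metis V_def one_closed r_one)
    then show ?thesis using HV unfolding V_def K.quotient_carrier by blast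
  qed
  moreover have "carrier (V i) \<noteq> {\<zero>\<^bsub>V i\<^esub>}"
    using e_notin_K[OF i] ei K.coset_eq_K_iff[of "e i"] unfolding V_def K.quotient_carrier K.quotient_zero by blast
  ultimately show ?thesis unfolding irreducible_module_def using V.left_module_axioms by blast
qed

definition apex where
  "apex M i \<longleftrightarrow> i \<in> I \<and> (\<exists>x\<in>carrier M. e i \<odot>\<^bsub>M\<^esub> x \<noteq> \<zero>\<^bsub>M\<^esub>) \<and>
     (\<forall>j\<in>I. lt j i \<longrightarrow> (\<forall>x\<in>carrier M. e j \<odot>\<^bsub>M\<^esub> x = \<zero>\<^bsub>M\<^esub>))"

lemma apex_unique: "apex M i \<Longrightarrow> apex M j \<Longrightarrow> i = j"
  unfolding apex_def using lt_total by blast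

lemma apex_exists:
  assumes "irreducible_module R M" shows "\<exists>i. apex M i"
proof -
  interpret M: left_module R M using assms unfolding irreducible_module_def by blast
  let ?A = "{i \<in> I. \<exists>x\<in>carrier M. e i \<odot>\<^bsub>M\<^esub> x \<noteq> \<zero>\<^bsub>M\<^esub>}"
  let ?N = "{a \<in> carrier R. \<forall>x\<in>carrier M. a \<odot>\<^bsub>M\<^esub> x = \<zero>\<^bsub>M\<^esub>}"
  have "?A \<noteq> {}"
  proof
    assume "?A = {}"
    then have "e ` I \<subseteq> ?N" using e_closed by auto
    then have "Idl (e ` I) \<subseteq> ?N" by (rule genideal_minimal[OF M.annihilator_ideal])
    then have "carrier R \<subseteq> ?N" by (simp only: e_full)
    then have "\<one> \<in> ?N" by blast
    then have "carrier M \<subseteq> {\<zero>\<^bsub>M\<^esub>}" by auto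
    then show False using assms M.M.zero_closed unfolding irreducible_module_def by blast
  qed
  moreover have "finite ?A" using finite_I by simp
  moreover have "asymp_on ?A lt" "transp_on ?A lt"
    using lt_irrefl lt_trans unfolding asymp_on_def transp_on_def by blast+
  ultimately have "\<exists>i\<in>?A. \<forall>j\<in>?A. j \<noteq> i \<longrightarrow> \<not> lt j i"
    by (rule Finite_Set.bex_min_element(1)[rotated 3])
  then obtain i where i: "i \<in> ?A" "\<forall>j\<in>?A. j \<noteq> i \<longrightarrow> \<not> lt j i"
    by (rule bexE)
  have "e j \<odot>\<^bsub>M\<^esub> x = \<zero>\<^bsub>M\<^esub>" if "j \<in> I" "lt j i" "x \<in> carrier M" for j x
  proof (rule ccontr)
    assume "e j \<odot>\<^bsub>M\<^esub> x \<noteq> \<zero>\<^bsub>M\<^esub>"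
    then have "j \<in> ?A" using that by blast
    then have "j \<noteq> i \<longrightarrow> \<not> lt j i" by (rule bspec[OF i(2)])
    then show False using that(2) lt_irrefl[of i] by metis
  qed
  then show ?thesis unfolding apex_def using i(1) by blast
qed

lemma J_annihilates:
  assumes "left_module R M" "apex M i" "a \<in> J i" "x \<in> carrier M"
  shows "a \<odot>\<^bsub>M\<^esub> x = \<zero>\<^bsub>M\<^esub>"
proof -
  interpret M: left_module R M by fact
  have "e ` {j \<in> I. lt j i} \<subseteq> {a \<in> carrier R. \<forall>x\<in>carrier M. a \<odot>\<^bsub>M\<^esub> x = \<zero>\<^bsub>M\<^esub>}"
    using assms(2) e_closed unfolding apex_def by auto
  then have "J i \<subseteq> {a \<in> carrier R. \<forall>x\<in>carrier M. a \<odot>\<^bsub>M\<^esub> x = \<zero>\<^bsub>M\<^esub>}"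
    unfolding J_def by (rule genideal_minimal[OF M.annihilator_ideal])
  then show ?thesis using assms by blast
qed

lemma irreducible_isomorphic_V:
  assumes M: "irreducible_module R M" and ap: "apex M i"
  shows "module_isomorphic R (V i) M"
proof -
  interpret M: left_module R M using M unfolding irreducible_module_def by blast
  have i: "i \<in> I" using ap unfolding apex_def by blast
  note ei = e_closed[OF i]
  obtain x where x: "x \<in> carrier M" "e i \<odot>\<^bsub>M\<^esub> x \<noteq> \<zero>\<^bsub>M\<^esub>" using ap unfolding apex_def by blast
  define v where "v = e i \<odot>\<^bsub>M\<^esub> x"
  have v: "v \<in> carrier M" "v \<noteq> \<zero>\<^bsub>M\<^esub>" "e i \<odot>\<^bsub>M\<^esub> v = v"
    using x ei e_idem[OF i] by (auto simp: v_def M.smult_assoc1[symmetric])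
  have gen: "(\<lambda>a. a \<odot>\<^bsub>M\<^esub> w) ` carrier R = carrier M" if "w \<in> carrier M" "w \<noteq> \<zero>\<^bsub>M\<^esub>" for w
    using M.irreducible_cyclic[OF M that] .
  have "K i = {a \<in> carrier R. a \<odot>\<^bsub>M\<^esub> v = \<zero>\<^bsub>M\<^esub>}"
  proof (rule equalityI; rule subsetI)
    fix a assume a: "a \<in> K i"
    then have aR: "a \<in> carrier R" by (simp add: K_def)
    have "a \<odot>\<^bsub>M\<^esub> v = \<zero>\<^bsub>M\<^esub>"
    proof (rule ccontr)
      assume "a \<odot>\<^bsub>M\<^esub> v \<noteq> \<zero>\<^bsub>M\<^esub>"
      then have "v \<in> (\<lambda>b. b \<odot>\<^bsub>M\<^esub> (a \<odot>\<^bsub>M\<^esub> v)) ` carrier R" using gen[of "a \<odot>\<^bsub>M\<^esub> v"] v aR by simp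
      then obtain b where b: "b \<in> carrier R" "v = b \<odot>\<^bsub>M\<^esub> (a \<odot>\<^bsub>M\<^esub> v)" by blast
      have "(e i \<otimes> b \<otimes> a \<otimes> e i) \<odot>\<^bsub>M\<^esub> v = e i \<odot>\<^bsub>M\<^esub> (b \<odot>\<^bsub>M\<^esub> (a \<odot>\<^bsub>M\<^esub> v))"
        using aR b ei v(1) v(3) by (simp add: M.smult_assoc1)
      also have "\<dots> = v" using b v by simp
      finally show False using J_annihilates[OF M.left_module_axioms ap, of "e i \<otimes> b \<otimes> a \<otimes> e i" v] a b v
        unfolding K_def by simp
    qed
    then show "a \<in> {a \<in> carrier R. a \<odot>\<^bsub>M\<^esub> v = \<zero>\<^bsub>M\<^esub>}" using aR by simp
  next
    fix a assume "a \<in> {a \<in> carrier R. a \<odot>\<^bsub>M\<^esub> v = \<zero>\<^bsub>M\<^esub>}"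
    then have a: "a \<in> carrier R" "a \<odot>\<^bsub>M\<^esub> v = \<zero>\<^bsub>M\<^esub>" by auto
    show "a \<in> K i"
    proof (rule ccontr)
      assume "a \<notin> K i"
      then obtain y where y: "y \<in> carrier R" "y \<otimes> a \<otimes> e i \<ominus> e i \<in> J i"
        using left_inverse_mod_J[OF i a(1)] by blast
      have "(y \<otimes> a \<otimes> e i) \<odot>\<^bsub>M\<^esub> v = e i \<odot>\<^bsub>M\<^esub> v"
        using J_annihilates[OF M.left_module_axioms ap y(2) v(1)] y a ei v
        by (simp add: M.smult_diff_eq_zero_iff)
      then have "v = y \<odot>\<^bsub>M\<^esub> (a \<odot>\<^bsub>M\<^esub> v)" using v ei y a(1) by (simp add: M.smult_assoc1)
      then show False using v a y by (simp add: M.smult_zero_right)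
    qed
  qed
  then show ?thesis unfolding V_def using M.cyclic_module_isomorphic[OF v(1) gen[OF v(1,2)]] by blast
qed

lemma apex_V:
  assumes i: "i \<in> I" shows "apex (V i) i"
proof -
  interpret K: left_ideal R "K i" using left_ideal_K[OF i] .
  interpret V: left_module R "V i" unfolding V_def by (rule K.quotient_left_module)
  note ei = e_closed[OF i]
  have sm: "a \<odot>\<^bsub>V i\<^esub> (K i +> b) = \<zero>\<^bsub>V i\<^esub> \<longleftrightarrow> a \<otimes> b \<in> K i" if "a \<in> carrier R" "b \<in> carrier R" for a b
    using that by (simp add: V_def K.quotient_smult K.quotient_zero K.coset_eq_K_iff)
  interpret J: ideal "J i" R by (rule J_ideal)
  have "e j \<otimes> b \<in> K i" if "j \<in> I" "lt j i" "b \<in> carrier R" for j b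
  proof -
    have "e j \<in> J i" unfolding J_def using genideal_self[of "e ` {j \<in> I. lt j i}"] that e_closed by auto
    then show ?thesis using J.I_r_closed that J_subset_K[OF i] by blast
  qed
  then have "e j \<odot>\<^bsub>V i\<^esub> (K i +> b) = \<zero>\<^bsub>V i\<^esub>" if "j \<in> I" "lt j i" "b \<in> carrier R" for j b
    using that sm e_closed[of j] by blast
  then have "e j \<odot>\<^bsub>V i\<^esub> x = \<zero>\<^bsub>V i\<^esub>" if "j \<in> I" "lt j i" "x \<in> carrier (V i)" for j x
    using that(3) that(1,2) unfolding V_def K.quotient_carrier by blast
  moreover have "e i \<odot>\<^bsub>V i\<^esub> (K i +> e i) \<noteq> \<zero>\<^bsub>V i\<^esub>"
    using sm[OF ei ei] e_idem[OF i] e_notin_K[OF i] by simp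
  moreover have "K i +> e i \<in> carrier (V i)" unfolding V_def K.quotient_carrier using ei by blast
  ultimately show ?thesis unfolding apex_def using i by blast
qed

lemma apex_isomorphic:
  assumes M: "left_module R M" and N: "left_module R N" and iso: "module_isomorphic R M N" and ap: "apex M i"
  shows "apex N i"
proof -
  interpret M: left_module R M by fact
  interpret N: left_module R N by fact
  obtain h where h: "bij_betw h (carrier M) (carrier N)"
    "\<And>x y. x \<in> carrier M \<Longrightarrow> y \<in> carrier M \<Longrightarrow> h (x \<oplus>\<^bsub>M\<^esub> y) = h x \<oplus>\<^bsub>N\<^esub> h y"
    "\<And>a x. a \<in> carrier R \<Longrightarrow> x \<in> carrier M \<Longrightarrow> h (a \<odot>\<^bsub>M\<^esub> x) = a \<odot>\<^bsub>N\<^esub> h x"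
    using iso unfolding module_isomorphic_def by blast
  have hin: "h x \<in> carrier N" if "x \<in> carrier M" for x using h(1) that bij_betwE by blast
  have surj: "carrier N = h ` carrier M" using h(1) by (simp add: bij_betw_def)
  have h0: "h \<zero>\<^bsub>M\<^esub> = \<zero>\<^bsub>N\<^esub>"
    using h(3)[of \<zero> "\<zero>\<^bsub>M\<^esub>"] hin[of "\<zero>\<^bsub>M\<^esub>"] by (simp add: M.smult_zero_left N.smult_zero_left)
  have eq: "a \<odot>\<^bsub>N\<^esub> h x = \<zero>\<^bsub>N\<^esub> \<longleftrightarrow> a \<odot>\<^bsub>M\<^esub> x = \<zero>\<^bsub>M\<^esub>" if "a \<in> carrier R" "x \<in> carrier M" for a x
    using h(3)[OF that, symmetric] h0 bij_betw_imp_inj_on[OF h(1)] that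
    by (metis M.M.zero_closed M.smult_closed inj_onD)
  show ?thesis using ap eq e_closed unfolding apex_def surj by auto
qed

theorem irreducible_classes_bij:
  "bij_betw (\<lambda>i. {N :: ('a, 'a set) module. irreducible_module R N \<and> module_isomorphic R (V i) N}) I
     (irreducible_classes R)"
proof (rule bij_betwI')
  have lm: "left_module R M" if "irreducible_module R M" for M :: "('a, 'a set) module"
    using that unfolding irreducible_module_def by blast
  {
    fix i j assume ij: "i \<in> I" "j \<in> I"
    show "({N :: ('a, 'a set) module. irreducible_module R N \<and> module_isomorphic R (V i) N} =
           {N. irreducible_module R N \<and> module_isomorphic R (V j) N}) = (i = j)"
    proof
      assume "{N :: ('a, 'a set) module. irreducible_module R N \<and> module_isomorphic R (V i) N} =
           {N. irreducible_module R N \<and> module_isomorphic R (V j) N}"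
      then have "module_isomorphic R (V i) (V j)"
        using V_irreducible[OF ij(2)] module_isomorphic_refl by blast
      then have "apex (V j) i"
        using apex_isomorphic[OF lm lm _ apex_V] V_irreducible ij by blast
      then show "i = j" using apex_unique apex_V[OF ij(2)] by blast
    qed simp
  next
    fix i assume "i \<in> I"
    then show "{N :: ('a, 'a set) module. irreducible_module R N \<and> module_isomorphic R (V i) N} \<in> irreducible_classes R"
      unfolding irreducible_classes_def using V_irreducible by blast
  next
    fix C :: "('a, 'a set) module set" assume "C \<in> irreducible_classes R"
    then obtain M :: "('a, 'a set) module" where M: "irreducible_module R M"
      "C = {N. irreducible_module R N \<and> module_isomorphic R M N}"
      unfolding irreducible_classes_def by blast
    obtain i where i: "apex M i" using apex_exists[OF M(1)] by blast
    then have iI: "i \<in> I" by (simp add: apex_def)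
    have iso: "module_isomorphic R (V i) M" using irreducible_isomorphic_V[OF M(1) i] .
    have "module_isomorphic R M N \<longleftrightarrow> module_isomorphic R (V i) N" for N :: "('a, 'a set) module"
      using module_isomorphic_trans[OF iso] module_isomorphic_trans[OF module_isomorphic_sym[OF lm[OF V_irreducible[OF iI]] iso]]
      by blast
    then show "\<exists>i\<in>I. C = {N. irreducible_module R N \<and> module_isomorphic R (V i) N}"
      using M(2) iI by blast
  }
qed

theorem irreducible_isomorphic_to_quotient:
  assumes "irreducible_module R M"
  shows "\<exists>W :: ('a, 'a set) module. irreducible_module R W \<and> module_isomorphic R M W"
proof -
  obtain i where i: "apex M i" using apex_exists[OF assms] by blast
  then have iI: "i \<in> I" by (simp add: apex_def)
  have "left_module R (V i)" using V_irreducible[OF iI] unfolding irreducible_module_def by blast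
  then show ?thesis
    using V_irreducible[OF iI] module_isomorphic_sym[OF _ irreducible_isomorphic_V[OF assms i]] by blast
qed

end

subsection \<open>Double cosets of Young subgroups\<close>

abbreviation pinv :: "(nat \<Rightarrow> nat) \<Rightarrow> nat \<Rightarrow> nat" where "pinv \<equiv> inv_into UNIV"

lemma young_permutes: "\<pi> \<in> young_subgroup l \<Longrightarrow> \<pi> permutes {1..sum_list l}"
  by (simp add: young_subgroup_def)

lemma young_id: "id \<in> young_subgroup l"
  by (simp add: young_subgroup_def permutes_id)

lemma young_comp:
  assumes "\<sigma> \<in> young_subgroup l" "\<pi> \<in> young_subgroup l" shows "\<sigma> \<circ> \<pi> \<in> young_subgroup l"
  using assms unfolding young_subgroup_def
  by (simp only: mem_Collect_eq permutes_compose image_comp[symmetric] simp_thms) metis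

lemma young_pinv:
  assumes "\<pi> \<in> young_subgroup l" shows "pinv \<pi> \<in> young_subgroup l"
proof -
  have "pinv \<pi> ` block l i = block l i" if "i < length l" for i
  proof -
    have "inj \<pi>" using young_permutes[OF assms] by (rule permutes_inj)
    moreover have "\<pi> ` block l i = block l i" using assms that by (simp add: young_subgroup_def)
    ultimately show ?thesis using image_inv_f_f[of \<pi> "block l i"] by simp
  qed
  then show ?thesis using assms by (simp add: young_subgroup_def permutes_inv)
qed

lemma young_comp_pinv:
  assumes "\<pi> \<in> young_subgroup l"
  shows "\<pi> \<circ> pinv \<pi> = id" "pinv \<pi> \<circ> \<pi> = id"
  using permutes_inv_o[OF young_permutes[OF assms]] by auto

lemma young_cancel:
  assumes "\<pi> \<in> young_subgroup l"
  shows "\<pi> (pinv \<pi> x) = x" "pinv \<pi> (\<pi> x) = x"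
  using young_comp_pinv[OF assms] by (auto simp: fun_eq_iff)

lemma young_cancel_comp:
  assumes "\<pi> \<in> young_subgroup l"
  shows "\<pi> \<circ> (pinv \<pi> \<circ> f) = f" "pinv \<pi> \<circ> (\<pi> \<circ> f) = f"
  using assms by (auto simp: fun_eq_iff young_cancel)

lemma finite_young: "finite (young_subgroup l)"
  by (rule finite_subset[of _ "{\<pi>. \<pi> permutes {1..sum_list l}}"])
    (auto simp: young_subgroup_def finite_permutations)

lemma card_young_pos: "0 < card (young_subgroup l)"
  using finite_young young_id by (metis card_gt_0_iff empty_iff)

lemma in_double_coset:
  "x \<in> double_coset l \<alpha> m \<longleftrightarrow> (\<exists>\<sigma>\<in>young_subgroup l. \<exists>\<pi>\<in>young_subgroup m. x = \<sigma> \<circ> \<alpha> \<circ> \<pi>)"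
  unfolding double_coset_def by blast

lemma double_coset_self: "\<alpha> \<in> double_coset l \<alpha> m"
  unfolding in_double_coset using young_id by (metis comp_id id_comp)

lemma double_coset_sym:
  assumes "\<beta> \<in> double_coset l \<alpha> m" shows "\<alpha> \<in> double_coset l \<beta> m"
proof -
  obtain \<sigma> \<pi> where s: "\<sigma> \<in> young_subgroup l" "\<pi> \<in> young_subgroup m" "\<beta> = \<sigma> \<circ> \<alpha> \<circ> \<pi>"
    using assms unfolding in_double_coset by blast
  then have "\<alpha> = pinv \<sigma> \<circ> \<beta> \<circ> pinv \<pi>" by (auto simp: fun_eq_iff young_cancel)
  then show ?thesis unfolding in_double_coset using s young_pinv by blast
qed

lemma double_coset_trans:
  assumes "\<beta> \<in> double_coset l \<alpha> m" "\<gamma> \<in> double_coset l \<beta> m" shows "\<gamma> \<in> double_coset l \<alpha> m"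
proof -
  obtain \<sigma> \<pi> where s: "\<sigma> \<in> young_subgroup l" "\<pi> \<in> young_subgroup m" "\<beta> = \<sigma> \<circ> \<alpha> \<circ> \<pi>"
    using assms unfolding in_double_coset by blast
  obtain \<sigma>' \<pi>' where t: "\<sigma>' \<in> young_subgroup l" "\<pi>' \<in> young_subgroup m" "\<gamma> = \<sigma>' \<circ> \<beta> \<circ> \<pi>'"
    using assms unfolding in_double_coset by blast
  have "\<gamma> = (\<sigma>' \<circ> \<sigma>) \<circ> \<alpha> \<circ> (\<pi> \<circ> \<pi>')" using s t by (simp add: comp_assoc)
  then show ?thesis unfolding in_double_coset using s t young_comp by blast
qed

lemma double_coset_eq_iff: "double_coset l \<beta> m = double_coset l \<alpha> m \<longleftrightarrow> \<beta> \<in> double_coset l \<alpha> m"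
proof
  show "double_coset l \<beta> m = double_coset l \<alpha> m" if "\<beta> \<in> double_coset l \<alpha> m"
    using that double_coset_sym double_coset_trans by blast
qed (use double_coset_self in blast)

lemma in_double_cosets_iff:
  assumes "E \<in> double_cosets S l m" shows "x \<in> E \<longleftrightarrow> E = double_coset l x m"
  using assms double_coset_eq_iff double_coset_self unfolding double_cosets_def by blast

lemma coset_rep_in: "coset_rep (double_coset l \<alpha> m) \<in> double_coset l \<alpha> m"
  unfolding coset_rep_def by (rule someI[of "\<lambda>x. x \<in> double_coset l \<alpha> m"], rule double_coset_self)

subsection \<open>Stabilisers and structure constants\<close>

lemma G_R_subset: "G_R l \<alpha> m \<subseteq> young_subgroup l"
  unfolding G_R_def by blast

lemma finite_G_R: "finite (G_R l \<alpha> m)"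
  using G_R_subset finite_young by (rule finite_subset)

lemma G_R_id: "id \<in> G_R l \<alpha> m"
  by (auto simp: G_R_def young_id intro!: bexI[of _ id])

lemma G_R_comp:
  assumes "\<sigma> \<in> G_R l \<alpha> m" "\<tau> \<in> G_R l \<alpha> m" shows "\<sigma> \<circ> \<tau> \<in> G_R l \<alpha> m"
proof -
  obtain \<pi> \<pi>' where "\<pi> \<in> young_subgroup m" "\<sigma> \<circ> \<alpha> = \<alpha> \<circ> \<pi>" "\<pi>' \<in> young_subgroup m" "\<tau> \<circ> \<alpha> = \<alpha> \<circ> \<pi>'"
    using assms unfolding G_R_def by blast
  then show ?thesis unfolding G_R_def using assms
    by (auto simp: G_R_def young_comp fun_eq_iff intro!: bexI[of _ "\<pi> \<circ> \<pi>'"])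
qed

lemma G_R_pinv:
  assumes "\<sigma> \<in> G_R l \<alpha> m" shows "pinv \<sigma> \<in> G_R l \<alpha> m"
proof -
  obtain \<pi> where p: "\<pi> \<in> young_subgroup m" "\<sigma> \<circ> \<alpha> = \<alpha> \<circ> \<pi>" and s: "\<sigma> \<in> young_subgroup l"
    using assms unfolding G_R_def by blast
  have "pinv \<sigma> (\<alpha> x) = \<alpha> (pinv \<pi> x)" for x
  proof -
    have "\<sigma> (\<alpha> (pinv \<pi> x)) = \<alpha> x" using p by (metis comp_apply young_cancel(1))
    then show ?thesis using s by (metis young_cancel(2))
  qed
  then show ?thesis unfolding G_R_def using p s young_pinv by (auto simp: fun_eq_iff)
qed

lemma n_R_pos: "0 < n_R l \<alpha> m"
  unfolding n_R_def using finite_G_R G_R_id by (metis card_gt_0_iff empty_iff)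

lemma card_dvd_right_invariant:
  fixes A K :: "('a \<Rightarrow> 'a) set"
  assumes A: "finite A" "\<And>a. a \<in> A \<Longrightarrow> inj a"
    and K: "id \<in> K" "\<And>k k'. k \<in> K \<Longrightarrow> k' \<in> K \<Longrightarrow> k \<circ> k' \<in> K" "\<And>k. k \<in> K \<Longrightarrow> \<exists>k'\<in>K. k \<circ> k' = id"
    and AK: "\<And>a k. a \<in> A \<Longrightarrow> k \<in> K \<Longrightarrow> a \<circ> k \<in> A"
  shows "card K dvd card A"
proof -
  let ?r = "{(a, b). a \<in> A \<and> b \<in> A \<and> (\<exists>k\<in>K. b = a \<circ> k)}"
  have equiv: "equiv A ?r"
  proof (rule equivI)
    show "refl_on A ?r" using K(1) by (auto simp: refl_on_def intro!: bexI[of _ id])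
    show "sym ?r"
    proof (rule symI)
      fix a b assume "(a, b) \<in> ?r"
      then obtain k where k: "a \<in> A" "k \<in> K" "b \<in> A" "b = a \<circ> k" by blast
      obtain k' where "k' \<in> K" "k \<circ> k' = id" using K(3)[OF k(2)] by blast
      then have "a = b \<circ> k'" using k(4) by (metis comp_assoc comp_id)
      then show "(b, a) \<in> ?r" using k \<open>k' \<in> K\<close> by blast
    qed
    show "trans ?r" using K(2) by (auto simp: trans_def comp_assoc)
  qed auto
  show ?thesis
  proof (rule equiv_imp_dvd_card[OF A(1) equiv])
    fix C assume "C \<in> A // ?r"
    then obtain a where a: "a \<in> A" "C = ?r `` {a}" by (auto elim: quotientE)
    then have "C = (\<lambda>k. a \<circ> k) ` K" using AK by auto
    moreover have "inj_on (\<lambda>k. a \<circ> k) K" using A(2)[OF a(1)] by (auto simp: inj_on_def fun_eq_iff)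
    ultimately show "card K dvd card C" by (simp add: card_image)
  qed
qed

lemma sum_dvd_right_invariant:
  fixes A K :: "('a \<Rightarrow> 'a) set" and g :: "('a \<Rightarrow> 'a) \<Rightarrow> nat"
  assumes A: "finite A" "\<And>a. a \<in> A \<Longrightarrow> inj a"
    and K: "id \<in> K" "\<And>k k'. k \<in> K \<Longrightarrow> k' \<in> K \<Longrightarrow> k \<circ> k' \<in> K" "\<And>k. k \<in> K \<Longrightarrow> \<exists>k'\<in>K. k \<circ> k' = id"
    and AK: "\<And>a k. a \<in> A \<Longrightarrow> k \<in> K \<Longrightarrow> a \<circ> k \<in> A"
    and g: "\<And>a k. a \<in> A \<Longrightarrow> k \<in> K \<Longrightarrow> g (a \<circ> k) = g a" "\<And>a. a \<in> A \<Longrightarrow> d dvd g a"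
  shows "card K * d dvd (\<Sum>a\<in>A. g a)"
proof -
  have "(\<Sum>a\<in>A. g a) = (\<Sum>v\<in>g ` A. \<Sum>a\<in>{a \<in> A. g a = v}. g a)"
    using A(1) by (rule sum.image_gen)
  also have "\<dots> = (\<Sum>v\<in>g ` A. card {a \<in> A. g a = v} * v)" by simp
  also have "card K * d dvd \<dots>"
  proof (rule dvd_sum, rule mult_dvd_mono)
    fix v assume "v \<in> g ` A"
    show "card K dvd card {a \<in> A. g a = v}"
      by (rule card_dvd_right_invariant) (use assms in auto)
    show "d dvd v" using \<open>v \<in> g ` A\<close> g(2) by auto
  qed
  finally show ?thesis .
qed

definition pair_count where
  "pair_count l \<alpha> v \<beta> m \<gamma> = card {(\<sigma>, \<rho>). \<sigma> \<in> young_subgroup l \<and> \<rho> \<in> young_subgroup v \<and>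
     (\<exists>\<pi>\<in>young_subgroup m. \<sigma> \<circ> \<alpha> \<circ> \<rho> \<circ> \<beta> = \<gamma> \<circ> \<pi>)}"

lemma pair_count_sum_left:
  "pair_count l \<alpha> v \<beta> m \<gamma> = (\<Sum>\<sigma>\<in>young_subgroup l.
     card {\<rho> \<in> young_subgroup v. \<exists>\<pi>\<in>young_subgroup m. \<sigma> \<circ> \<alpha> \<circ> \<rho> \<circ> \<beta> = \<gamma> \<circ> \<pi>})"
proof -
  have "{(\<sigma>, \<rho>). \<sigma> \<in> young_subgroup l \<and> \<rho> \<in> young_subgroup v \<and>
     (\<exists>\<pi>\<in>young_subgroup m. \<sigma> \<circ> \<alpha> \<circ> \<rho> \<circ> \<beta> = \<gamma> \<circ> \<pi>)} =
     (SIGMA \<sigma>:young_subgroup l. {\<rho> \<in> young_subgroup v. \<exists>\<pi>\<in>young_subgroup m. \<sigma> \<circ> \<alpha> \<circ> \<rho> \<circ> \<beta> = \<gamma> \<circ> \<pi>})"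
    by auto
  then show ?thesis unfolding pair_count_def by (simp add: card_SigmaI finite_young)
qed

lemma pair_count_sum_right:
  "pair_count l \<alpha> v \<beta> m \<gamma> = (\<Sum>\<rho>\<in>young_subgroup v.
     card {\<sigma> \<in> young_subgroup l. \<exists>\<pi>\<in>young_subgroup m. \<sigma> \<circ> \<alpha> \<circ> \<rho> \<circ> \<beta> = \<gamma> \<circ> \<pi>})"
proof -
  have "{(\<sigma>, \<rho>). \<sigma> \<in> young_subgroup l \<and> \<rho> \<in> young_subgroup v \<and>
     (\<exists>\<pi>\<in>young_subgroup m. \<sigma> \<circ> \<alpha> \<circ> \<rho> \<circ> \<beta> = \<gamma> \<circ> \<pi>)} =
     prod.swap ` (SIGMA \<rho>:young_subgroup v. {\<sigma> \<in> young_subgroup l. \<exists>\<pi>\<in>young_subgroup m. \<sigma> \<circ> \<alpha> \<circ> \<rho> \<circ> \<beta> = \<gamma> \<circ> \<pi>})"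
    by (auto simp: image_def)
  then show ?thesis unfolding pair_count_def by (simp add: card_SigmaI finite_young card_image)
qed

lemma dvd_pair_count: "n_R l \<alpha> v * n_R v \<beta> m dvd pair_count l \<alpha> v \<beta> m \<gamma>"
  unfolding pair_count_sum_left n_R_def
proof (rule sum_dvd_right_invariant)
  fix \<sigma> \<kappa> assume s: "\<sigma> \<in> young_subgroup l" "\<kappa> \<in> G_R l \<alpha> v"
  then show "\<sigma> \<circ> \<kappa> \<in> young_subgroup l" using G_R_subset young_comp by blast
  obtain \<pi> where p: "\<pi> \<in> young_subgroup v" "\<kappa> \<circ> \<alpha> = \<alpha> \<circ> \<pi>" using s unfolding G_R_def by blast
  have eq: "\<sigma> \<circ> \<kappa> \<circ> \<alpha> \<circ> \<rho> \<circ> \<beta> = \<sigma> \<circ> \<alpha> \<circ> (\<pi> \<circ> \<rho>) \<circ> \<beta>" for \<rho>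
    using p(2) by (metis comp_assoc)
  have "bij_betw (\<lambda>\<rho>. \<pi> \<circ> \<rho>)
     {\<rho> \<in> young_subgroup v. \<exists>\<pi>\<in>young_subgroup m. \<sigma> \<circ> \<kappa> \<circ> \<alpha> \<circ> \<rho> \<circ> \<beta> = \<gamma> \<circ> \<pi>}
     {\<rho> \<in> young_subgroup v. \<exists>\<pi>\<in>young_subgroup m. \<sigma> \<circ> \<alpha> \<circ> \<rho> \<circ> \<beta> = \<gamma> \<circ> \<pi>}"
    by (rule bij_betw_byWitness[where f' = "\<lambda>\<rho>. pinv \<pi> \<circ> \<rho>"])
      (use p young_pinv in \<open>auto simp: eq[simplified comp_assoc] young_comp comp_assoc young_cancel_comp\<close>)
  then show "card {\<rho> \<in> young_subgroup v. \<exists>\<pi>\<in>young_subgroup m. \<sigma> \<circ> \<kappa> \<circ> \<alpha> \<circ> \<rho> \<circ> \<beta> = \<gamma> \<circ> \<pi>} =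
    card {\<rho> \<in> young_subgroup v. \<exists>\<pi>\<in>young_subgroup m. \<sigma> \<circ> \<alpha> \<circ> \<rho> \<circ> \<beta> = \<gamma> \<circ> \<pi>}"
    by (rule bij_betw_same_card)
next
  fix \<sigma> assume "\<sigma> \<in> young_subgroup l"
  show "card (G_R v \<beta> m) dvd card {\<rho> \<in> young_subgroup v. \<exists>\<pi>\<in>young_subgroup m. \<sigma> \<circ> \<alpha> \<circ> \<rho> \<circ> \<beta> = \<gamma> \<circ> \<pi>}"
  proof (rule card_dvd_right_invariant)
    fix \<rho> \<kappa> assume "\<rho> \<in> {\<rho> \<in> young_subgroup v. \<exists>\<pi>\<in>young_subgroup m. \<sigma> \<circ> \<alpha> \<circ> \<rho> \<circ> \<beta> = \<gamma> \<circ> \<pi>}" "\<kappa> \<in> G_R v \<beta> m"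
    then obtain \<pi> \<pi>' where r: "\<rho> \<in> young_subgroup v" "\<pi> \<in> young_subgroup m" "\<sigma> \<circ> \<alpha> \<circ> \<rho> \<circ> \<beta> = \<gamma> \<circ> \<pi>"
      "\<kappa> \<in> young_subgroup v" "\<pi>' \<in> young_subgroup m" "\<kappa> \<circ> \<beta> = \<beta> \<circ> \<pi>'" unfolding G_R_def by blast
    have "\<sigma> \<circ> \<alpha> \<circ> (\<rho> \<circ> \<kappa>) \<circ> \<beta> = \<gamma> \<circ> (\<pi> \<circ> \<pi>')" using r by (metis comp_assoc)
    then show "\<rho> \<circ> \<kappa> \<in> {\<rho> \<in> young_subgroup v. \<exists>\<pi>\<in>young_subgroup m. \<sigma> \<circ> \<alpha> \<circ> \<rho> \<circ> \<beta> = \<gamma> \<circ> \<pi>}"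
      using r young_comp by blast
  next
    fix k assume "k \<in> G_R v \<beta> m"
    then show "\<exists>k'\<in>G_R v \<beta> m. k \<circ> k' = id"
      using G_R_pinv G_R_subset young_comp_pinv by blast
  qed (auto simp: finite_young G_R_id G_R_comp dest: young_permutes permutes_inj)
next
  fix k assume "k \<in> G_R l \<alpha> v"
  then show "\<exists>k'\<in>G_R l \<alpha> v. k \<circ> k' = id"
    using G_R_pinv G_R_subset young_comp_pinv by blast
qed (auto simp: finite_young G_R_id G_R_comp dest: young_permutes permutes_inj)

lemma pair_count_eq:
  "n_R l \<gamma> m * card {\<rho> \<in> young_subgroup v. \<alpha> \<circ> \<rho> \<circ> \<beta> \<in> double_coset l \<gamma> m} = pair_count l \<alpha> v \<beta> m \<gamma>"
proof -
  have "card {\<sigma> \<in> young_subgroup l. \<exists>\<pi>\<in>young_subgroup m. \<sigma> \<circ> \<alpha> \<circ> \<rho> \<circ> \<beta> = \<gamma> \<circ> \<pi>} =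
     (if \<alpha> \<circ> \<rho> \<circ> \<beta> \<in> double_coset l \<gamma> m then n_R l \<gamma> m else 0)" (is "card ?A = _") for \<rho>
  proof (cases "\<alpha> \<circ> \<rho> \<circ> \<beta> \<in> double_coset l \<gamma> m")
    case True
    then obtain \<sigma>0 \<pi>0 where s: "\<sigma>0 \<in> young_subgroup l" "\<pi>0 \<in> young_subgroup m" "\<alpha> \<circ> \<rho> \<circ> \<beta> = \<sigma>0 \<circ> \<gamma> \<circ> \<pi>0"
      unfolding in_double_coset by blast
    have "(\<exists>\<pi>\<in>young_subgroup m. \<sigma> \<circ> \<alpha> \<circ> \<rho> \<circ> \<beta> = \<gamma> \<circ> \<pi>) \<longleftrightarrow> (\<exists>\<pi>\<in>young_subgroup m. (\<sigma> \<circ> \<sigma>0) \<circ> \<gamma> = \<gamma> \<circ> \<pi>)" for \<sigma>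
    proof -
      have eq: "\<sigma> \<circ> \<alpha> \<circ> \<rho> \<circ> \<beta> = \<sigma> \<circ> \<sigma>0 \<circ> \<gamma> \<circ> \<pi>0" using s(3) by (metis comp_assoc)
      show ?thesis
      proof
        assume "\<exists>\<pi>\<in>young_subgroup m. \<sigma> \<circ> \<alpha> \<circ> \<rho> \<circ> \<beta> = \<gamma> \<circ> \<pi>"
        then obtain \<pi> where "\<pi> \<in> young_subgroup m" "\<sigma> \<circ> \<sigma>0 \<circ> \<gamma> \<circ> \<pi>0 = \<gamma> \<circ> \<pi>" unfolding eq by blast
        then have "\<sigma> \<circ> \<sigma>0 \<circ> \<gamma> = \<gamma> \<circ> (\<pi> \<circ> pinv \<pi>0)"
          using young_comp_pinv(1)[OF s(2)] by (metis comp_assoc comp_id)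
        then show "\<exists>\<pi>\<in>young_subgroup m. (\<sigma> \<circ> \<sigma>0) \<circ> \<gamma> = \<gamma> \<circ> \<pi>"
          using \<open>\<pi> \<in> young_subgroup m\<close> s young_comp young_pinv by blast
      next
        assume "\<exists>\<pi>\<in>young_subgroup m. (\<sigma> \<circ> \<sigma>0) \<circ> \<gamma> = \<gamma> \<circ> \<pi>"
        then obtain \<pi> where "\<pi> \<in> young_subgroup m" "(\<sigma> \<circ> \<sigma>0) \<circ> \<gamma> = \<gamma> \<circ> \<pi>" by blast
        then have "\<sigma> \<circ> \<sigma>0 \<circ> \<gamma> \<circ> \<pi>0 = \<gamma> \<circ> (\<pi> \<circ> \<pi>0)" by (metis comp_assoc)
        then show "\<exists>\<pi>\<in>young_subgroup m. \<sigma> \<circ> \<alpha> \<circ> \<rho> \<circ> \<beta> = \<gamma> \<circ> \<pi>"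
          unfolding eq using \<open>\<pi> \<in> young_subgroup m\<close> s young_comp by blast
      qed
    qed
    then have "bij_betw (\<lambda>\<sigma>. \<sigma> \<circ> \<sigma>0) ?A (G_R l \<gamma> m)"
      unfolding G_R_def
      by (intro bij_betw_byWitness[where f' = "\<lambda>\<sigma>. \<sigma> \<circ> pinv \<sigma>0"])
        (use s young_pinv in \<open>auto simp: young_comp comp_assoc young_comp_pinv young_cancel_comp\<close>)
    then show ?thesis using True by (simp add: n_R_def bij_betw_same_card)
  next
    case False
    have "?A = {}"
    proof (rule ccontr)
      assume "?A \<noteq> {}"
      then obtain \<sigma> \<pi> where s: "\<sigma> \<in> young_subgroup l" "\<pi> \<in> young_subgroup m" "\<sigma> \<circ> \<alpha> \<circ> \<rho> \<circ> \<beta> = \<gamma> \<circ> \<pi>" by blast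
      then have "\<alpha> \<circ> \<rho> \<circ> \<beta> = pinv \<sigma> \<circ> \<gamma> \<circ> \<pi>"
        using young_comp_pinv(2)[OF s(1)] by (metis comp_assoc id_comp)
      then show False using False s young_pinv unfolding in_double_coset by blast
    qed
    then show ?thesis using False by (simp only: if_False card.empty)
  qed
  then show ?thesis unfolding pair_count_sum_right
    by (simp add: sum.If_cases finite_young Int_def mult.commute)
qed

lemma n_R_cong:
  assumes "\<beta> \<in> double_coset l \<alpha> m" shows "n_R l \<beta> m = n_R l \<alpha> m"
proof -
  obtain \<sigma> \<pi> where s: "\<sigma> \<in> young_subgroup l" "\<pi> \<in> young_subgroup m" "\<beta> = \<sigma> \<circ> \<alpha> \<circ> \<pi>"
    using assms unfolding in_double_coset by blast
  have "(\<exists>\<pi>'\<in>young_subgroup m. \<tau> \<circ> \<beta> = \<beta> \<circ> \<pi>') \<longleftrightarrow> (\<exists>\<pi>'\<in>young_subgroup m. (pinv \<sigma> \<circ> \<tau> \<circ> \<sigma>) \<circ> \<alpha> = \<alpha> \<circ> \<pi>')" for \<tau>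
  proof
    assume "\<exists>\<pi>'\<in>young_subgroup m. \<tau> \<circ> \<beta> = \<beta> \<circ> \<pi>'"
    then obtain \<pi>' where p: "\<pi>' \<in> young_subgroup m" "\<tau> \<circ> \<beta> = \<beta> \<circ> \<pi>'" by blast
    have "pinv \<sigma> (\<tau> (\<sigma> (\<alpha> x))) = \<alpha> ((\<pi> \<circ> \<pi>' \<circ> pinv \<pi>) x)" for x
    proof -
      have "\<tau> (\<beta> (pinv \<pi> x)) = \<beta> (\<pi>' (pinv \<pi> x))" using p by (metis comp_apply)
      then show ?thesis using s by (simp add: young_cancel)
    qed
    then show "\<exists>\<pi>'\<in>young_subgroup m. (pinv \<sigma> \<circ> \<tau> \<circ> \<sigma>) \<circ> \<alpha> = \<alpha> \<circ> \<pi>'"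
      using p s young_comp young_pinv by (intro bexI[of _ "\<pi> \<circ> \<pi>' \<circ> pinv \<pi>"]) (auto simp: fun_eq_iff)
  next
    assume "\<exists>\<pi>'\<in>young_subgroup m. (pinv \<sigma> \<circ> \<tau> \<circ> \<sigma>) \<circ> \<alpha> = \<alpha> \<circ> \<pi>'"
    then obtain \<pi>' where p: "\<pi>' \<in> young_subgroup m" "(pinv \<sigma> \<circ> \<tau> \<circ> \<sigma>) \<circ> \<alpha> = \<alpha> \<circ> \<pi>'" by blast
    have "\<tau> (\<beta> x) = \<beta> ((pinv \<pi> \<circ> \<pi>' \<circ> \<pi>) x)" for x
    proof -
      have "pinv \<sigma> (\<tau> (\<sigma> (\<alpha> (\<pi> x)))) = \<alpha> (\<pi>' (\<pi> x))" using p by (metis comp_apply)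
      then have "\<tau> (\<sigma> (\<alpha> (\<pi> x))) = \<sigma> (\<alpha> (\<pi>' (\<pi> x)))" using s by (metis young_cancel(1))
      then show ?thesis using s by (simp add: young_cancel)
    qed
    then show "\<exists>\<pi>'\<in>young_subgroup m. \<tau> \<circ> \<beta> = \<beta> \<circ> \<pi>'"
      using p s young_comp young_pinv by (intro bexI[of _ "pinv \<pi> \<circ> \<pi>' \<circ> \<pi>"]) (auto simp: fun_eq_iff)
  qed
  then have "bij_betw (\<lambda>\<tau>. pinv \<sigma> \<circ> \<tau> \<circ> \<sigma>) (G_R l \<beta> m) (G_R l \<alpha> m)"
    unfolding G_R_def
    by (intro bij_betw_byWitness[where f' = "\<lambda>\<tau>. \<sigma> \<circ> \<tau> \<circ> pinv \<sigma>"])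
      (use s young_pinv in \<open>auto simp: young_comp comp_assoc young_comp_pinv young_cancel_comp\<close>)
  then show ?thesis by (simp add: n_R_def bij_betw_same_card)
qed

lemma N_cong:
  assumes "\<alpha>' \<in> double_coset l \<alpha> v" "\<beta>' \<in> double_coset v \<beta> m"
  shows "card {\<rho> \<in> young_subgroup v. \<alpha>' \<circ> \<rho> \<circ> \<beta>' \<in> double_coset l \<gamma> m} =
         card {\<rho> \<in> young_subgroup v. \<alpha> \<circ> \<rho> \<circ> \<beta> \<in> double_coset l \<gamma> m}"
proof -
  obtain \<sigma> \<pi> where s: "\<sigma> \<in> young_subgroup l" "\<pi> \<in> young_subgroup v" "\<alpha>' = \<sigma> \<circ> \<alpha> \<circ> \<pi>"
    using assms(1) unfolding in_double_coset by blast
  obtain \<pi>' \<tau> where t: "\<pi>' \<in> young_subgroup v" "\<tau> \<in> young_subgroup m" "\<beta>' = \<pi>' \<circ> \<beta> \<circ> \<tau>"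
    using assms(2) unfolding in_double_coset by blast
  have *: "\<sigma> \<circ> x \<circ> \<tau> \<in> double_coset l \<gamma> m \<longleftrightarrow> x \<in> double_coset l \<gamma> m" for x
  proof -
    have "\<sigma> \<circ> x \<circ> \<tau> \<in> double_coset l x m" unfolding in_double_coset using s t by blast
    then show ?thesis using double_coset_sym double_coset_trans by blast
  qed
  have "\<alpha>' \<circ> \<rho> \<circ> \<beta>' \<in> double_coset l \<gamma> m \<longleftrightarrow> \<alpha> \<circ> (\<pi> \<circ> \<rho> \<circ> \<pi>') \<circ> \<beta> \<in> double_coset l \<gamma> m" for \<rho>
    using *[of "\<alpha> \<circ> (\<pi> \<circ> \<rho> \<circ> \<pi>') \<circ> \<beta>"] s t by (simp add: comp_assoc)
  then have "bij_betw (\<lambda>\<rho>. \<pi> \<circ> \<rho> \<circ> \<pi>')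
      {\<rho> \<in> young_subgroup v. \<alpha>' \<circ> \<rho> \<circ> \<beta>' \<in> double_coset l \<gamma> m}
      {\<rho> \<in> young_subgroup v. \<alpha> \<circ> \<rho> \<circ> \<beta> \<in> double_coset l \<gamma> m}"
    by (intro bij_betw_byWitness[where f' = "\<lambda>\<rho>. pinv \<pi> \<circ> \<rho> \<circ> pinv \<pi>'"])
      (use s t young_pinv in \<open>auto simp: young_comp comp_assoc young_comp_pinv young_cancel_comp\<close>)
  then show ?thesis by (rule bij_betw_same_card)
qed

lemma schur_coeff_mult:
  "schur_coeff (l, double_coset l \<alpha> v, v) (v, double_coset v \<beta> m, m) (l, double_coset l \<gamma> m, m)
     * (n_R l \<alpha> v * n_R v \<beta> m) = pair_count l \<alpha> v \<beta> m \<gamma>"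
proof -
  have "n_R_coset l (double_coset l \<alpha> m) m = n_R l \<alpha> m" for l \<alpha> m
    unfolding n_R_coset_def using n_R_cong[OF coset_rep_in] .
  moreover have "n_R l \<gamma> m * N_coset v (double_coset l \<alpha> v) (double_coset v \<beta> m) (double_coset l \<gamma> m) =
      pair_count l \<alpha> v \<beta> m \<gamma>"
    unfolding N_coset_def N_cong[OF coset_rep_in coset_rep_in] by (rule pair_count_eq)
  ultimately show ?thesis using dvd_pair_count by simp
qed

lemma schur_coeff_coset:
  assumes "D1 \<in> double_cosets S l v" "D2 \<in> double_cosets S v m" "D \<in> double_cosets S l m"
  shows "real (schur_coeff (l, D1, v) (v, D2, m) (l, D, m)) =
    real (n_R_coset l D m) * real (N_coset v D1 D2 D) / (real (n_R_coset l D1 v) * real (n_R_coset v D2 m))"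
proof -
  obtain \<alpha> \<beta> \<gamma> where D: "D1 = double_coset l \<alpha> v" "D2 = double_coset v \<beta> m" "D = double_coset l \<gamma> m"
    using assms unfolding double_cosets_def by blast
  have n: "n_R_coset l (double_coset l \<alpha> m) m = n_R l \<alpha> m" for l \<alpha> m
    unfolding n_R_coset_def using n_R_cong[OF coset_rep_in] .
  have "n_R l \<gamma> m * N_coset v D1 D2 D = pair_count l \<alpha> v \<beta> m \<gamma>"
    unfolding N_coset_def D N_cong[OF coset_rep_in coset_rep_in] by (rule pair_count_eq)
  then have "real (schur_coeff (l, D1, v) (v, D2, m) (l, D, m)) * (real (n_R l \<alpha> v) * real (n_R v \<beta> m)) =
    real (n_R l \<gamma> m) * real (N_coset v D1 D2 D)"
    using schur_coeff_mult[of l \<alpha> v \<beta> m \<gamma>] unfolding D by (metis of_nat_mult)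
  moreover have "real (n_R l \<alpha> v) * real (n_R v \<beta> m) \<noteq> 0" using n_R_pos by (simp add: less_imp_neq[symmetric])
  ultimately show ?thesis unfolding D n by (simp add: nonzero_eq_divide_eq)
qed

subsection \<open>Algebras given by structure constants\<close>

definition structure_algebra :: "'b set \<Rightarrow> ('b \<Rightarrow> 'b \<Rightarrow> 'b \<Rightarrow> nat) \<Rightarrow> 'b set \<Rightarrow> ('b \<Rightarrow> 'k::field) ring" where
  "structure_algebra B C U =
     \<lparr>carrier = {x. \<forall>c. c \<notin> B \<longrightarrow> x c = 0},
      monoid.mult = (\<lambda>x y c. if c \<in> B then \<Sum>a\<in>B. \<Sum>b\<in>B. x a * y b * of_nat (C a b c) else 0),
      one = (\<lambda>c. if c \<in> U then 1 else 0),
      ring.zero = (\<lambda>c. 0),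
      ring.add = (\<lambda>x y c. x c + y c)\<rparr>"

locale structure_constants =
  fixes B :: "'b set" and C :: "'b \<Rightarrow> 'b \<Rightarrow> 'b \<Rightarrow> nat" and U :: "'b set"
  assumes finite_B: "finite B" and U_subset: "U \<subseteq> B"
    and assoc: "a \<in> B \<Longrightarrow> b \<in> B \<Longrightarrow> c \<in> B \<Longrightarrow> d \<in> B \<Longrightarrow>
      (\<Sum>e\<in>B. C a b e * C e c d) = (\<Sum>e\<in>B. C b c e * C a e d)"
    and unit_left: "b \<in> B \<Longrightarrow> c \<in> B \<Longrightarrow> (\<Sum>u\<in>U. C u b c) = (if b = c then 1 else 0)"
    and unit_right: "b \<in> B \<Longrightarrow> c \<in> B \<Longrightarrow> (\<Sum>u\<in>U. C b u c) = (if b = c then 1 else 0)"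
begin

lemma sum4_swap:
  fixes f :: "'b \<Rightarrow> 'b \<Rightarrow> 'b \<Rightarrow> 'b \<Rightarrow> 'k::field"
  shows "(\<Sum>e\<in>B. \<Sum>c\<in>B. \<Sum>a\<in>B. \<Sum>b\<in>B. f a b c e) = (\<Sum>a\<in>B. \<Sum>b\<in>B. \<Sum>c\<in>B. \<Sum>e\<in>B. f a b c e)"
proof -
  have "(\<Sum>e\<in>B. \<Sum>c\<in>B. \<Sum>a\<in>B. \<Sum>b\<in>B. f a b c e) = (\<Sum>c\<in>B. \<Sum>e\<in>B. \<Sum>a\<in>B. \<Sum>b\<in>B. f a b c e)" by (rule sum.swap)
  also have "\<dots> = (\<Sum>c\<in>B. \<Sum>a\<in>B. \<Sum>e\<in>B. \<Sum>b\<in>B. f a b c e)" by (rule sum.cong[OF refl], rule sum.swap)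
  also have "\<dots> = (\<Sum>a\<in>B. \<Sum>c\<in>B. \<Sum>e\<in>B. \<Sum>b\<in>B. f a b c e)" by (rule sum.swap)
  also have "\<dots> = (\<Sum>a\<in>B. \<Sum>c\<in>B. \<Sum>b\<in>B. \<Sum>e\<in>B. f a b c e)" by (rule sum.cong[OF refl], rule sum.cong[OF refl], rule sum.swap)
  also have "\<dots> = (\<Sum>a\<in>B. \<Sum>b\<in>B. \<Sum>c\<in>B. \<Sum>e\<in>B. f a b c e)" by (rule sum.cong[OF refl], rule sum.swap)
  finally show ?thesis .
qed

lemma structure_algebra_assoc:
  fixes x y z :: "'b \<Rightarrow> 'k::field"
  assumes "d \<in> B"
  shows "(\<Sum>e\<in>B. \<Sum>c\<in>B. (\<Sum>a\<in>B. \<Sum>b\<in>B. x a * y b * of_nat (C a b e)) * z c * of_nat (C e c d)) =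
         (\<Sum>a\<in>B. \<Sum>e\<in>B. x a * (\<Sum>b\<in>B. \<Sum>c\<in>B. y b * z c * of_nat (C b c e)) * of_nat (C a e d))"
proof -
  have "(\<Sum>e\<in>B. \<Sum>c\<in>B. (\<Sum>a\<in>B. \<Sum>b\<in>B. x a * y b * of_nat (C a b e)) * z c * of_nat (C e c d)) =
      (\<Sum>e\<in>B. \<Sum>c\<in>B. \<Sum>a\<in>B. \<Sum>b\<in>B. x a * y b * z c * of_nat (C a b e * C e c d))"
    by (simp add: sum_distrib_left sum_distrib_right mult_ac)
  also have "\<dots> = (\<Sum>a\<in>B. \<Sum>b\<in>B. \<Sum>c\<in>B. \<Sum>e\<in>B. x a * y b * z c * of_nat (C a b e * C e c d))"
    by (rule sum4_swap)
  also have "\<dots> = (\<Sum>a\<in>B. \<Sum>b\<in>B. \<Sum>c\<in>B. x a * y b * z c * of_nat (\<Sum>e\<in>B. C a b e * C e c d))"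
    by (simp add: sum_distrib_left)
  also have "\<dots> = (\<Sum>a\<in>B. \<Sum>b\<in>B. \<Sum>c\<in>B. x a * y b * z c * of_nat (\<Sum>e\<in>B. C b c e * C a e d))"
    by (intro sum.cong refl) (simp only: assoc[OF _ _ _ assms])
  also have "\<dots> = (\<Sum>a\<in>B. \<Sum>b\<in>B. \<Sum>c\<in>B. \<Sum>e\<in>B. x a * y b * z c * of_nat (C b c e * C a e d))"
    by (simp add: sum_distrib_left)
  also have "\<dots> = (\<Sum>a\<in>B. \<Sum>b\<in>B. \<Sum>e\<in>B. \<Sum>c\<in>B. x a * y b * z c * of_nat (C b c e * C a e d))"
    by (rule sum.cong[OF refl], rule sum.cong[OF refl], rule sum.swap)
  also have "\<dots> = (\<Sum>a\<in>B. \<Sum>e\<in>B. \<Sum>b\<in>B. \<Sum>c\<in>B. x a * y b * z c * of_nat (C b c e * C a e d))"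
    by (rule sum.cong[OF refl], rule sum.swap)
  also have "\<dots> = (\<Sum>a\<in>B. \<Sum>e\<in>B. x a * (\<Sum>b\<in>B. \<Sum>c\<in>B. y b * z c * of_nat (C b c e)) * of_nat (C a e d))"
    by (simp add: sum_distrib_left sum_distrib_right mult_ac)
  finally show ?thesis .
qed

abbreviation alg :: "('b \<Rightarrow> 'k::field) ring" where "alg \<equiv> structure_algebra B C U"

lemma alg_carrier: "x \<in> carrier alg \<longleftrightarrow> (\<forall>c. c \<notin> B \<longrightarrow> x c = 0)"
  by (simp add: structure_algebra_def)

lemma alg_mult: "(x \<otimes>\<^bsub>alg\<^esub> y) c = (if c \<in> B then \<Sum>a\<in>B. \<Sum>b\<in>B. x a * y b * of_nat (C a b c) else 0)"
  by (simp add: structure_algebra_def)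

lemma alg_add: "(x \<oplus>\<^bsub>alg\<^esub> y) c = x c + y c"
  by (simp add: structure_algebra_def)

lemma alg_zero: "\<zero>\<^bsub>alg\<^esub> c = 0"
  by (simp add: structure_algebra_def)

lemma alg_one: "\<one>\<^bsub>alg\<^esub> c = (if c \<in> U then 1 else 0)"
  by (simp add: structure_algebra_def)

lemma alg_one_mult:
  assumes x: "x \<in> carrier alg" shows "\<one>\<^bsub>alg\<^esub> \<otimes>\<^bsub>alg\<^esub> x = x"
proof (rule ext)
  fix c
  show "(\<one>\<^bsub>alg\<^esub> \<otimes>\<^bsub>alg\<^esub> x) c = x c"
  proof (cases "c \<in> B")
    case True
    have "(\<Sum>a\<in>B. \<Sum>b\<in>B. (if a \<in> U then 1 else 0) * x b * of_nat (C a b c)) =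
        (\<Sum>a\<in>B. if a \<in> U then \<Sum>b\<in>B. x b * of_nat (C a b c) else 0)"
      by (intro sum.cong refl) simp
    also have "\<dots> = (\<Sum>a\<in>U. \<Sum>b\<in>B. x b * of_nat (C a b c))"
      using U_subset finite_B by (simp add: sum.inter_restrict[symmetric] Int_absorb1)
    also have "\<dots> = (\<Sum>b\<in>B. x b * of_nat (\<Sum>a\<in>U. C a b c))"
      by (subst sum.swap) (simp add: sum_distrib_left)
    also have "\<dots> = (\<Sum>b\<in>B. if b = c then x b else 0)"
      by (intro sum.cong refl) (simp only: unit_left[OF _ True], simp)
    finally show ?thesis using True finite_B by (simp add: alg_mult alg_one)
  qed (use x in \<open>simp add: alg_mult alg_carrier\<close>)
qed

lemma alg_mult_one:
  assumes x: "x \<in> carrier alg" shows "x \<otimes>\<^bsub>alg\<^esub> \<one>\<^bsub>alg\<^esub> = x"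
proof (rule ext)
  fix c
  show "(x \<otimes>\<^bsub>alg\<^esub> \<one>\<^bsub>alg\<^esub>) c = x c"
  proof (cases "c \<in> B")
    case True
    have "(\<Sum>b\<in>B. \<Sum>a\<in>B. x b * (if a \<in> U then 1 else 0) * of_nat (C b a c)) =
        (\<Sum>b\<in>B. \<Sum>a\<in>B. if a \<in> U then x b * of_nat (C b a c) else 0)"
      by (intro sum.cong refl) simp
    also have "\<dots> = (\<Sum>b\<in>B. \<Sum>a\<in>U. x b * of_nat (C b a c))"
      using U_subset finite_B by (simp add: sum.inter_restrict[symmetric] Int_absorb1)
    also have "\<dots> = (\<Sum>b\<in>B. x b * of_nat (\<Sum>a\<in>U. C b a c))"
      by (simp add: sum_distrib_left)
    also have "\<dots> = (\<Sum>b\<in>B. if b = c then x b else 0)"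
      by (intro sum.cong refl) (simp only: unit_right[OF _ True], simp)
    finally show ?thesis using True finite_B by (simp add: alg_mult alg_one)
  qed (use x in \<open>simp add: alg_mult alg_carrier\<close>)
qed

lemma alg_ring: "ring (alg :: ('b \<Rightarrow> 'k::field) ring)"
proof (rule ringI)
  show "abelian_group (alg :: ('b \<Rightarrow> 'k) ring)"
  proof (rule abelian_groupI)
    fix x :: "'b \<Rightarrow> 'k" assume "x \<in> carrier alg"
    then show "\<exists>y\<in>carrier alg. y \<oplus>\<^bsub>alg\<^esub> x = \<zero>\<^bsub>alg\<^esub>"
      by (intro bexI[of _ "\<lambda>c. - x c"]) (auto simp: alg_carrier fun_eq_iff alg_add alg_zero)
  qed (auto simp: alg_carrier fun_eq_iff alg_add alg_zero)
  show "monoid (alg :: ('b \<Rightarrow> 'k) ring)"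
  proof (rule monoidI)
    fix x y z :: "'b \<Rightarrow> 'k" assume "x \<in> carrier alg" "y \<in> carrier alg" "z \<in> carrier alg"
    show "x \<otimes>\<^bsub>alg\<^esub> y \<otimes>\<^bsub>alg\<^esub> z = x \<otimes>\<^bsub>alg\<^esub> (y \<otimes>\<^bsub>alg\<^esub> z)"
    proof (rule ext)
      fix d show "(x \<otimes>\<^bsub>alg\<^esub> y \<otimes>\<^bsub>alg\<^esub> z) d = (x \<otimes>\<^bsub>alg\<^esub> (y \<otimes>\<^bsub>alg\<^esub> z)) d"
        using structure_algebra_assoc[of d x y z]
        by (cases "d \<in> B") (simp_all add: alg_mult cong: sum.cong)
    qed
  qed (use U_subset in \<open>auto simp: alg_one_mult alg_mult_one, auto simp: alg_carrier alg_mult alg_one\<close>)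
qed (auto simp: fun_eq_iff alg_add alg_mult distrib_left distrib_right sum.distrib)

definition basis_elem :: "'b \<Rightarrow> 'b \<Rightarrow> 'k::field" where
  "basis_elem a = (\<lambda>c. if c = a then 1 else 0)"

lemma basis_elem_carrier: "a \<in> B \<Longrightarrow> basis_elem a \<in> carrier alg"
  by (auto simp: alg_carrier basis_elem_def)

lemma basis_elem_mult:
  assumes "a \<in> B" "b \<in> B"
  shows "((basis_elem a :: 'b \<Rightarrow> 'k::field) \<otimes>\<^bsub>alg\<^esub> basis_elem b) c = (if c \<in> B then of_nat (C a b c) else 0)"
proof -
  have "(\<Sum>a'\<in>B. \<Sum>b'\<in>B. basis_elem a a' * basis_elem b b' * (of_nat (C a' b' c) :: 'k)) =
      (\<Sum>a'\<in>B. if a' = a then \<Sum>b'\<in>B. (if b' = b then of_nat (C a' b' c) else 0) else 0)"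
    by (intro sum.cong refl) (auto simp: basis_elem_def intro!: sum.cong)
  then show ?thesis using assms finite_B by (simp add: alg_mult)
qed

lemma basis_induct [consumes 1, case_names zero add scale basis]:
  fixes x :: "'b \<Rightarrow> 'k::field"
  assumes x: "x \<in> carrier alg"
    and zero: "P (\<lambda>c. 0)" and add: "\<And>y z. P y \<Longrightarrow> P z \<Longrightarrow> P (\<lambda>c. y c + z c)"
    and scale: "\<And>t y. P y \<Longrightarrow> P (\<lambda>c. t * y c)"
    and basis: "\<And>c. c \<in> B \<Longrightarrow> x c \<noteq> 0 \<Longrightarrow> P (basis_elem c)"
  shows "P x"
proof -
  have "P (\<lambda>c. \<Sum>a\<in>A. x a * basis_elem a c)" if "A \<subseteq> B" for A
    using finite_subset[OF that finite_B] that
  proof (induction A rule: finite_induct)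
    case (insert a A)
    have "P (\<lambda>c. x a * basis_elem a c)"
    proof (cases "x a = 0")
      case False then show ?thesis using scale basis insert by simp
    qed (simp add: zero)
    then show ?case using insert add by simp
  qed (simp add: zero)
  moreover have "(\<lambda>c. \<Sum>a\<in>B. x a * basis_elem a c) = x"
  proof
    fix c
    have "(\<Sum>a\<in>B. x a * basis_elem a c) = (\<Sum>a\<in>B. if a = c then x c else 0)"
      by (intro sum.cong refl) (auto simp: basis_elem_def)
    then show "(\<Sum>a\<in>B. x a * basis_elem a c) = x c" using x finite_B by (auto simp: alg_carrier)
  qed
  ultimately show ?thesis by (metis order_refl)
qed

lemma scale_eq_mult:
  fixes x :: "'b \<Rightarrow> 'k::field"
  assumes "x \<in> carrier alg"
  shows "(\<lambda>c. t * x c) = (\<lambda>c. t * \<one>\<^bsub>alg\<^esub> c) \<otimes>\<^bsub>alg\<^esub> x"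
proof -
  have "((\<lambda>c. t * \<one>\<^bsub>alg\<^esub> c) \<otimes>\<^bsub>alg\<^esub> x) c = t * (\<one>\<^bsub>alg\<^esub> \<otimes>\<^bsub>alg\<^esub> x) c" for c
    by (simp add: alg_mult sum_distrib_left mult_ac)
  then show ?thesis using alg_one_mult[OF assms] by (intro ext) simp
qed

lemma ideal_scale:
  fixes x :: "'b \<Rightarrow> 'k::field"
  assumes "ideal J alg" "x \<in> J" shows "(\<lambda>c. t * x c) \<in> J"
proof -
  interpret ideal J alg by fact
  have "x \<in> carrier alg" using assms(2) a_subset by blast
  then show ?thesis unfolding scale_eq_mult[OF \<open>x \<in> carrier alg\<close>]
    using assms(2) U_subset by (intro I_l_closed) (auto simp: alg_carrier alg_one)
qed

end

subsection \<open>Blocks\<close>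

definition blk :: "nat list \<Rightarrow> nat \<Rightarrow> nat" where
  "blk l x = (LEAST i. x \<le> sum_list (take (Suc i) l))"

lemma sum_list_take_mono: "i \<le> j \<Longrightarrow> sum_list (take i l) \<le> sum_list (take j (l :: nat list))"
proof -
  assume "i \<le> j"
  then have "take j l = take i l @ take (j - i) (drop i l)" by (metis le_add_diff_inverse take_add)
  then show ?thesis by simp
qed

lemma blk_in_block:
  assumes "x \<in> {1..sum_list l}" shows "blk l x < length l" "x \<in> block l (blk l x)"
proof -
  let ?P = "\<lambda>i. x \<le> sum_list (take (Suc i) l)"
  have ne: "l \<noteq> []" using assms by auto
  then have ex: "?P (length l - 1)" using assms by simp
  then show "blk l x < length l"
    unfolding blk_def using Least_le[of ?P, OF ex] ne by (metis diff_less length_greater_0_conv less_le_trans not_less zero_less_one)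
  have "?P (blk l x)" unfolding blk_def using ex by (rule LeastI)
  moreover have "sum_list (take (blk l x) l) < x"
  proof (cases "blk l x")
    case 0 then show ?thesis using assms by simp
  next
    case (Suc i)
    then have "\<not> ?P i" using not_less_Least[of i ?P] unfolding blk_def by simp
    then show ?thesis using Suc by simp
  qed
  ultimately show "x \<in> block l (blk l x)" by (simp add: block_def)
qed

lemma blk_eqI:
  assumes "x \<in> block l i" shows "blk l x = i"
  unfolding blk_def
proof (rule Least_equality)
  show "x \<le> sum_list (take (Suc i) l)" using assms by (simp add: block_def)
  fix j assume "x \<le> sum_list (take (Suc j) l)"
  then show "i \<le> j" using assms sum_list_take_mono[of "Suc j" i l] unfolding block_def
    by (metis (mono_tags, lifting) le_trans mem_Collect_eq not_le not_less_eq_eq)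
qed

lemma block_subset: "block l i \<subseteq> {1..sum_list l}"
  using sum_list_take_mono[of "Suc i" "length l" l] sum_list_take_mono[of "length l" "Suc i" l]
  by (cases "Suc i \<le> length l") (auto simp: block_def)

lemma block_eq: "i < length l \<Longrightarrow> block l i = {x \<in> {1..sum_list l}. blk l x = i}"
  using block_subset[of l i] blk_eqI blk_in_block by auto

lemma card_block: "i < length l \<Longrightarrow> card (block l i) = l ! i"
proof -
  assume "i < length l"
  moreover have "block l i = {sum_list (take i l)<..sum_list (take (Suc i) l)}"
    unfolding block_def by auto
  ultimately show ?thesis by (simp add: take_Suc_conv_app_nth)
qed

lemma young_iff:
  "\<pi> \<in> young_subgroup l \<longleftrightarrow> \<pi> permutes {1..sum_list l} \<and> (\<forall>x\<in>{1..sum_list l}. blk l (\<pi> x) = blk l x)"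
proof
  assume p: "\<pi> \<in> young_subgroup l"
  then have "blk l (\<pi> x) = blk l x" if x: "x \<in> {1..sum_list l}" for x
    using blk_in_block[OF x] by (intro blk_eqI) (auto simp: young_subgroup_def)
  then show "\<pi> permutes {1..sum_list l} \<and> (\<forall>x\<in>{1..sum_list l}. blk l (\<pi> x) = blk l x)"
    using young_permutes[OF p] by blast
next
  assume p: "\<pi> permutes {1..sum_list l} \<and> (\<forall>x\<in>{1..sum_list l}. blk l (\<pi> x) = blk l x)"
  have "\<pi> ` block l i = block l i" if i: "i < length l" for i
  proof (rule endo_inj_surj)
    show "finite (block l i)" using block_subset by (rule finite_subset) simp
    show "\<pi> ` block l i \<subseteq> block l i"
    proof
      fix y assume "y \<in> \<pi> ` block l i"
      then obtain x where x: "x \<in> {1..sum_list l}" "blk l x = i" "y = \<pi> x" unfolding block_eq[OF i] by blast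
      then have "y \<in> {1..sum_list l}" "blk l y = i" using p permutes_in_image by metis+
      then show "y \<in> block l i" unfolding block_eq[OF i] by blast
    qed
    show "inj_on \<pi> (block l i)" using p permutes_inj_on by blast
  qed
  then show "\<pi> \<in> young_subgroup l" using p by (simp add: young_subgroup_def)
qed

lemma fiber_bij:
  assumes A: "finite A" and B: "finite B"
    and eq: "\<And>c. card {x \<in> A. u x = c} = card {y \<in> B. v y = c}"
  shows "\<exists>f. bij_betw f A B \<and> (\<forall>x\<in>A. v (f x) = u x)"
proof -
  have "\<exists>h. bij_betw h {x \<in> A. u x = c} {y \<in> B. v y = c}" for c
    using eq A B by (intro finite_same_card_bij) auto
  then obtain h where h: "\<And>c. bij_betw (h c) {x \<in> A. u x = c} {y \<in> B. v y = c}" by metis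
  define f where "f x = h (u x) x" for x
  have f: "f x \<in> B" "v (f x) = u x" if "x \<in> A" for x
    using bij_betwE[OF h[of "u x"]] that unfolding f_def by auto
  have "inj_on f A"
  proof (rule inj_onI)
    fix x y assume xy: "x \<in> A" "y \<in> A" "f x = f y"
    then have "u x = u y" using f(2) by metis
    then show "x = y" using bij_betw_imp_inj_on[OF h[of "u x"]] xy unfolding f_def by (simp add: inj_on_def)
  qed
  moreover have "f ` A = B"
  proof
    show "B \<subseteq> f ` A"
    proof
      fix y assume "y \<in> B"
      then have "y \<in> h (v y) ` {x \<in> A. u x = v y}" using h[of "v y"] by (simp add: bij_betw_def)
      then obtain x where "x \<in> A" "u x = v y" "y = h (v y) x" by blast
      then show "y \<in> f ` A" unfolding f_def by (intro image_eqI[of _ _ x]) simp_all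
    qed
  qed (use f in auto)
  ultimately show ?thesis using f(2) by (intro exI[of _ f]) (simp add: bij_betw_def)
qed

lemma right_coset_fibers:
  assumes "\<pi> \<in> young_subgroup m"
  shows "card {x \<in> {1..sum_list m}. \<alpha> (\<pi> x) = i \<and> blk m x = t} = card {x \<in> {1..sum_list m}. \<alpha> x = i \<and> blk m x = t}"
proof -
  have p: "\<pi> permutes {1..sum_list m}" "\<And>x. x \<in> {1..sum_list m} \<Longrightarrow> blk m (\<pi> x) = blk m x"
    using assms by (auto simp: young_iff)
  have "bij_betw \<pi> {x \<in> {1..sum_list m}. \<alpha> (\<pi> x) = i \<and> blk m x = t} {x \<in> {1..sum_list m}. \<alpha> x = i \<and> blk m x = t}"
    unfolding bij_betw_def
  proof
    show "inj_on \<pi> {x \<in> {1..sum_list m}. \<alpha> (\<pi> x) = i \<and> blk m x = t}" using p(1) permutes_inj_on by blast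
    show "\<pi> ` {x \<in> {1..sum_list m}. \<alpha> (\<pi> x) = i \<and> blk m x = t} = {x \<in> {1..sum_list m}. \<alpha> x = i \<and> blk m x = t}"
    proof (intro subset_antisym subsetI)
      fix y assume y: "y \<in> {x \<in> {1..sum_list m}. \<alpha> x = i \<and> blk m x = t}"
      then have "y \<in> \<pi> ` {1..sum_list m}" unfolding permutes_image[OF p(1)] by blast
      then obtain x where x: "x \<in> {1..sum_list m}" "y = \<pi> x" by blast
      then show "y \<in> \<pi> ` {x \<in> {1..sum_list m}. \<alpha> (\<pi> x) = i \<and> blk m x = t}" using y p(2) by auto
    qed (use p permutes_in_image[OF p(1)] in auto)
  qed
  then show ?thesis by (rule bij_betw_same_card)
qed

lemma right_coset_if_fibers:
  assumes eq: "\<And>i t. card {x \<in> {1..sum_list m}. \<beta> x = i \<and> blk m x = t} = card {x \<in> {1..sum_list m}. \<alpha> x = i \<and> blk m x = t}"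
    and out: "\<And>x. x \<notin> {1..sum_list m} \<Longrightarrow> \<beta> x = \<alpha> x"
  shows "\<exists>\<pi>\<in>young_subgroup m. \<beta> = \<alpha> \<circ> \<pi>"
proof -
  let ?A = "{1..sum_list m}"
  have "card {x \<in> ?A. (\<beta> x, blk m x) = c} = card {x \<in> ?A. (\<alpha> x, blk m x) = c}" for c
    using eq[of "fst c" "snd c"] by (cases c) simp
  then obtain f where f: "bij_betw f ?A ?A" "\<And>x. x \<in> ?A \<Longrightarrow> (\<alpha> (f x), blk m (f x)) = (\<beta> x, blk m x)"
    using fiber_bij[of ?A ?A "\<lambda>x. (\<beta> x, blk m x)" "\<lambda>x. (\<alpha> x, blk m x)"] by auto
  define \<pi> where "\<pi> x = (if x \<in> ?A then f x else x)" for x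
  have "bij_betw \<pi> ?A ?A" using f(1) by (rule bij_betw_cong[THEN iffD1, rotated]) (simp add: \<pi>_def)
  then have "\<pi> permutes ?A" by (rule bij_imp_permutes) (simp only: \<pi>_def if_False)
  then have "\<pi> \<in> young_subgroup m" using f(2) unfolding young_iff by (simp add: \<pi>_def)
  moreover have "\<beta> = \<alpha> \<circ> \<pi>" using f(2) out by (auto simp: fun_eq_iff \<pi>_def)
  ultimately show ?thesis by blast
qed

subsection \<open>The right generalized Schur algebra\<close>

lemma pair_count_one:
  assumes 1: "\<And>\<sigma> \<rho> \<pi>. \<sigma> \<in> young_subgroup l \<Longrightarrow> \<rho> \<in> young_subgroup v \<Longrightarrow> \<pi> \<in> young_subgroup m \<Longrightarrow>
        \<sigma> \<circ> \<alpha> \<circ> \<rho> \<circ> \<beta> = \<alpha> \<circ> \<beta> \<circ> \<pi> \<Longrightarrow> \<exists>\<rho>'\<in>young_subgroup v. \<sigma> \<circ> \<alpha> = \<alpha> \<circ> \<rho>'"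
    and 2: "\<And>\<rho> \<pi>. \<rho> \<in> young_subgroup v \<Longrightarrow> \<pi> \<in> young_subgroup m \<Longrightarrow>
        \<alpha> \<circ> \<rho> \<circ> \<beta> = \<alpha> \<circ> \<beta> \<circ> \<pi> \<Longrightarrow> \<exists>\<pi>'\<in>young_subgroup m. \<rho> \<circ> \<beta> = \<beta> \<circ> \<pi>'"
  shows "pair_count l \<alpha> v \<beta> m (\<alpha> \<circ> \<beta>) = n_R l \<alpha> v * n_R v \<beta> m"
proof -
  have "card {\<rho> \<in> young_subgroup v. \<exists>\<pi>\<in>young_subgroup m. \<sigma> \<circ> \<alpha> \<circ> \<rho> \<circ> \<beta> = (\<alpha> \<circ> \<beta>) \<circ> \<pi>} =
     (if \<sigma> \<in> G_R l \<alpha> v then n_R v \<beta> m else 0)" (is "card ?A = _") if s: "\<sigma> \<in> young_subgroup l" for \<sigma>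
  proof (cases "\<sigma> \<in> G_R l \<alpha> v")
    case False
    then have "?A = {}" using 1 s unfolding G_R_def by blast
    then show ?thesis using False by (simp only: if_False card.empty)
  next
    case True
    then obtain \<pi>1 where p: "\<pi>1 \<in> young_subgroup v" "\<sigma> \<circ> \<alpha> = \<alpha> \<circ> \<pi>1" unfolding G_R_def by blast
    have eq: "\<sigma> \<circ> \<alpha> \<circ> \<rho> \<circ> \<beta> = \<alpha> \<circ> (\<pi>1 \<circ> \<rho>) \<circ> \<beta>" for \<rho> using p(2) by (metis comp_assoc)
    have "?A = {\<rho> \<in> young_subgroup v. \<pi>1 \<circ> \<rho> \<in> G_R v \<beta> m}"
    proof (intro subset_antisym subsetI)
      fix \<rho> assume "\<rho> \<in> ?A"
      then show "\<rho> \<in> {\<rho> \<in> young_subgroup v. \<pi>1 \<circ> \<rho> \<in> G_R v \<beta> m}"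
        unfolding eq G_R_def using 2 p young_comp by blast
    next
      fix \<rho> assume "\<rho> \<in> {\<rho> \<in> young_subgroup v. \<pi>1 \<circ> \<rho> \<in> G_R v \<beta> m}"
      then obtain \<pi> where "\<rho> \<in> young_subgroup v" "\<pi> \<in> young_subgroup m" "\<pi>1 \<circ> \<rho> \<circ> \<beta> = \<beta> \<circ> \<pi>" unfolding G_R_def by blast
      moreover have "\<alpha> \<circ> (\<pi>1 \<circ> \<rho>) \<circ> \<beta> = (\<alpha> \<circ> \<beta>) \<circ> \<pi>" using calculation by (metis comp_assoc)
      ultimately show "\<rho> \<in> ?A" unfolding eq by blast
    qed
    moreover have "bij_betw (\<lambda>\<rho>. \<pi>1 \<circ> \<rho>) {\<rho> \<in> young_subgroup v. \<pi>1 \<circ> \<rho> \<in> G_R v \<beta> m} (G_R v \<beta> m)"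
      by (rule bij_betw_byWitness[where f' = "\<lambda>\<rho>. pinv \<pi>1 \<circ> \<rho>"])
        (use p in \<open>auto simp: young_cancel_comp intro!: young_comp young_pinv intro: subsetD[OF G_R_subset]\<close>)
    ultimately show ?thesis using True by (simp add: n_R_def bij_betw_same_card)
  qed
  then have "pair_count l \<alpha> v \<beta> m (\<alpha> \<circ> \<beta>) = (\<Sum>\<sigma>\<in>young_subgroup l. if \<sigma> \<in> G_R l \<alpha> v then n_R v \<beta> m else 0)"
    unfolding pair_count_sum_left by (intro sum.cong refl) simp
  also have "\<dots> = (\<Sum>\<sigma>\<in>G_R l \<alpha> v. n_R v \<beta> m)"
    using G_R_subset[of l \<alpha> v] finite_young by (simp add: sum.inter_restrict[symmetric] Int_absorb1)
  finally show ?thesis by (simp add: n_R_def)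
qed

lemma card_filter_sum: "finite A \<Longrightarrow> card {x \<in> A. P x} = (\<Sum>x\<in>A. if P x then 1 else 0)"
  by (simp add: sum.If_cases Int_def)

lemma finite_tau_bar: "finite (carrier (tau_bar r))"
proof (rule finite_imageD)
  show "finite ((\<lambda>\<alpha>. restrict \<alpha> {0..r}) ` carrier (tau_bar r))"
    by (rule finite_subset[of _ "{0..r} \<rightarrow>\<^sub>E {0..r}"]) (auto simp: tau_bar_def finite_PiE)
  show "inj_on (\<lambda>\<alpha>. restrict \<alpha> {0..r}) (carrier (tau_bar r))"
  proof (rule inj_onI)
    fix \<alpha> \<beta> assume ab: "\<alpha> \<in> carrier (tau_bar r)" "\<beta> \<in> carrier (tau_bar r)" "restrict \<alpha> {0..r} = restrict \<beta> {0..r}"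
    have "\<alpha> x = \<beta> x" for x
    proof (cases "x \<le> r")
      case True
      then show ?thesis using ab(3) by (metis restrict_apply' atLeastAtMost_iff le0)
    qed (use ab(1,2) in \<open>simp add: tau_bar_def\<close>)
    then show "\<alpha> = \<beta>" by blast
  qed
qed

lemma permutes_rook:
  assumes "\<pi> permutes {1..r}" shows "\<pi> \<in> rook_monoid r"
proof -
  have "\<pi> 0 = 0" "\<And>x. x > r \<Longrightarrow> \<pi> x = x" using assms by (auto intro: permutes_not_in)
  moreover have "\<pi> ` {0..r} \<subseteq> {0..r}"
  proof
    fix y assume "y \<in> \<pi> ` {0..r}"
    then obtain x where "x \<le> r" "y = \<pi> x" by auto
    then show "y \<in> {0..r}" using permutes_in_image[OF assms, of x] \<open>\<pi> 0 = 0\<close> by (cases "x = 0") auto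
  qed
  moreover have "card {x \<in> {0..r}. \<pi> x = i} \<le> 1" for i
    using permutes_inj[OF assms] by (intro card_le_Suc0_iff_eq[THEN iffD2, folded One_nat_def]) (auto dest: injD)
  ultimately show ?thesis by (simp add: rook_monoid_def tau_bar_def)
qed

locale schur =
  fixes r n :: nat and S :: "(nat \<Rightarrow> nat) set"
  assumes submonoid: "submonoid S (tau_bar r)" and rook: "rook_monoid r \<subseteq> S" and rn: "r \<le> n"
begin

abbreviation "L \<equiv> weak_compositions n r"

lemma L_sum: "l \<in> L \<Longrightarrow> sum_list l = r" "l \<in> L \<Longrightarrow> length l = n"
  by (auto simp: weak_compositions_def)

lemma S_comp: "\<alpha> \<in> S \<Longrightarrow> \<beta> \<in> S \<Longrightarrow> \<alpha> \<circ> \<beta> \<in> S"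
  using submonoid.m_closed[OF submonoid] by (simp add: tau_bar_def)

lemma S_tau:
  assumes "\<alpha> \<in> S" shows "\<alpha> 0 = 0" "x \<le> r \<Longrightarrow> \<alpha> x \<le> r" "r < x \<Longrightarrow> \<alpha> x = x"
  using submonoid.mem_carrier[OF submonoid assms] by (auto simp: tau_bar_def image_subset_iff)

lemma finite_S: "finite S"
  using submonoid.subset[OF submonoid] finite_tau_bar by (rule finite_subset)

lemma permutes_S: "\<pi> permutes {1..r} \<Longrightarrow> \<pi> \<in> S"
  using permutes_rook rook by blast

lemma young_S: "l \<in> L \<Longrightarrow> \<pi> \<in> young_subgroup l \<Longrightarrow> \<pi> \<in> S"
  using young_permutes[of \<pi> l] L_sum permutes_S by simp

lemma id_S: "id \<in> S"
  using permutes_S permutes_id by blast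

lemma finite_L: "finite L"
proof (rule finite_subset)
  show "L \<subseteq> {xs. set xs \<subseteq> {0..r} \<and> length xs = n}"
    using member_le_sum_list by (fastforce simp: weak_compositions_def)
qed (simp add: finite_lists_length_eq)

lemma double_coset_subset_S: "l \<in> L \<Longrightarrow> m \<in> L \<Longrightarrow> \<alpha> \<in> S \<Longrightarrow> double_coset l \<alpha> m \<subseteq> S"
  using S_comp young_S unfolding double_coset_def by blast

lemma finite_double_cosets: "finite (double_cosets S l m)"
  unfolding double_cosets_def using finite_S by simp

abbreviation "Bas \<equiv> schur_basis S n r"

lemma finite_Bas: "finite Bas"
proof (rule finite_subset)
  show "Bas \<subseteq> L \<times> (\<Union>l\<in>L. \<Union>m\<in>L. double_cosets S l m) \<times> L"
    unfolding schur_basis_def by blast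
qed (simp add: finite_L finite_double_cosets)

lemma coset_rep_S:
  assumes "l \<in> L" "m \<in> L" "D \<in> double_cosets S l m" shows "coset_rep D \<in> S" "D = double_coset l (coset_rep D) m"
proof -
  obtain \<alpha> where "\<alpha> \<in> S" "D = double_coset l \<alpha> m" using assms(3) unfolding double_cosets_def by blast
  then show "coset_rep D \<in> S" "D = double_coset l (coset_rep D) m"
    using coset_rep_in double_coset_subset_S[OF assms(1,2)] double_coset_eq_iff by blast+
qed

lemma N_coset_sum:
  assumes l: "l \<in> L" "v \<in> L" "m \<in> L" "m' \<in> L" and D: "D1 \<in> double_cosets S l v" "D2 \<in> double_cosets S v m"
    "D3 \<in> double_cosets S m m'" "D \<in> double_cosets S l m'"
  shows "(\<Sum>E\<in>double_cosets S l m. N_coset v D1 D2 E * N_coset m E D3 D) =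
    (\<Sum>\<rho>\<in>young_subgroup v. \<Sum>\<rho>'\<in>young_subgroup m.
       if coset_rep D1 \<circ> \<rho> \<circ> coset_rep D2 \<circ> \<rho>' \<circ> coset_rep D3 \<in> D then 1 else 0)"
proof -
  let ?x = "\<lambda>\<rho>. coset_rep D1 \<circ> \<rho> \<circ> coset_rep D2"
  have x: "?x \<rho> \<in> S" if "\<rho> \<in> young_subgroup v" for \<rho>
    using that coset_rep_S l D S_comp young_S by metis
  have "(\<Sum>E\<in>double_cosets S l m. N_coset v D1 D2 E * N_coset m E D3 D) =
    (\<Sum>E\<in>double_cosets S l m. \<Sum>\<rho>\<in>young_subgroup v. if ?x \<rho> \<in> E then N_coset m E D3 D else 0)"
    unfolding N_coset_def[of v D1 D2] card_filter_sum[OF finite_young] sum_distrib_right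
    by (intro sum.cong refl) simp
  also have "\<dots> = (\<Sum>\<rho>\<in>young_subgroup v. \<Sum>E\<in>double_cosets S l m. if ?x \<rho> \<in> E then N_coset m E D3 D else 0)"
    by (rule sum.swap)
  also have "\<dots> = (\<Sum>\<rho>\<in>young_subgroup v. N_coset m (double_coset l (?x \<rho>) m) D3 D)"
  proof (rule sum.cong[OF refl])
    fix \<rho> assume r: "\<rho> \<in> young_subgroup v"
    have "(\<Sum>E\<in>double_cosets S l m. if ?x \<rho> \<in> E then N_coset m E D3 D else 0) =
      (\<Sum>E\<in>double_cosets S l m. if E = double_coset l (?x \<rho>) m then N_coset m E D3 D else 0)"
      by (intro sum.cong refl) (simp add: in_double_cosets_iff)
    also have "\<dots> = N_coset m (double_coset l (?x \<rho>) m) D3 D"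
      using x[OF r] finite_double_cosets by (simp add: sum.delta double_cosets_def)
    finally show "(\<Sum>E\<in>double_cosets S l m. if ?x \<rho> \<in> E then N_coset m E D3 D else 0) =
      N_coset m (double_coset l (?x \<rho>) m) D3 D" .
  qed
  also have "\<dots> = (\<Sum>\<rho>\<in>young_subgroup v. card {\<rho>' \<in> young_subgroup m. ?x \<rho> \<circ> \<rho>' \<circ> coset_rep D3 \<in> D})"
  proof (rule sum.cong[OF refl])
    fix \<rho>
    obtain \<delta> where "D = double_coset l \<delta> m'" using D(4) unfolding double_cosets_def by blast
    then show "N_coset m (double_coset l (?x \<rho>) m) D3 D =
       card {\<rho>' \<in> young_subgroup m. ?x \<rho> \<circ> \<rho>' \<circ> coset_rep D3 \<in> D}"
      unfolding N_coset_def by (simp only: N_cong[OF coset_rep_in double_coset_self])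
  qed
  finally show ?thesis by (simp only: card_filter_sum[OF finite_young])
qed

lemma N_coset_sum':
  assumes l: "l \<in> L" "v \<in> L" "m \<in> L" "m' \<in> L" and D: "D1 \<in> double_cosets S l v" "D2 \<in> double_cosets S v m"
    "D3 \<in> double_cosets S m m'" "D \<in> double_cosets S l m'"
  shows "(\<Sum>E\<in>double_cosets S v m'. N_coset m D2 D3 E * N_coset v D1 E D) =
    (\<Sum>\<rho>\<in>young_subgroup v. \<Sum>\<rho>'\<in>young_subgroup m.
       if coset_rep D1 \<circ> \<rho> \<circ> coset_rep D2 \<circ> \<rho>' \<circ> coset_rep D3 \<in> D then 1 else 0)"
proof -
  let ?x = "\<lambda>\<rho>. coset_rep D2 \<circ> \<rho> \<circ> coset_rep D3"
  have x: "?x \<rho> \<in> S" if "\<rho> \<in> young_subgroup m" for \<rho>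
    using that coset_rep_S l D S_comp young_S by metis
  have "(\<Sum>E\<in>double_cosets S v m'. N_coset m D2 D3 E * N_coset v D1 E D) =
    (\<Sum>E\<in>double_cosets S v m'. \<Sum>\<rho>\<in>young_subgroup m. if ?x \<rho> \<in> E then N_coset v D1 E D else 0)"
    unfolding N_coset_def[of m D2 D3] card_filter_sum[OF finite_young] sum_distrib_right
    by (intro sum.cong refl) simp
  also have "\<dots> = (\<Sum>\<rho>\<in>young_subgroup m. \<Sum>E\<in>double_cosets S v m'. if ?x \<rho> \<in> E then N_coset v D1 E D else 0)"
    by (rule sum.swap)
  also have "\<dots> = (\<Sum>\<rho>\<in>young_subgroup m. N_coset v D1 (double_coset v (?x \<rho>) m') D)"
  proof (rule sum.cong[OF refl])
    fix \<rho> assume r: "\<rho> \<in> young_subgroup m"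
    have "(\<Sum>E\<in>double_cosets S v m'. if ?x \<rho> \<in> E then N_coset v D1 E D else 0) =
      (\<Sum>E\<in>double_cosets S v m'. if E = double_coset v (?x \<rho>) m' then N_coset v D1 E D else 0)"
      by (intro sum.cong refl) (simp add: in_double_cosets_iff)
    also have "\<dots> = N_coset v D1 (double_coset v (?x \<rho>) m') D"
      using x[OF r] finite_double_cosets by (simp add: sum.delta double_cosets_def)
    finally show "(\<Sum>E\<in>double_cosets S v m'. if ?x \<rho> \<in> E then N_coset v D1 E D else 0) =
      N_coset v D1 (double_coset v (?x \<rho>) m') D" .
  qed
  also have "\<dots> = (\<Sum>\<rho>\<in>young_subgroup m. card {\<rho>' \<in> young_subgroup v. coset_rep D1 \<circ> \<rho>' \<circ> ?x \<rho> \<in> D})"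
  proof (rule sum.cong[OF refl])
    fix \<rho>
    obtain \<delta> where "D = double_coset l \<delta> m'" using D(4) unfolding double_cosets_def by blast
    then show "N_coset v D1 (double_coset v (?x \<rho>) m') D =
       card {\<rho>' \<in> young_subgroup v. coset_rep D1 \<circ> \<rho>' \<circ> ?x \<rho> \<in> D}"
      unfolding N_coset_def by (simp only: N_cong[OF double_coset_self coset_rep_in])
  qed
  also have "\<dots> = (\<Sum>\<rho>\<in>young_subgroup v. \<Sum>\<rho>'\<in>young_subgroup m.
       if coset_rep D1 \<circ> \<rho> \<circ> coset_rep D2 \<circ> \<rho>' \<circ> coset_rep D3 \<in> D then 1 else 0)"
    unfolding card_filter_sum[OF finite_young] by (subst sum.swap) (simp only: comp_assoc)
  finally show ?thesis .
qed

lemma schur_coeff_nonzeroD: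
  "schur_coeff (l, D1, v) (w, D2, m) (l', D, m') \<noteq> 0 \<Longrightarrow> v = w \<and> l' = l \<and> m' = m"
  by (simp split: if_splits)

lemma sum_Bas:
  fixes f :: "schur_index \<Rightarrow> 'c::comm_monoid_add"
  assumes "l \<in> L" "m \<in> L" "\<And>l' D m'. f (l', D, m') \<noteq> 0 \<Longrightarrow> l' = l \<and> m' = m"
  shows "(\<Sum>e\<in>Bas. f e) = (\<Sum>E\<in>double_cosets S l m. f (l, E, m))"
proof -
  have "(\<Sum>E\<in>double_cosets S l m. f (l, E, m)) = (\<Sum>e\<in>(\<lambda>E. (l, E, m)) ` double_cosets S l m. f e)"
    by (subst sum.reindex) (auto simp: inj_on_def)
  also have "\<dots> = (\<Sum>e\<in>Bas. f e)"
  proof (rule sum.mono_neutral_left[OF finite_Bas])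
    show "(\<lambda>E. (l, E, m)) ` double_cosets S l m \<subseteq> Bas" using assms(1,2) by (auto simp: schur_basis_def)
    show "\<forall>e\<in>Bas - (\<lambda>E. (l, E, m)) ` double_cosets S l m. f e = 0"
      using assms(3) by (force simp: schur_basis_def)
  qed
  finally show ?thesis by simp
qed

lemma n_R_coset_pos: "0 < n_R_coset l D m"
  unfolding n_R_coset_def by (rule n_R_pos)

lemma schur_coeff_assoc:
  assumes "a \<in> Bas" "b \<in> Bas" "c \<in> Bas" "d \<in> Bas"
  shows "(\<Sum>e\<in>Bas. schur_coeff a b e * schur_coeff e c d) = (\<Sum>e\<in>Bas. schur_coeff b c e * schur_coeff a e d)"
proof -
  obtain l D1 v where a: "a = (l, D1, v)" by (cases a) auto
  obtain w D2 m where b: "b = (w, D2, m)" by (cases b) auto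
  obtain w' D3 m' where c: "c = (w', D3, m')" by (cases c) auto
  obtain l'' D m'' where d: "d = (l'', D, m'')" by (cases d) auto
  show ?thesis
  proof (cases "v = w \<and> m = w' \<and> l'' = l \<and> m'' = m'")
    case False
    have "schur_coeff a b e * schur_coeff e c d = 0" "schur_coeff b c e * schur_coeff a e d = 0" for e
      using False unfolding a b c d by (cases e, auto split: if_splits)+
    then show ?thesis by (simp only: sum.neutral_const)
  next
    case True
    have l: "l \<in> L" "v \<in> L" "m \<in> L" "m' \<in> L" and D: "D1 \<in> double_cosets S l v" "D2 \<in> double_cosets S v m"
      "D3 \<in> double_cosets S m m'" "D \<in> double_cosets S l m'"
      using assms True unfolding a b c d schur_basis_def by auto
    have eq: "a = (l, D1, v)" "b = (v, D2, m)" "c = (m, D3, m')" "d = (l, D, m')" using a b c d True by auto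
    let ?q = "real (n_R_coset l D m') / (real (n_R_coset l D1 v) * real (n_R_coset v D2 m) * real (n_R_coset m D3 m'))"
    have "real (\<Sum>e\<in>Bas. schur_coeff a b e * schur_coeff e c d) =
      real (\<Sum>E\<in>double_cosets S l m. schur_coeff a b (l, E, m) * schur_coeff (l, E, m) c d)"
      unfolding eq by (subst sum_Bas[OF l(1,3)]) (auto split: if_splits)
    also have "\<dots> = (\<Sum>E\<in>double_cosets S l m. ?q * real (N_coset v D1 D2 E * N_coset m E D3 D))"
    proof -
      have "real (schur_coeff a b (l, E, m) * schur_coeff (l, E, m) c d) = ?q * real (N_coset v D1 D2 E * N_coset m E D3 D)"
        if "E \<in> double_cosets S l m" for E
        unfolding eq of_nat_mult schur_coeff_coset[OF D(1,2) that] schur_coeff_coset[OF that D(3,4)]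
        using n_R_coset_pos[of l E m] by (simp add: mult_ac)
      then show ?thesis by simp
    qed
    also have "\<dots> = ?q * real (\<Sum>E\<in>double_cosets S l m. N_coset v D1 D2 E * N_coset m E D3 D)"
      by (simp add: sum_distrib_left)
    also have "\<dots> = ?q * real (\<Sum>E\<in>double_cosets S v m'. N_coset m D2 D3 E * N_coset v D1 E D)"
      unfolding N_coset_sum[OF l D] N_coset_sum'[OF l D] ..
    also have "\<dots> = (\<Sum>E\<in>double_cosets S v m'. ?q * real (N_coset m D2 D3 E * N_coset v D1 E D))"
      by (simp add: sum_distrib_left)
    also have "\<dots> = real (\<Sum>E\<in>double_cosets S v m'. schur_coeff b c (v, E, m') * schur_coeff a (v, E, m') d)"
    proof -
      have "real (schur_coeff b c (v, E, m') * schur_coeff a (v, E, m') d) = ?q * real (N_coset m D2 D3 E * N_coset v D1 E D)"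
        if "E \<in> double_cosets S v m'" for E
        unfolding eq of_nat_mult schur_coeff_coset[OF D(2,3) that] schur_coeff_coset[OF D(1) that D(4)]
        using n_R_coset_pos[of v E m'] by (simp add: mult_ac)
      then show ?thesis by simp
    qed
    also have "\<dots> = real (\<Sum>e\<in>Bas. schur_coeff b c e * schur_coeff a e d)"
      unfolding eq by (subst sum_Bas[OF l(2,4)]) (auto split: if_splits)
    finally show ?thesis by linarith
  qed
qed

abbreviation "Uts \<equiv> (\<lambda>l. (l, double_coset l id l, l)) ` L"

lemma Uts_subset: "Uts \<subseteq> Bas"
  using id_S by (auto simp: schur_basis_def double_cosets_def)

lemma schur_coeff_id_left:
  "schur_coeff (l, double_coset l id l, l) (l, double_coset l \<beta> m, m) (l, double_coset l \<gamma> m, m) =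
    (if double_coset l \<beta> m = double_coset l \<gamma> m then 1 else 0)"
proof -
  have G: "G_R l id l = young_subgroup l" by (auto simp: G_R_def)
  have "id \<circ> \<rho> \<circ> \<beta> \<in> double_coset l \<gamma> m \<longleftrightarrow> \<beta> \<in> double_coset l \<gamma> m" if "\<rho> \<in> young_subgroup l" for \<rho>
  proof -
    have "\<rho> \<circ> \<beta> \<in> double_coset l \<beta> m" unfolding in_double_coset using that young_id by (metis comp_id)
    then show ?thesis using double_coset_sym double_coset_trans by (metis id_comp)
  qed
  then have "card {\<rho> \<in> young_subgroup l. id \<circ> \<rho> \<circ> \<beta> \<in> double_coset l \<gamma> m} =
     (if \<beta> \<in> double_coset l \<gamma> m then card (young_subgroup l) else 0)"
    unfolding card_filter_sum[OF finite_young] by simp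
  then have "schur_coeff (l, double_coset l id l, l) (l, double_coset l \<beta> m, m) (l, double_coset l \<gamma> m, m) *
      (card (young_subgroup l) * n_R l \<beta> m) = n_R l \<gamma> m * (if \<beta> \<in> double_coset l \<gamma> m then card (young_subgroup l) else 0)"
    using schur_coeff_mult[of l id l \<beta> m \<gamma>] pair_count_eq[of l \<gamma> m l id \<beta>] by (simp only: n_R_def G)
  then show ?thesis
    using n_R_cong[of \<beta> l \<gamma> m] n_R_pos[of l \<gamma> m] n_R_pos[of l \<beta> m] card_young_pos[of l] double_coset_eq_iff[of l \<beta> m \<gamma>]
    by (auto simp del: schur_coeff.simps split: if_splits)
qed

lemma schur_coeff_id_right:
  "schur_coeff (l, double_coset l \<beta> m, m) (m, double_coset m id m, m) (l, double_coset l \<gamma> m, m) =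
    (if double_coset l \<beta> m = double_coset l \<gamma> m then 1 else 0)"
proof -
  have G: "G_R m id m = young_subgroup m" by (auto simp: G_R_def)
  have "\<beta> \<circ> \<rho> \<circ> id \<in> double_coset l \<gamma> m \<longleftrightarrow> \<beta> \<in> double_coset l \<gamma> m" if "\<rho> \<in> young_subgroup m" for \<rho>
  proof -
    have "\<beta> \<circ> \<rho> \<in> double_coset l \<beta> m" unfolding in_double_coset using that young_id by (metis id_comp)
    then show ?thesis using double_coset_sym double_coset_trans by (metis comp_id)
  qed
  then have "card {\<rho> \<in> young_subgroup m. \<beta> \<circ> \<rho> \<circ> id \<in> double_coset l \<gamma> m} =
     (if \<beta> \<in> double_coset l \<gamma> m then card (young_subgroup m) else 0)"
    unfolding card_filter_sum[OF finite_young] by simp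
  then have "schur_coeff (l, double_coset l \<beta> m, m) (m, double_coset m id m, m) (l, double_coset l \<gamma> m, m) *
      (n_R l \<beta> m * card (young_subgroup m)) = n_R l \<gamma> m * (if \<beta> \<in> double_coset l \<gamma> m then card (young_subgroup m) else 0)"
    using schur_coeff_mult[of l \<beta> m id m \<gamma>] pair_count_eq[of l \<gamma> m m \<beta> id] by (simp only: n_R_def G)
  then show ?thesis
    using n_R_cong[of \<beta> l \<gamma> m] n_R_pos[of l \<gamma> m] n_R_pos[of l \<beta> m] card_young_pos[of m] double_coset_eq_iff[of l \<beta> m \<gamma>]
    by (auto simp del: schur_coeff.simps split: if_splits)
qed

sublocale structure_constants Bas schur_coeff Uts
proof
  show "finite Bas" "Uts \<subseteq> Bas" by (rule finite_Bas, rule Uts_subset)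
  have inj: "inj_on (\<lambda>l. (l, double_coset l id l, l)) L" by (rule inj_onI) simp
  fix b c assume bc: "b \<in> Bas" "c \<in> Bas"
  obtain l D m where b: "b = (l, D, m)" by (cases b) auto
  obtain \<beta> where l: "l \<in> L" "m \<in> L" "\<beta> \<in> S" "D = double_coset l \<beta> m"
    using bc(1) unfolding b schur_basis_def double_cosets_def by auto
  obtain l' E m' where c: "c = (l', E, m')" by (cases c) auto
  obtain \<gamma> where l': "l' \<in> L" "m' \<in> L" "\<gamma> \<in> S" "E = double_coset l' \<gamma> m'"
    using bc(2) unfolding c schur_basis_def double_cosets_def by auto
  have "(\<Sum>u\<in>Uts. schur_coeff u b c) = (\<Sum>u\<in>L. schur_coeff (u, double_coset u id u, u) b c)"
    by (simp only: sum.reindex[OF inj] o_def)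
  also have "\<dots> = (\<Sum>u\<in>L. if u = l then (if b = c then 1 else 0) else 0)"
  proof (rule sum.cong[OF refl])
    fix u
    show "schur_coeff (u, double_coset u id u, u) b c = (if u = l then (if b = c then 1 else 0) else 0)"
    proof (cases "u = l \<and> l' = l \<and> m' = m")
      case True
      then show ?thesis unfolding b c l(4) l'(4) using schur_coeff_id_left[of l \<beta> m \<gamma>] by (simp del: schur_coeff.simps)
    qed (auto simp: b c)
  qed
  also have "\<dots> = (if b = c then 1 else 0)" using l finite_L by simp
  finally show "(\<Sum>u\<in>Uts. schur_coeff u b c) = (if b = c then 1 else 0)" .
  have "(\<Sum>u\<in>Uts. schur_coeff b u c) = (\<Sum>u\<in>L. schur_coeff b (u, double_coset u id u, u) c)"
    by (simp only: sum.reindex[OF inj] o_def)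
  also have "\<dots> = (\<Sum>u\<in>L. if u = m then (if b = c then 1 else 0) else 0)"
  proof (rule sum.cong[OF refl])
    fix u
    show "schur_coeff b (u, double_coset u id u, u) c = (if u = m then (if b = c then 1 else 0) else 0)"
    proof (cases "u = m \<and> l' = l \<and> m' = m")
      case True
      then show ?thesis unfolding b c l(4) l'(4) using schur_coeff_id_right[of l \<beta> m \<gamma>] by (simp del: schur_coeff.simps)
    qed (auto simp: b c)
  qed
  also have "\<dots> = (if b = c then 1 else 0)" using l finite_L by simp
  finally show "(\<Sum>u\<in>Uts. schur_coeff b u c) = (if b = c then 1 else 0)" .
qed (rule schur_coeff_assoc)

lemma schur_algebra_eq: "schur_algebra S n r = alg"
  unfolding schur_algebra_def structure_algebra_def ..

definition F :: "nat list \<Rightarrow> (nat \<Rightarrow> nat) \<Rightarrow> nat list \<Rightarrow> schur_index \<Rightarrow> 'k::field" where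
  "F l \<alpha> m = basis_elem (l, double_coset l \<alpha> m, m)"

lemma Bas_iff: "(l, double_coset l \<alpha> m, m) \<in> Bas" if "l \<in> L" "m \<in> L" "\<alpha> \<in> S"
  using that by (auto simp: schur_basis_def double_cosets_def)

lemma F_carrier: "l \<in> L \<Longrightarrow> m \<in> L \<Longrightarrow> \<alpha> \<in> S \<Longrightarrow> F l \<alpha> m \<in> carrier alg"
  unfolding F_def by (intro basis_elem_carrier Bas_iff)

lemma F_mult_one:
  assumes l: "l \<in> L" "v \<in> L" "m \<in> L" and S: "\<alpha> \<in> S" "\<beta> \<in> S"
    and 0: "\<And>\<rho>. \<rho> \<in> young_subgroup v \<Longrightarrow> \<alpha> \<circ> \<rho> \<circ> \<beta> \<in> double_coset l (\<alpha> \<circ> \<beta>) m"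
    and 1: "\<And>\<sigma> \<rho> \<pi>. \<sigma> \<in> young_subgroup l \<Longrightarrow> \<rho> \<in> young_subgroup v \<Longrightarrow> \<pi> \<in> young_subgroup m \<Longrightarrow>
        \<sigma> \<circ> \<alpha> \<circ> \<rho> \<circ> \<beta> = \<alpha> \<circ> \<beta> \<circ> \<pi> \<Longrightarrow> \<exists>\<rho>'\<in>young_subgroup v. \<sigma> \<circ> \<alpha> = \<alpha> \<circ> \<rho>'"
    and 2: "\<And>\<rho> \<pi>. \<rho> \<in> young_subgroup v \<Longrightarrow> \<pi> \<in> young_subgroup m \<Longrightarrow>
        \<alpha> \<circ> \<rho> \<circ> \<beta> = \<alpha> \<circ> \<beta> \<circ> \<pi> \<Longrightarrow> \<exists>\<pi>'\<in>young_subgroup m. \<rho> \<circ> \<beta> = \<beta> \<circ> \<pi>'"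
  shows "F l \<alpha> v \<otimes>\<^bsub>alg\<^esub> F v \<beta> m = (F l (\<alpha> \<circ> \<beta>) m :: schur_index \<Rightarrow> 'k::field)"
proof (rule ext)
  fix c :: schur_index
  obtain l' E m' where c: "c = (l', E, m')" by (cases c) auto
  have C: "(F l \<alpha> v \<otimes>\<^bsub>alg\<^esub> F v \<beta> m) c = (if c \<in> Bas then of_nat (schur_coeff (l, double_coset l \<alpha> v, v) (v, double_coset v \<beta> m, m) c) else (0::'k))"
    unfolding F_def using l S by (intro basis_elem_mult Bas_iff)
  show "(F l \<alpha> v \<otimes>\<^bsub>alg\<^esub> F v \<beta> m) c = (F l (\<alpha> \<circ> \<beta>) m :: schur_index \<Rightarrow> 'k) c"
  proof (cases "c \<in> Bas \<and> l' = l \<and> m' = m")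
    case False
    moreover have "c = (l, double_coset l (\<alpha> \<circ> \<beta>) m, m) \<Longrightarrow> c \<in> Bas" using Bas_iff[OF l(1,3) S_comp[OF S]] by simp
    ultimately show ?thesis unfolding C unfolding c F_def basis_elem_def by auto
  next
    case True
    then obtain \<gamma> where g: "\<gamma> \<in> S" "E = double_coset l \<gamma> m" unfolding c schur_basis_def double_cosets_def by auto
    have pos: "n_R l \<alpha> v * n_R v \<beta> m > 0" using n_R_pos by simp
    have "schur_coeff (l, double_coset l \<alpha> v, v) (v, double_coset v \<beta> m, m) c = (if E = double_coset l (\<alpha> \<circ> \<beta>) m then 1 else 0)"
    proof (cases "E = double_coset l (\<alpha> \<circ> \<beta>) m")
      case E: True
      have "schur_coeff (l, double_coset l \<alpha> v, v) (v, double_coset v \<beta> m, m) c * (n_R l \<alpha> v * n_R v \<beta> m) = n_R l \<alpha> v * n_R v \<beta> m"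
        using schur_coeff_mult[of l \<alpha> v \<beta> m "\<alpha> \<circ> \<beta>"] pair_count_one[OF 1 2] E True unfolding c by simp
      then show ?thesis using E pos by simp
    next
      case E: False
      have "\<alpha> \<circ> \<rho> \<circ> \<beta> \<notin> double_coset l \<gamma> m" if "\<rho> \<in> young_subgroup v" for \<rho>
        using 0[OF that] E g double_coset_eq_iff by metis
      then have "card {\<rho> \<in> young_subgroup v. \<alpha> \<circ> \<rho> \<circ> \<beta> \<in> double_coset l \<gamma> m} = 0"
        unfolding card_filter_sum[OF finite_young] by simp
      then have "schur_coeff (l, double_coset l \<alpha> v, v) (v, double_coset v \<beta> m, m) c * (n_R l \<alpha> v * n_R v \<beta> m) = 0"
        using schur_coeff_mult[of l \<alpha> v \<beta> m \<gamma>] pair_count_eq[of l \<gamma> m v \<alpha> \<beta>] True g unfolding c by simp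
      then show ?thesis using E pos by simp
    qed
    then show ?thesis unfolding C using True by (auto simp: c F_def basis_elem_def)
  qed
qed

end

subsection \<open>Partitions as compositions\<close>

definition parts :: "nat multiset \<Rightarrow> nat list" where
  "parts \<nu> = rev (sorted_list_of_multiset \<nu>)"

lemma mset_parts: "mset (parts \<nu>) = \<nu>"
  by (simp add: parts_def)

lemma sum_parts: "sum_list (parts \<nu>) = sum_mset \<nu>"
  using sum_mset_sum_list[of "parts \<nu>"] by (simp add: mset_parts)

lemma length_parts: "length (parts \<nu>) = size \<nu>"
  using size_mset[of "parts \<nu>"] by (simp only: mset_parts)

lemma young_pad: "young_subgroup (l @ replicate k 1 @ replicate j 0) = young_subgroup l"
proof -
  let ?l = "l @ replicate k 1 @ replicate j (0::nat)"
  have sum: "sum_list ?l = sum_list l + k" by (simp add: sum_list_replicate)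
  have b1: "block ?l i = block l i" if "i < length l" for i
    using that by (auto simp: block_def)
  have t: "sum_list (take (length l + i) ?l) = sum_list l + i" if "i \<le> k" for i
    using that by (simp add: sum_list_replicate min_def)
  have b2: "block ?l (length l + i) = {sum_list l + i + 1}" if "i < k" for i
    using t[of i] t[of "Suc i"] that unfolding block_def by auto
  have t': "sum_list (take (length l + i) ?l) = sum_list l + k" if "i \<ge> k" for i
    using that by (simp add: sum_list_replicate min_def)
  have b3: "block ?l (length l + i) = {}" if "i \<ge> k" for i
    using t'[of i] t'[of "Suc i"] that unfolding block_def by auto
  show ?thesis
  proof (intro subset_antisym subsetI)
    fix \<pi> assume p: "\<pi> \<in> young_subgroup ?l"
    have "\<pi> x = x" if "x \<in> {1..sum_list ?l} - {1..sum_list l}" for x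
    proof -
      define i where "i = x - sum_list l - 1"
      have i: "i < k" "x = sum_list l + i + 1" using that sum by (auto simp: i_def)
      have "\<pi> ` block ?l (length l + i) = block ?l (length l + i)"
        using p i unfolding young_subgroup_def by simp
      then show ?thesis using b2[OF i(1)] i(2) by simp
    qed
    then have "\<pi> permutes {1..sum_list l}"
      by (intro permutes_superset[OF young_permutes[OF p]]) blast
    moreover have "\<pi> ` block l i = block l i" if "i < length l" for i
    proof -
      have "\<pi> ` block ?l i = block ?l i" using p that by (simp add: young_subgroup_def)
      then show ?thesis by (simp only: b1[OF that])
    qed
    ultimately show "\<pi> \<in> young_subgroup l" by (simp add: young_subgroup_def)
  next
    fix \<pi> assume p: "\<pi> \<in> young_subgroup l"
    have "\<pi> permutes {1..sum_list ?l}"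
      using young_permutes[OF p] by (rule permutes_subset) (simp add: sum)
    moreover have "\<pi> ` block ?l i = block ?l i" if "i < length ?l" for i
    proof (cases "i < length l")
      case True
      then show ?thesis using p b1[OF True] by (simp add: young_subgroup_def)
    next
      case False
      then obtain i' where i': "i = length l + i'" using le_Suc_ex by (metis not_less)
      have "\<pi> (sum_list l + i' + 1) = sum_list l + i' + 1"
        by (rule permutes_not_in[OF young_permutes[OF p]]) simp
      then show ?thesis using b2[of i'] b3[of i'] unfolding i' by (cases "i' < k") auto
    qed
    ultimately show "\<pi> \<in> young_subgroup ?l" by (simp add: young_subgroup_def)
  qed
qed

definition class_sizes :: "('a \<Rightarrow> 'c) \<Rightarrow> 'a set \<Rightarrow> nat multiset" where
  "class_sizes k A = image_mset (\<lambda>c. card {i \<in> A. k i = c}) (mset_set (k ` A))"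

lemma class_sizes_bij:
  assumes A: "finite A"
  shows "0 \<notin># class_sizes k A" "sum_mset (class_sizes k A) = card A"
    "\<exists>b. bij_betw b {1..card A} A \<and> (\<forall>x\<in>{1..card A}. \<forall>y\<in>{1..card A}.
        k (b x) = k (b y) \<longleftrightarrow> blk (parts (class_sizes k A)) x = blk (parts (class_sizes k A)) y)"
proof -
  let ?sz = "\<lambda>c. card {i \<in> A. k i = c}"
  show "0 \<notin># class_sizes k A" using A by (auto simp: class_sizes_def)
  have "card A = (\<Sum>c\<in>k ` A. ?sz c)"
    using sum.image_gen[of A "\<lambda>_. 1::nat" k] A by simp
  then show sm: "sum_mset (class_sizes k A) = card A"
    by (simp add: class_sizes_def sum_unfold_sum_mset)
  define ps where "ps = parts (class_sizes k A)"
  obtain xs where xs: "mset xs = mset_set (k ` A)" by (metis ex_mset)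
  define cs where "cs = rev (sort_key ?sz xs)"
  have mcs: "mset cs = mset_set (k ` A)" using xs by (simp add: cs_def)
  have set_cs: "set cs = k ` A" using mcs A by (metis finite_imageI finite_set_mset_mset_set set_mset_mset)
  have "count (mset cs) a = (if a \<in> set cs then 1 else 0)" for a
    unfolding mcs set_cs using A by (simp add: count_mset_set')
  then have dist: "distinct cs" by (simp add: distinct_count_atmost_1)
  have "sort (map ?sz xs) = map ?sz (sort_key ?sz xs)"
    by (rule properties_for_sort) simp_all
  moreover have "mset (map ?sz xs) = class_sizes k A" by (simp add: xs class_sizes_def)
  ultimately have "sorted_list_of_multiset (class_sizes k A) = map ?sz (sort_key ?sz xs)"
    using sorted_list_of_multiset_mset[of "map ?sz xs"] by simp
  then have map_cs: "map ?sz cs = ps"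
    unfolding ps_def parts_def cs_def rev_map[symmetric] by simp
  then have len: "length cs = length ps" by (metis length_map)
  have sumps: "sum_list ps = card A" unfolding ps_def sum_parts by (rule sm)
  have blk_less: "blk ps x < length cs" if "x \<in> {1..card A}" for x
    using blk_in_block(1)[of x ps] that sumps len by simp
  have "card {x \<in> {1..card A}. cs ! blk ps x = c} = card {i \<in> A. k i = c}" for c
  proof (cases "c \<in> set cs")
    case True
    then obtain t where t: "t < length cs" "c = cs ! t" by (metis in_set_conv_nth)
    have "{x \<in> {1..card A}. cs ! blk ps x = c} = block ps t"
      using block_eq[of t ps] t len sumps blk_less dist by (auto simp: nth_eq_iff_index_eq)
    moreover have "ps ! t = ?sz (cs ! t)" using t(1) unfolding map_cs[symmetric] by (rule nth_map)
    ultimately show ?thesis using card_block[of t ps] t len by simp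
  next
    case False
    then have "{x \<in> {1..card A}. cs ! blk ps x = c} = {}" "{i \<in> A. k i = c} = {}"
      using blk_less nth_mem set_cs by auto
    then show ?thesis by (simp only: card.empty)
  qed
  then obtain b where b: "bij_betw b {1..card A} A" "\<And>x. x \<in> {1..card A} \<Longrightarrow> k (b x) = cs ! blk ps x"
    using fiber_bij[of "{1..card A}" A "\<lambda>x. cs ! blk ps x" k] A by blast
  then have "k (b x) = k (b y) \<longleftrightarrow> blk ps x = blk ps y" if "x \<in> {1..card A}" "y \<in> {1..card A}" for x y
    using that blk_less dist by (simp add: nth_eq_iff_index_eq)
  then show "\<exists>b. bij_betw b {1..card A} A \<and> (\<forall>x\<in>{1..card A}. \<forall>y\<in>{1..card A}.
        k (b x) = k (b y) \<longleftrightarrow> blk (parts (class_sizes k A)) x = blk (parts (class_sizes k A)) y)"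
    using b(1) unfolding ps_def by blast
qed

context schur
begin

definition Par :: "nat multiset set" where
  "Par = {\<nu>. 0 \<notin># \<nu> \<and> sum_mset \<nu> \<le> r}"

definition hat :: "nat multiset \<Rightarrow> nat list" where
  "hat \<nu> = parts \<nu> @ replicate (r - sum_mset \<nu>) 1 @ replicate (n - size \<nu> - (r - sum_mset \<nu>)) 0"

definition eps :: "nat \<Rightarrow> nat \<Rightarrow> nat" where
  "eps m x = (if x \<le> m \<or> r < x then x else 0)"

lemma young_hat: "young_subgroup (hat \<nu>) = young_subgroup (parts \<nu>)"
  unfolding hat_def by (rule young_pad)

lemma size_le_sum: "0 \<notin># \<nu> \<Longrightarrow> size \<nu> \<le> sum_mset (\<nu> :: nat multiset)"
proof (induction \<nu>)
  case (add x \<nu>)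
  then have "size \<nu> \<le> sum_mset \<nu>" "0 < x" by auto
  then show ?case by simp
qed simp

lemma hat_L: assumes "\<nu> \<in> Par" shows "hat \<nu> \<in> L"
proof -
  have "size \<nu> \<le> sum_mset \<nu>" "sum_mset \<nu> \<le> r" using assms size_le_sum by (auto simp: Par_def)
  then show ?thesis using rn
    by (simp add: weak_compositions_def hat_def length_parts sum_parts sum_list_replicate)
qed

lemma young_hat_permutes: "\<rho> \<in> young_subgroup (hat \<nu>) \<Longrightarrow> \<rho> permutes {1..sum_mset \<nu>}"
  using young_permutes[of \<rho> "parts \<nu>"] by (simp add: young_hat sum_parts)

lemma young_hat_iff:
  "\<rho> \<in> young_subgroup (hat \<nu>) \<longleftrightarrow> \<rho> permutes {1..sum_mset \<nu>} \<and>
     (\<forall>x\<in>{1..sum_mset \<nu>}. blk (parts \<nu>) (\<rho> x) = blk (parts \<nu>) x)"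
  unfolding young_hat young_iff sum_parts ..

lemma rook_S:
  assumes "\<alpha> 0 = 0" "\<And>x. x \<le> r \<Longrightarrow> \<alpha> x \<le> r" "\<And>x. r < x \<Longrightarrow> \<alpha> x = x"
    and inj: "\<And>x y. x \<le> r \<Longrightarrow> y \<le> r \<Longrightarrow> \<alpha> x = \<alpha> y \<Longrightarrow> \<alpha> x \<noteq> 0 \<Longrightarrow> x = y"
  shows "\<alpha> \<in> S"
proof -
  have "card {x \<in> {0..r}. \<alpha> x = i} \<le> 1" if "i \<in> {1..r}" for i
    using inj that by (intro card_le_Suc0_iff_eq[THEN iffD2, folded One_nat_def]) auto
  then have "\<alpha> \<in> rook_monoid r" using assms(1-3) by (auto simp: rook_monoid_def tau_bar_def)
  then show ?thesis using rook by blast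
qed

lemma eps_S: "m \<le> r \<Longrightarrow> eps m \<in> S"
  by (rule rook_S) (auto simp: eps_def split: if_splits)

lemma permutes_eps_commute:
  assumes "\<rho> permutes {1..m}" "m \<le> r" shows "\<rho> \<circ> eps m = eps m \<circ> \<rho>"
proof
  fix x
  consider "x = 0" | "x \<in> {1..m}" | "m < x" by fastforce
  then show "(\<rho> \<circ> eps m) x = (eps m \<circ> \<rho>) x"
  proof cases
    case 2
    then have "\<rho> x \<in> {1..m}" using assms permutes_in_image by metis
    then show ?thesis using 2 by (simp add: eps_def)
  next
    case 3
    then have "\<rho> x = x" "\<rho> 0 = 0" using assms permutes_not_in[of \<rho> "{1..m}"] by auto
    then show ?thesis by (simp add: eps_def)
  qed (use assms permutes_not_in[of \<rho> "{1..m}" 0] in \<open>simp add: eps_def\<close>)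
qed

lemma comp_eps:
  assumes "\<beta> \<in> S" "\<And>x. m < x \<Longrightarrow> x \<le> r \<Longrightarrow> \<beta> x = 0" shows "\<beta> \<circ> eps m = \<beta>"
  using assms(2) S_tau(1)[OF assms(1)] by (auto simp: fun_eq_iff eps_def)

definition idem :: "nat multiset \<Rightarrow> schur_index \<Rightarrow> 'k::field" where
  "idem \<nu> = F (hat \<nu>) (eps (sum_mset \<nu>)) (hat \<nu>)"

lemma Par_sum: "\<nu> \<in> Par \<Longrightarrow> sum_mset \<nu> \<le> r"
  by (simp add: Par_def)

lemma idem_carrier: "\<nu> \<in> Par \<Longrightarrow> idem \<nu> \<in> carrier alg"
  unfolding idem_def by (intro F_carrier hat_L eps_S Par_sum)

lemma F_idem_right:
  assumes p: "\<nu> \<in> Par" "l \<in> L" "\<beta> \<in> S" and kill: "\<And>x. sum_mset \<nu> < x \<Longrightarrow> x \<le> r \<Longrightarrow> \<beta> x = 0"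
  shows "F l \<beta> (hat \<nu>) \<otimes>\<^bsub>alg\<^esub> idem \<nu> = (F l \<beta> (hat \<nu>) :: schur_index \<Rightarrow> 'k::field)"
proof -
  let ?e = "eps (sum_mset \<nu>)"
  have be: "\<beta> \<circ> ?e = \<beta>" using comp_eps[OF p(3)] kill by blast
  have comm: "\<rho> \<circ> ?e = ?e \<circ> \<rho>" if "\<rho> \<in> young_subgroup (hat \<nu>)" for \<rho>
    by (rule permutes_eps_commute[OF young_hat_permutes[OF that] Par_sum[OF p(1)]])
  have eq: "\<beta> \<circ> \<rho> \<circ> ?e = \<beta> \<circ> \<rho>" if "\<rho> \<in> young_subgroup (hat \<nu>)" for \<rho>
    using comm[OF that] be by (metis comp_assoc)
  have "F l \<beta> (hat \<nu>) \<otimes>\<^bsub>alg\<^esub> F (hat \<nu>) ?e (hat \<nu>) = (F l (\<beta> \<circ> ?e) (hat \<nu>) :: schur_index \<Rightarrow> 'k)"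
  proof (rule F_mult_one[OF p(2) hat_L[OF p(1)] hat_L[OF p(1)] p(3) eps_S[OF Par_sum[OF p(1)]]])
    fix \<rho> assume r: "\<rho> \<in> young_subgroup (hat \<nu>)"
    show "\<beta> \<circ> \<rho> \<circ> ?e \<in> double_coset l (\<beta> \<circ> ?e) (hat \<nu>)"
      unfolding eq[OF r] be in_double_coset using r young_id by (metis id_comp)
    show "\<exists>\<pi>'\<in>young_subgroup (hat \<nu>). \<rho> \<circ> ?e = ?e \<circ> \<pi>'" using comm[OF r] r by blast
  next
    fix \<sigma> \<rho> \<pi> assume r: "\<rho> \<in> young_subgroup (hat \<nu>)" "\<pi> \<in> young_subgroup (hat \<nu>)"
      and eq1: "\<sigma> \<circ> \<beta> \<circ> \<rho> \<circ> ?e = \<beta> \<circ> ?e \<circ> \<pi>"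
    have "\<sigma> \<circ> \<beta> \<circ> \<rho> = \<beta> \<circ> \<pi>" using eq1 eq[OF r(1)] be by (metis comp_assoc)
    then have "\<sigma> \<circ> \<beta> = \<beta> \<circ> (\<pi> \<circ> pinv \<rho>)" using young_comp_pinv(1)[OF r(1)] by (metis comp_assoc comp_id)
    then show "\<exists>\<rho>'\<in>young_subgroup (hat \<nu>). \<sigma> \<circ> \<beta> = \<beta> \<circ> \<rho>'" using r young_comp young_pinv by blast
  qed
  then show ?thesis unfolding idem_def be .
qed

lemma idem_idem: "\<nu> \<in> Par \<Longrightarrow> idem \<nu> \<otimes>\<^bsub>alg\<^esub> idem \<nu> = (idem \<nu> :: schur_index \<Rightarrow> 'k::field)"
  using F_idem_right[of \<nu> "hat \<nu>" "eps (sum_mset \<nu>)"] hat_L[of \<nu>] eps_S[OF Par_sum[of \<nu>]]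
  by (simp add: idem_def eps_def)

definition rank :: "(nat \<Rightarrow> nat) \<Rightarrow> nat" where
  "rank \<alpha> = card {i \<in> {1..r}. \<exists>x\<in>{1..r}. \<alpha> x = i}"

text \<open>
  Two points of the image of \<open>\<alpha>\<close> are equivalent if they lie in the same block of \<open>l\<close> and their fibres
  meet each block of \<open>m\<close> equally often.  Composing over the partition of class sizes, the
  product of the two basis elements is a single basis element with coefficient one.
\<close>

lemma F_factor:
  assumes l: "l \<in> L" "m \<in> L" and a: "\<alpha> \<in> S"
  obtains \<nu> \<beta> \<gamma> where "\<nu> \<in> Par" "sum_mset \<nu> = rank \<alpha>" "\<beta> \<in> S" "\<gamma> \<in> S"
    "\<And>x. sum_mset \<nu> < x \<Longrightarrow> x \<le> r \<Longrightarrow> \<beta> x = 0"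
    "F l \<beta> (hat \<nu>) \<otimes>\<^bsub>alg\<^esub> F (hat \<nu>) \<gamma> m = (F l \<alpha> m :: schur_index \<Rightarrow> 'k::field)"
proof -
  define I where "I = {i \<in> {1..r}. \<exists>x\<in>{1..r}. \<alpha> x = i}"
  define fib where "fib i t = card {x \<in> {1..r}. \<alpha> x = i \<and> blk m x = t}" for i t
  define k where "k i = (blk l i, fib i)" for i
  define \<nu> where "\<nu> = class_sizes k I"
  define q where "q = card I"
  have finI: "finite I" by (simp add: I_def)
  have qr: "q \<le> r" using card_mono[of "{1..r}" I] unfolding q_def I_def by fastforce
  note cs = class_sizes_bij[OF finI, of k, folded \<nu>_def q_def]
  obtain b where b: "bij_betw b {1..q} I"
    "\<And>x y. x \<in> {1..q} \<Longrightarrow> y \<in> {1..q} \<Longrightarrow> k (b x) = k (b y) \<longleftrightarrow> blk (parts \<nu>) x = blk (parts \<nu>) y"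
    using cs(3) by blast
  have P: "\<nu> \<in> Par" using cs(1,2) qr by (simp add: Par_def)
  have bI: "b x \<in> I" if "x \<in> {1..q}" for x using bij_betwE[OF b(1)] that by blast
  have Ir: "I \<subseteq> {1..r}" by (auto simp: I_def)
  define \<beta> where "\<beta> x = (if x \<in> {1..q} then b x else if r < x then x else 0)" for x
  define bi where "bi i = (if i \<in> I then inv_into {1..q} b i else if r < i then i else 0)" for i
  have bib: "bi (b x) = x" if "x \<in> {1..q}" for x
    using bij_betw_inv_into_left[OF b(1) that] bI[OF that] by (simp add: bi_def)
  have bbi: "b (bi i) = i" "bi i \<in> {1..q}" if "i \<in> I" for i
    using bij_betw_inv_into_right[OF b(1) that] bij_betwE[OF bij_betw_inv_into[OF b(1)]] that by (auto simp: bi_def)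
  have bS: "\<beta> \<in> S"
  proof (rule rook_S)
    show "\<beta> 0 = 0" by (simp add: \<beta>_def)
    show "\<beta> x = x" if "r < x" for x using that qr by (simp add: \<beta>_def)
    show "\<beta> x \<le> r" if "x \<le> r" for x using that subsetD[OF Ir bI[of x]] by (simp add: \<beta>_def)
    show "x = y" if "x \<le> r" "y \<le> r" "\<beta> x = \<beta> y" "\<beta> x \<noteq> 0" for x y
    proof -
      have xy: "x \<in> {1..q}" "y \<in> {1..q}" using that by (auto simp: \<beta>_def split: if_splits)
      then have "b x = b y" using that(3) by (simp add: \<beta>_def)
      then show ?thesis using bij_betw_imp_inj_on[OF b(1)] xy by (blast dest: inj_onD)
    qed
  qed
  have biS: "bi \<in> S"
  proof (rule rook_S)
    show "bi 0 = 0" using Ir by (auto simp: bi_def)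
    show "bi x = x" if "r < x" for x using that Ir by (auto simp: bi_def)
    show "bi x \<le> r" if "x \<le> r" for x
    proof (cases "x \<in> I")
      case True
      then show ?thesis using bbi(2)[OF True] qr by (metis atLeastAtMost_iff order_trans)
    qed (use that in \<open>simp add: bi_def\<close>)
    show "x = y" if "x \<le> r" "y \<le> r" "bi x = bi y" "bi x \<noteq> 0" for x y
    proof -
      have "x \<in> I" "y \<in> I" using that by (auto simp: bi_def split: if_splits)
      then show ?thesis using bbi(1) that(3) by metis
    qed
  qed
  define \<gamma> where "\<gamma> = bi \<circ> \<alpha>"
  have gS: "\<gamma> \<in> S" unfolding \<gamma>_def using biS a by (rule S_comp)
  have aI: "\<alpha> x \<in> I \<or> \<alpha> x = 0" if "x \<le> r" for x
    using S_tau(1)[OF a] S_tau(2)[OF a that] that by (cases "x = 0") (force simp: I_def)+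
  have bg: "\<beta> \<circ> \<gamma> = \<alpha>"
  proof
    fix x show "(\<beta> \<circ> \<gamma>) x = \<alpha> x"
    proof (cases "x \<le> r")
      case True
      from aI[OF True] consider "\<alpha> x \<in> I" | "\<alpha> x = 0" by (rule disjE)
      then show ?thesis
      proof cases
        case 1
        then show ?thesis using bbi[OF 1] by (simp add: \<gamma>_def \<beta>_def)
      qed (use S_tau(1)[OF biS] S_tau(1)[OF bS] in \<open>simp add: \<gamma>_def\<close>)
    qed (use S_tau(3)[OF a] S_tau(3)[OF bS] S_tau(3)[OF biS] in \<open>simp add: \<gamma>_def\<close>)
  qed
  have gfib: "{x \<in> {1..r}. \<gamma> x = j \<and> blk m x = t} = {x \<in> {1..r}. \<alpha> x = b j \<and> blk m x = t}" if "j \<in> {1..q}" for j t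
  proof -
    have "\<gamma> x = j \<longleftrightarrow> \<alpha> x = b j" if x: "x \<in> {1..r}" for x
    proof
      assume g: "\<gamma> x = j"
      then have "\<alpha> x \<in> I" using \<open>j \<in> {1..q}\<close> aI[of x] x S_tau(1)[OF biS] by (auto simp: \<gamma>_def)
      then show "\<alpha> x = b j" using bbi(1) g by (auto simp: \<gamma>_def)
    next
      assume "\<alpha> x = b j"
      then show "\<gamma> x = j" using bib[OF \<open>j \<in> {1..q}\<close>] by (simp add: \<gamma>_def)
    qed
    then show ?thesis by auto
  qed
  have sum: "sum_mset \<nu> = q" using cs(2) .
  have right: "\<exists>\<pi>\<in>young_subgroup m. \<rho> \<circ> \<gamma> = \<gamma> \<circ> \<pi>" if r: "\<rho> \<in> young_subgroup (hat \<nu>)" for \<rho>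
  proof (rule right_coset_if_fibers)
    have rp: "\<rho> permutes {1..q}" "\<And>x. x \<in> {1..q} \<Longrightarrow> blk (parts \<nu>) (\<rho> x) = blk (parts \<nu>) x"
      using r unfolding young_hat_iff sum by auto
    fix i t
    show "card {x \<in> {1..sum_list m}. (\<rho> \<circ> \<gamma>) x = i \<and> blk m x = t} = card {x \<in> {1..sum_list m}. \<gamma> x = i \<and> blk m x = t}"
    proof (cases "i \<in> {1..q}")
      case True
      define y where "y = pinv \<rho> i"
      have y: "y \<in> {1..q}" "\<rho> y = i" using True rp(1) permutes_inv[OF rp(1)] unfolding y_def
        by (metis permutes_in_image, metis permutes_inverses(1))
      have "\<rho> z = i \<longleftrightarrow> z = y" for z using y(2) permutes_inj[OF rp(1)] by (auto dest: injD)
      then have "{x \<in> {1..r}. (\<rho> \<circ> \<gamma>) x = i \<and> blk m x = t} = {x \<in> {1..r}. \<alpha> x = b y \<and> blk m x = t}"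
        using gfib[OF y(1), of t] by simp
      moreover have "k (b y) = k (b i)" using b(2)[OF y(1) True] rp(2)[OF y(1)] y(2) by simp
      ultimately show ?thesis using gfib[OF True, of t] l by (simp add: L_sum k_def fib_def fun_eq_iff)
    next
      case False
      have "\<rho> z = i \<longleftrightarrow> z = i" for z using permutes_inj[OF rp(1)] permutes_not_in[OF rp(1) False] by (metis injD)
      then show ?thesis by simp
    qed
  next
    fix x assume x: "x \<notin> {1..sum_list m}"
    have "\<rho> permutes {1..q}" using young_hat_permutes[OF r] sum by simp
    moreover have "\<gamma> x \<notin> {1..q}" using x S_tau[OF gS] l qr by (cases "x = 0") (auto simp: L_sum)
    ultimately have "\<rho> (\<gamma> x) = \<gamma> x" by (rule permutes_not_in)
    then show "(\<rho> \<circ> \<gamma>) x = \<gamma> x" by simp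
  qed
  have "F l \<beta> (hat \<nu>) \<otimes>\<^bsub>alg\<^esub> F (hat \<nu>) \<gamma> m = (F l (\<beta> \<circ> \<gamma>) m :: schur_index \<Rightarrow> 'k)"
  proof (rule F_mult_one[OF l(1) hat_L[OF P] l(2) bS gS])
    fix \<rho> assume r: "\<rho> \<in> young_subgroup (hat \<nu>)"
    then obtain \<pi> where p: "\<pi> \<in> young_subgroup m" "\<rho> \<circ> \<gamma> = \<gamma> \<circ> \<pi>" using right by blast
    then have "\<beta> \<circ> \<rho> \<circ> \<gamma> = id \<circ> (\<beta> \<circ> \<gamma>) \<circ> \<pi>" by (metis comp_assoc id_comp)
    then show "\<beta> \<circ> \<rho> \<circ> \<gamma> \<in> double_coset l (\<beta> \<circ> \<gamma>) m"
      unfolding in_double_coset using p young_id by blast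
    show "\<exists>\<pi>'\<in>young_subgroup m. \<rho> \<circ> \<gamma> = \<gamma> \<circ> \<pi>'" using p by blast
  next
    fix \<sigma> \<rho> \<pi> assume s: "\<sigma> \<in> young_subgroup l" "\<rho> \<in> young_subgroup (hat \<nu>)" "\<pi> \<in> young_subgroup m"
      and eq: "\<sigma> \<circ> \<beta> \<circ> \<rho> \<circ> \<gamma> = \<beta> \<circ> \<gamma> \<circ> \<pi>"
    obtain \<pi>' where p': "\<pi>' \<in> young_subgroup m" "\<rho> \<circ> \<gamma> = \<gamma> \<circ> \<pi>'" using right s by blast
    have "\<sigma> \<circ> \<alpha> \<circ> \<pi>' = \<alpha> \<circ> \<pi>" using eq p'(2) bg by (metis comp_assoc)
    then have sa: "\<sigma> \<circ> \<alpha> = \<alpha> \<circ> (\<pi> \<circ> pinv \<pi>')" using young_comp_pinv(1)[OF p'(1)] by (metis comp_assoc comp_id)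
    have pp: "\<pi> \<circ> pinv \<pi>' \<in> young_subgroup m" using s p' young_comp young_pinv by blast
    have sp: "\<sigma> permutes {1..r}" "\<And>x. x \<in> {1..r} \<Longrightarrow> blk l (\<sigma> x) = blk l x" using s(1) l by (auto simp: young_iff L_sum)
    have fib: "fib (\<sigma> i) = fib i" for i
    proof
      fix t
      have "card {x \<in> {1..r}. \<alpha> ((\<pi> \<circ> pinv \<pi>') x) = \<sigma> i \<and> blk m x = t} = fib (\<sigma> i) t"
        using right_coset_fibers[OF pp, of \<alpha> "\<sigma> i" t] l by (simp add: L_sum fib_def)
      moreover have "\<alpha> ((\<pi> \<circ> pinv \<pi>') x) = \<sigma> i \<longleftrightarrow> \<alpha> x = i" for x
      proof -
        have "\<alpha> ((\<pi> \<circ> pinv \<pi>') x) = \<sigma> (\<alpha> x)" using fun_cong[OF sa, of x] by simp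
        then show ?thesis by (simp only: inj_eq[OF permutes_inj[OF sp(1)]])
      qed
      ultimately show "fib (\<sigma> i) t = fib i t" unfolding fib_def by simp
    qed
    have sI: "\<sigma> i \<in> I" "k (\<sigma> i) = k i" if i: "i \<in> I" for i
    proof -
      obtain x where x: "x \<in> {1..r}" "\<alpha> x = i" using i unfolding I_def by blast
      have "fib i (blk m x) \<noteq> 0" using x by (auto simp: fib_def)
      then have "fib (\<sigma> i) (blk m x) \<noteq> 0" using fib by simp
      then have "{y \<in> {1..r}. \<alpha> y = \<sigma> i \<and> blk m y = blk m x} \<noteq> {}" unfolding fib_def by (metis card.empty)
      moreover have "\<sigma> i \<in> {1..r}" using i Ir permutes_in_image[OF sp(1)] by blast
      ultimately show "\<sigma> i \<in> I" unfolding I_def by blast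
      show "k (\<sigma> i) = k i" using fib sp(2) i Ir by (auto simp: k_def)
    qed
    define \<rho>' where "\<rho>' x = (if x \<in> {1..q} then bi (\<sigma> (b x)) else x)" for x
    have r': "\<rho>' x \<in> {1..q}" "b (\<rho>' x) = \<sigma> (b x)" if "x \<in> {1..q}" for x
      using bbi[OF sI(1)[OF bI[OF that]]] that by (auto simp: \<rho>'_def)
    have "inj_on \<rho>' {1..q}"
    proof (rule inj_onI)
      fix x y assume "x \<in> {1..q}" "y \<in> {1..q}" "\<rho>' x = \<rho>' y"
      then have "\<sigma> (b x) = \<sigma> (b y)" using r'(2) by metis
      then have "b x = b y" by (simp only: inj_eq[OF permutes_inj[OF sp(1)]])
      then show "x = y" using bij_betw_imp_inj_on[OF b(1)] \<open>x \<in> {1..q}\<close> \<open>y \<in> {1..q}\<close> by (auto dest: inj_onD)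
    qed
    moreover have "\<rho>' ` {1..q} \<subseteq> {1..q}" using r'(1) by blast
    ultimately have "bij_betw \<rho>' {1..q} {1..q}"
      unfolding bij_betw_def using endo_inj_surj[of "{1..q}" \<rho>'] by blast
    then have "\<rho>' permutes {1..q}" by (rule bij_imp_permutes) (simp only: \<rho>'_def if_False)
    moreover have "blk (parts \<nu>) (\<rho>' x) = blk (parts \<nu>) x" if "x \<in> {1..q}" for x
      using b(2)[OF r'(1)[OF that] that] r'(2)[OF that] sI(2)[OF bI[OF that]] by simp
    ultimately have "\<rho>' \<in> young_subgroup (hat \<nu>)" unfolding young_hat_iff sum by blast
    moreover have "\<sigma> \<circ> \<beta> = \<beta> \<circ> \<rho>'"
    proof
      fix x show "(\<sigma> \<circ> \<beta>) x = (\<beta> \<circ> \<rho>') x"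
      proof (cases "x \<in> {1..q}")
        case True
        then show ?thesis using r'[OF True] by (simp add: \<beta>_def)
      next
        case False
        have "\<beta> x \<notin> {1..r}" using False by (auto simp: \<beta>_def)
        then have "\<sigma> (\<beta> x) = \<beta> x" by (rule permutes_not_in[OF sp(1)])
        then show ?thesis using False by (simp only: o_apply \<rho>'_def if_False)
      qed
    qed
    ultimately show "\<exists>\<rho>'\<in>young_subgroup (hat \<nu>). \<sigma> \<circ> \<beta> = \<beta> \<circ> \<rho>'" by blast
  qed
  moreover have "\<beta> x = 0" if "sum_mset \<nu> < x" "x \<le> r" for x using that sum by (simp add: \<beta>_def)
  moreover have "sum_mset \<nu> = rank \<alpha>" unfolding sum q_def I_def rank_def ..
  ultimately show ?thesis using that[OF P _ bS gS] bg by blast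
qed

lemma F_in_ideal:
  assumes "l \<in> L" "m \<in> L" "\<alpha> \<in> S" and J: "ideal J (alg :: (schur_index \<Rightarrow> 'k::field) ring)"
    and gen: "\<And>\<nu>. \<nu> \<in> Par \<Longrightarrow> sum_mset \<nu> = rank \<alpha> \<Longrightarrow> idem \<nu> \<in> J"
  shows "F l \<alpha> m \<in> J"
proof -
  interpret J: ideal J "alg :: (schur_index \<Rightarrow> 'k) ring" by fact
  obtain \<nu> \<beta> \<gamma> where f: "\<nu> \<in> Par" "sum_mset \<nu> = rank \<alpha>" "\<beta> \<in> S" "\<gamma> \<in> S"
    "\<And>x. sum_mset \<nu> < x \<Longrightarrow> x \<le> r \<Longrightarrow> \<beta> x = 0"
    "F l \<beta> (hat \<nu>) \<otimes>\<^bsub>alg\<^esub> F (hat \<nu>) \<gamma> m = (F l \<alpha> m :: schur_index \<Rightarrow> 'k)"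
    using F_factor[OF assms(1-3)] by blast
  have "F l \<beta> (hat \<nu>) \<in> J"
  proof -
    have "F l \<beta> (hat \<nu>) \<otimes>\<^bsub>alg\<^esub> idem \<nu> \<in> J"
      using gen[OF f(1,2)] F_carrier[OF assms(1) hat_L[OF f(1)] f(3)] by (rule J.I_l_closed)
    then show ?thesis by (simp only: F_idem_right[OF f(1) assms(1) f(3) f(5)])
  qed
  then show ?thesis unfolding f(6)[symmetric]
    using F_carrier assms(2) hat_L f by (intro J.I_r_closed) auto
qed

lemma schur_coeff_nonzero_rep:
  assumes "schur_coeff (l, double_coset l \<alpha> v, v) (v, double_coset v \<beta> m, m) (l, double_coset l \<gamma> m, m) \<noteq> 0"
  shows "\<exists>\<rho>\<in>young_subgroup v. double_coset l \<gamma> m = double_coset l (\<alpha> \<circ> \<rho> \<circ> \<beta>) m"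
proof -
  have "pair_count l \<alpha> v \<beta> m \<gamma> \<noteq> 0"
    using schur_coeff_mult[of l \<alpha> v \<beta> m \<gamma>] assms n_R_pos[of l \<alpha> v] n_R_pos[of v \<beta> m]
    by (metis mult_eq_0_iff less_numeral_extra(3))
  then have "card {\<rho> \<in> young_subgroup v. \<alpha> \<circ> \<rho> \<circ> \<beta> \<in> double_coset l \<gamma> m} \<noteq> 0"
    using pair_count_eq[of l \<gamma> m v \<alpha> \<beta>] by (metis mult_0_right)
  then have "{\<rho> \<in> young_subgroup v. \<alpha> \<circ> \<rho> \<circ> \<beta> \<in> double_coset l \<gamma> m} \<noteq> {}" by (metis card.empty)
  then show ?thesis using double_coset_eq_iff by blast
qed

lemma Bas_cases:
  assumes "c \<in> Bas"
  obtains l \<alpha> m where "l \<in> L" "m \<in> L" "\<alpha> \<in> S" "c = (l, double_coset l \<alpha> m, m)"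
proof -
  obtain l D m where c: "c = (l, D, m)" by (cases c) auto
  then show ?thesis using assms that unfolding schur_basis_def double_cosets_def by auto
qed

lemma alg_mult_nonzeroD:
  fixes x y :: "schur_index \<Rightarrow> 'k::field"
  assumes "(x \<otimes>\<^bsub>alg\<^esub> y) c \<noteq> 0"
  obtains l \<alpha> v \<beta> m \<rho> where "l \<in> L" "v \<in> L" "m \<in> L" "\<alpha> \<in> S" "\<beta> \<in> S" "\<rho> \<in> young_subgroup v"
    "x (l, double_coset l \<alpha> v, v) \<noteq> 0" "y (v, double_coset v \<beta> m, m) \<noteq> 0" "c = (l, double_coset l (\<alpha> \<circ> \<rho> \<circ> \<beta>) m, m)"
proof -
  have c: "c \<in> Bas" and "(\<Sum>a\<in>Bas. \<Sum>b\<in>Bas. x a * y b * of_nat (schur_coeff a b c)) \<noteq> 0"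
    using assms by (auto simp: alg_mult simp del: schur_coeff.simps split: if_splits)
  then obtain a where a: "a \<in> Bas" "(\<Sum>b\<in>Bas. x a * y b * of_nat (schur_coeff a b c)) \<noteq> 0"
    using sum.not_neutral_contains_not_neutral by blast
  then obtain b where b: "b \<in> Bas" "x a * y b * of_nat (schur_coeff a b c) \<noteq> 0"
    using sum.not_neutral_contains_not_neutral by blast
  then have xy: "x a \<noteq> 0" "y b \<noteq> 0" "schur_coeff a b c \<noteq> 0" by (auto simp del: schur_coeff.simps intro!: Nat.gr0I)
  obtain l \<alpha> v where a': "l \<in> L" "v \<in> L" "\<alpha> \<in> S" "a = (l, double_coset l \<alpha> v, v)" using a(1) by (rule Bas_cases)
  obtain w \<beta> m where b': "w \<in> L" "m \<in> L" "\<beta> \<in> S" "b = (w, double_coset w \<beta> m, m)" using b(1) by (rule Bas_cases)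
  obtain l' \<gamma> m' where c': "l' \<in> L" "m' \<in> L" "\<gamma> \<in> S" "c = (l', double_coset l' \<gamma> m', m')" using c by (rule Bas_cases)
  have eq: "v = w" "l' = l" "m' = m" using xy(3) schur_coeff_nonzeroD unfolding a' b' c' by blast+
  obtain \<rho> where "\<rho> \<in> young_subgroup v" "double_coset l \<gamma> m = double_coset l (\<alpha> \<circ> \<rho> \<circ> \<beta>) m"
    using schur_coeff_nonzero_rep xy(3) unfolding a' b' c' eq by blast
  then show ?thesis using that[of l v m \<alpha> \<beta> \<rho>] a' b' c' xy eq by blast
qed

lemma F_nonzero_iff: "(F l \<alpha> m :: schur_index \<Rightarrow> 'k::field) c \<noteq> 0 \<longleftrightarrow> c = (l, double_coset l \<alpha> m, m)"
  by (simp add: F_def basis_elem_def)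

lemma mult_idem_support:
  fixes x :: "schur_index \<Rightarrow> 'k::field"
  assumes "\<nu> \<in> Par" "(x \<otimes>\<^bsub>alg\<^esub> idem \<nu>) c \<noteq> 0"
  obtains l \<alpha> where "l \<in> L" "\<alpha> \<in> S" "c = (l, double_coset l \<alpha> (hat \<nu>), hat \<nu>)"
    "\<And>x. sum_mset \<nu> < x \<Longrightarrow> x \<le> r \<Longrightarrow> \<alpha> x = 0"
proof -
  let ?e = "eps (sum_mset \<nu>)"
  obtain l \<alpha> v \<beta> m \<rho> where a: "l \<in> L" "v \<in> L" "m \<in> L" "\<alpha> \<in> S" "\<beta> \<in> S" "\<rho> \<in> young_subgroup v"
    "(idem \<nu> :: schur_index \<Rightarrow> 'k) (v, double_coset v \<beta> m, m) \<noteq> 0" "c = (l, double_coset l (\<alpha> \<circ> \<rho> \<circ> \<beta>) m, m)"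
    using alg_mult_nonzeroD[OF assms(2)] by metis
  have v: "v = hat \<nu>" "m = hat \<nu>" "\<beta> \<in> double_coset (hat \<nu>) ?e (hat \<nu>)"
    using a(7) double_coset_self[of \<beta> v m] unfolding idem_def F_nonzero_iff by auto
  obtain \<sigma> \<pi> where s: "\<sigma> \<in> young_subgroup (hat \<nu>)" "\<pi> \<in> young_subgroup (hat \<nu>)" "\<beta> = \<sigma> \<circ> ?e \<circ> \<pi>"
    using v(3) unfolding in_double_coset by blast
  have e: "?e \<in> S" using eps_S Par_sum assms(1) by blast
  let ?a = "\<alpha> \<circ> \<rho> \<circ> \<sigma> \<circ> ?e"
  have aS: "?a \<in> S" using S_comp young_S[OF a(2)] young_S[OF hat_L[OF assms(1)]] a s e by metis
  have "\<alpha> \<circ> \<rho> \<circ> \<beta> = id \<circ> ?a \<circ> \<pi>" using s(3) by (simp add: comp_assoc)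
  then have "\<alpha> \<circ> \<rho> \<circ> \<beta> \<in> double_coset l ?a (hat \<nu>)" unfolding in_double_coset using young_id s(2) by blast
  then have "c = (l, double_coset l ?a (hat \<nu>), hat \<nu>)" using a(8) v double_coset_eq_iff by metis
  moreover have "?a x = 0" if "sum_mset \<nu> < x" "x \<le> r" for x
  proof -
    have "\<alpha> \<circ> \<rho> \<circ> \<sigma> \<in> S" using S_comp young_S[OF a(2)] young_S[OF hat_L[OF assms(1)]] a s by metis
    then have "(\<alpha> \<circ> \<rho> \<circ> \<sigma>) 0 = 0" by (rule S_tau)
    then show ?thesis using that by (simp add: eps_def)
  qed
  ultimately show ?thesis using that a(1) aS by blast
qed

lemma idem_mult_idem_support:
  fixes x :: "schur_index \<Rightarrow> 'k::field"
  assumes "\<nu> \<in> Par" "(idem \<nu> \<otimes>\<^bsub>alg\<^esub> (x \<otimes>\<^bsub>alg\<^esub> idem \<nu>)) c \<noteq> 0"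
  obtains \<alpha> where "\<alpha> \<in> S" "c = (hat \<nu>, double_coset (hat \<nu>) \<alpha> (hat \<nu>), hat \<nu>)"
    "\<And>x. sum_mset \<nu> < x \<Longrightarrow> x \<le> r \<Longrightarrow> \<alpha> x = 0" "\<And>x. x \<le> r \<Longrightarrow> \<alpha> x \<le> sum_mset \<nu>"
proof -
  let ?e = "eps (sum_mset \<nu>)"
  have e: "?e \<in> S" using eps_S Par_sum assms(1) by blast
  obtain l \<alpha> v \<beta> m \<rho> where a: "l \<in> L" "v \<in> L" "m \<in> L" "\<alpha> \<in> S" "\<beta> \<in> S" "\<rho> \<in> young_subgroup v"
    "(idem \<nu> :: schur_index \<Rightarrow> 'k) (l, double_coset l \<alpha> v, v) \<noteq> 0"
    "(x \<otimes>\<^bsub>alg\<^esub> idem \<nu>) (v, double_coset v \<beta> m, m) \<noteq> 0" "c = (l, double_coset l (\<alpha> \<circ> \<rho> \<circ> \<beta>) m, m)"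
    by (rule alg_mult_nonzeroD[OF assms(2)]) blast
  have v: "v = hat \<nu>" "l = hat \<nu>" "\<alpha> \<in> double_coset (hat \<nu>) ?e (hat \<nu>)"
    using a(7) double_coset_self[of \<alpha> l v] unfolding idem_def F_nonzero_iff by auto
  obtain \<sigma> \<pi> where s: "\<sigma> \<in> young_subgroup (hat \<nu>)" "\<pi> \<in> young_subgroup (hat \<nu>)" "\<alpha> = \<sigma> \<circ> ?e \<circ> \<pi>"
    using v(3) unfolding in_double_coset by blast
  obtain l' \<beta>' where b: "\<beta>' \<in> S" "(v, double_coset v \<beta> m, m) = (l', double_coset l' \<beta>' (hat \<nu>), hat \<nu>)"
    "\<And>x. sum_mset \<nu> < x \<Longrightarrow> x \<le> r \<Longrightarrow> \<beta>' x = 0"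
    using mult_idem_support[OF assms(1) a(8)] by metis
  have m: "m = hat \<nu>" and "\<beta> \<in> double_coset v \<beta>' (hat \<nu>)" using b(2) double_coset_self by auto
  then obtain \<sigma>' \<pi>' where t: "\<sigma>' \<in> young_subgroup (hat \<nu>)" "\<pi>' \<in> young_subgroup (hat \<nu>)" "\<beta> = \<sigma>' \<circ> \<beta>' \<circ> \<pi>'"
    unfolding in_double_coset v by blast
  let ?a = "?e \<circ> \<pi> \<circ> \<rho> \<circ> \<sigma>' \<circ> \<beta>'"
  note yS = young_S[OF hat_L[OF assms(1)]]
  have pS: "\<pi> \<circ> \<rho> \<circ> \<sigma>' \<in> S" using S_comp yS s t a(6) unfolding v by metis
  have pbS: "\<pi> \<circ> \<rho> \<circ> \<sigma>' \<circ> \<beta>' \<in> S" using S_comp pS b by metis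
  have aS: "?a \<in> S" using S_comp[OF e pbS] by (simp add: comp_assoc)
  have "\<alpha> \<circ> \<rho> \<circ> \<beta> = \<sigma> \<circ> ?a \<circ> \<pi>'" using s(3) t(3) by (simp add: comp_assoc)
  then have "\<alpha> \<circ> \<rho> \<circ> \<beta> \<in> double_coset (hat \<nu>) ?a (hat \<nu>)" unfolding in_double_coset using s t by blast
  then have "c = (hat \<nu>, double_coset (hat \<nu>) ?a (hat \<nu>), hat \<nu>)" using a(9) v m double_coset_eq_iff by metis
  moreover have "?a x = 0" if "sum_mset \<nu> < x" "x \<le> r" for x
    using b(3)[OF that] S_tau(1)[OF pS] by (simp add: eps_def)
  moreover have "?a x \<le> sum_mset \<nu>" if "x \<le> r" for x
    using S_tau(2)[OF pbS that] by (simp add: eps_def)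
  ultimately show ?thesis using that aS by blast
qed

end

subsection \<open>Straightening\<close>

lemma preserves_class_part:
  assumes M: "finite M" and s: "\<sigma> permutes M" "\<And>x. x \<in> M \<Longrightarrow> bk (\<sigma> x) = bk x"
    and r: "\<rho> permutes M" "\<And>x. x \<in> M \<Longrightarrow> kap (\<rho> x) = kap x"
    and kap: "\<And>x. kap x = (if x \<in> E then i else bk x)"
    and E: "E = {x \<in> M. bk x = j \<and> x \<in> W}" and W: "W \<subseteq> M" and ij: "i \<noteq> j"
    and th: "(\<lambda>x. \<sigma> (\<rho> x)) ` W = W"
  shows "\<sigma> x \<in> E \<longleftrightarrow> x \<in> E"
proof -
  define \<theta> where "\<theta> x = \<sigma> (\<rho> x)" for x
  define Q where "Q = {x \<in> W. bk x = i \<or> bk x = j}"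
  have rM: "\<rho> x \<in> M" if "x \<in> M" for x using r(1) that permutes_in_image by metis
  have QM: "x \<in> M" if "x \<in> Q" for x using that W by (auto simp: Q_def)
  have inj: "inj \<theta>" using inj_compose[OF permutes_inj[OF s(1)] permutes_inj[OF r(1)]] by (simp add: \<theta>_def[abs_def] comp_def)
  have kij: "kap y = i \<or> kap y = j \<longleftrightarrow> bk y = i \<or> bk y = j" if "y \<in> M" for y
    using E by (auto simp: kap)
  have "\<theta> ` Q \<subseteq> Q"
  proof
    fix y assume "y \<in> \<theta> ` Q"
    then obtain x where x: "x \<in> Q" "y = \<theta> x" by blast
    have "bk y = bk (\<rho> x)" using s(2)[OF rM[OF QM[OF x(1)]]] x(2) by (simp add: \<theta>_def)
    moreover have "bk (\<rho> x) = i \<or> bk (\<rho> x) = j"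
      using kij[OF rM[OF QM[OF x(1)]]] kij[OF QM[OF x(1)]] r(2)[OF QM[OF x(1)]] x(1) by (simp add: Q_def)
    moreover have "y \<in> W" using th x by (auto simp: \<theta>_def Q_def)
    ultimately show "y \<in> Q" by (simp add: Q_def)
  qed
  moreover have "finite Q" using M W QM by (meson finite_subset subsetI)
  moreover have "inj_on \<theta> Q" using inj by (rule inj_on_subset) simp
  ultimately have thQ: "\<theta> ` Q = Q" by (metis endo_inj_surj)
  define A where "A = {x \<in> Q. bk (\<rho> x) = j}"
  have "\<rho> ` A \<subseteq> E"
  proof
    fix y assume "y \<in> \<rho> ` A"
    then obtain x where x: "x \<in> Q" "bk y = j" "y = \<rho> x" unfolding A_def by blast
    have "kap x = i" using x(1) QM[OF x(1)] E by (auto simp: kap Q_def)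
    then have "kap y = i" using r(2)[OF QM[OF x(1)]] x(3) by simp
    then show "y \<in> E" using x(2) ij by (auto simp: kap split: if_splits)
  qed
  moreover have EA: "E = \<sigma> ` \<rho> ` A"
  proof (intro subset_antisym subsetI)
    fix y assume y: "y \<in> E"
    then have "y \<in> Q" using E by (auto simp: Q_def)
    then obtain x where x: "x \<in> Q" "y = \<sigma> (\<rho> x)" using thQ unfolding \<theta>_def by blast
    then have "bk (\<rho> x) = j" using s(2)[OF rM[OF QM[OF x(1)]]] y E by simp
    then show "y \<in> \<sigma> ` \<rho> ` A" using x by (auto simp: A_def)
  next
    fix y assume "y \<in> \<sigma> ` \<rho> ` A"
    then obtain x where x: "x \<in> Q" "bk (\<rho> x) = j" "y = \<sigma> (\<rho> x)" by (auto simp: A_def)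
    then have "y \<in> Q" "bk y = j" using thQ s(2)[OF rM[OF QM[OF x(1)]]] by (auto simp: \<theta>_def)
    then show "y \<in> E" using E QM by (auto simp: Q_def)
  qed
  moreover have "finite E" using E M by simp
  moreover have "card (\<rho> ` A) = card E"
    unfolding EA using permutes_inj_on[OF s(1)] by (simp add: card_image)
  ultimately have "\<rho> ` A = E" by (metis card_subset_eq)
  then have "\<sigma> ` E = E" using EA by simp
  then show ?thesis using inj_image_mem_iff[OF permutes_inj[OF s(1)], of x E] by simp
qed

lemma exists_permutes_image:
  assumes A: "finite A" and E: "E \<subseteq> A" "E' \<subseteq> A" "card E' = card E"
  shows "\<exists>\<theta>. \<theta> permutes A \<and> \<theta> ` E' = E"
proof -
  have fin: "finite E" "finite E'" using A E finite_subset by blast+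
  have "card {x \<in> A. (x \<in> E') = c} = card {x \<in> A. (x \<in> E) = c}" for c
  proof (cases c)
    case True
    then have "{x \<in> A. (x \<in> E') = c} = E'" "{x \<in> A. (x \<in> E) = c} = E" using E by auto
    then show ?thesis using E(3) by simp
  next
    case False
    then have "{x \<in> A. (x \<in> E') = c} = A - E'" "{x \<in> A. (x \<in> E) = c} = A - E" using E by auto
    then show ?thesis using E fin by (simp add: card_Diff_subset)
  qed
  then obtain f where f: "bij_betw f A A" "\<And>x. x \<in> A \<Longrightarrow> (f x \<in> E) = (x \<in> E')"
    using fiber_bij[OF A A, of "\<lambda>x. x \<in> E'" "\<lambda>x. x \<in> E"] by blast
  define \<theta> where "\<theta> x = (if x \<in> A then f x else x)" for x
  have "bij_betw \<theta> A A" using f(1) by (rule bij_betw_cong[THEN iffD1, rotated]) (simp add: \<theta>_def)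
  then have "\<theta> permutes A" by (rule bij_imp_permutes) (simp only: \<theta>_def if_False)
  moreover have "\<theta> ` E' = E"
  proof (rule card_subset_eq[OF fin(1)])
    show "\<theta> ` E' \<subseteq> E" using f(2) E(2) by (auto simp: \<theta>_def)
    show "card (\<theta> ` E') = card E" using E(3) permutes_inj_on[OF \<open>\<theta> permutes A\<close>] by (simp add: card_image)
  qed
  ultimately show ?thesis by blast
qed

lemma class_part_factor:
  fixes M :: "nat set"
  assumes M: "finite M" and r: "\<rho> permutes M" "\<And>x. x \<in> M \<Longrightarrow> kap (\<rho> x) = kap x"
    and kap: "\<And>x. kap x = (if x \<in> E then i else bk x)"
    and E: "E = {x \<in> M. bk x = j \<and> x \<in> W}" and W: "W \<subseteq> M" and ij: "i \<noteq> j"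
    and B: "B = {x \<in> M. bk x = i}"
  shows "card (B \<inter> W) \<le> card (B \<inter> \<rho> ` W)"
    and "card (B \<inter> \<rho> ` W) = card (B \<inter> W) \<Longrightarrow>
      \<exists>\<sigma> \<theta>. \<sigma> permutes M \<and> \<theta> permutes W \<and> \<rho> = \<sigma> \<circ> \<theta> \<and> (\<forall>x\<in>M. bk (\<sigma> x) = bk x)"
proof -
  define K where "K = {x \<in> M. kap x = i}"
  have KBE: "K = B \<union> E" "B \<inter> E = {}" "E \<subseteq> W" using E B ij by (auto simp: K_def kap)
  have fin: "finite B" "finite E" "finite W" "finite K"
    using M W E B finite_subset[OF W M] by (auto simp: K_def)
  have rK: "\<rho> x \<in> K \<longleftrightarrow> x \<in> K" for x
    using r(2) permutes_in_image[OF r(1), of x] by (auto simp: K_def)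
  then have rKW: "K \<inter> \<rho> ` W = \<rho> ` (K \<inter> W)" by (auto simp: rK)
  have "card (B \<inter> \<rho> ` W) + card (E \<inter> \<rho> ` W) = card (K \<inter> \<rho> ` W)"
    using KBE fin by (subst card_Un_disjoint[symmetric]) (auto intro!: arg_cong[where f = card])
  also have "\<dots> = card (K \<inter> W)"
    unfolding rKW using permutes_inj_on[OF r(1)] by (rule card_image)
  also have "\<dots> = card (B \<inter> W) + card E"
    using KBE fin by (subst card_Un_disjoint[symmetric]) (auto intro!: arg_cong[where f = card])
  finally have eq: "card (B \<inter> \<rho> ` W) + card (E \<inter> \<rho> ` W) = card (B \<inter> W) + card E" .
  moreover have "card (E \<inter> \<rho> ` W) \<le> card E" using fin by (intro card_mono) auto
  ultimately show "card (B \<inter> W) \<le> card (B \<inter> \<rho> ` W)" by linarith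
  assume "card (B \<inter> \<rho> ` W) = card (B \<inter> W)"
  then have "card (E \<inter> \<rho> ` W) = card E" using eq by linarith
  then have "E \<inter> \<rho> ` W = E" using fin by (intro card_subset_eq) auto
  then have "E \<subseteq> \<rho> ` W" by (simp only: le_iff_inf)
  moreover have "E \<subseteq> K" by (simp only: KBE(1) Un_upper2)
  ultimately have "E \<subseteq> K \<inter> \<rho> ` W" by (intro Int_greatest)
  then have ErKW: "E \<subseteq> \<rho> ` (K \<inter> W)" unfolding rKW .
  define E' where "E' = {x \<in> K \<inter> W. \<rho> x \<in> E}"
  have rE': "\<rho> ` E' = E" using ErKW by (auto simp: E'_def)
  then have "card E' = card E" using permutes_inj_on[OF r(1)] by (metis card_image)
  then obtain \<theta> where th: "\<theta> permutes (K \<inter> W)" "\<theta> ` E' = E"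
    using exists_permutes_image[of "K \<inter> W" E E'] KBE fin by (auto simp: E'_def)
  define \<sigma> where "\<sigma> = \<rho> \<circ> pinv \<theta>"
  have thM: "\<theta> permutes M" using th(1) by (rule permutes_subset) (auto simp: K_def)
  have sM: "\<sigma> permutes M" unfolding \<sigma>_def using permutes_inv[OF thM] r(1) by (rule permutes_compose)
  have rs: "\<rho> = \<sigma> \<circ> \<theta>" unfolding \<sigma>_def using permutes_inv_o[OF thM] by (simp add: comp_assoc)
  have "\<theta> permutes W" using th(1) by (rule permutes_subset) simp
  moreover have "bk (\<sigma> x) = bk x" if x: "x \<in> M" for x
  proof -
    define y where "y = pinv \<theta> x"
    have y: "y \<in> M" "\<theta> y = x" using permutes_inverses(1)[OF thM, of x] permutes_in_image[OF permutes_inv[OF thM], of x] x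
      by (auto simp: y_def)
    have "kap (\<theta> y) = kap y"
    proof (cases "y \<in> K \<inter> W")
      case True
      then have "\<theta> y \<in> K \<inter> W" using permutes_in_image[OF th(1)] by blast
      then show ?thesis using True by (simp add: K_def)
    next
      case False then show ?thesis using permutes_not_in[OF th(1)] by simp
    qed
    then have k: "kap (\<sigma> x) = kap x" using r(2)[OF y(1)] y(2) by (simp add: rs[symmetric] \<sigma>_def y_def)
    have "\<sigma> ` E = E" using th(2) rE' rs by (metis image_comp)
    then have "\<sigma> x \<in> E \<longleftrightarrow> x \<in> E" using inj_image_mem_iff[OF permutes_inj[OF sM], of x E] by simp
    then show ?thesis using k E by (auto simp: kap split: if_splits)
  qed
  ultimately show "\<exists>\<sigma> \<theta>. \<sigma> permutes M \<and> \<theta> permutes W \<and> \<rho> = \<sigma> \<circ> \<theta> \<and> (\<forall>x\<in>M. bk (\<sigma> x) = bk x)"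
    using sM rs by blast
qed

lemma class_sizes_less:
  fixes bk kap :: "'a \<Rightarrow> nat"
  assumes M: "finite M" and kap: "\<And>x. kap x = (if x \<in> E then i else bk x)"
    and E: "E \<subseteq> {x \<in> M. bk x = j}" "E \<noteq> {}" and ij: "i \<noteq> j"
    and i: "i \<in> bk ` M" and le: "card {x \<in> M. bk x = j} \<le> card {x \<in> M. bk x = i}"
  shows "class_sizes bk M < class_sizes kap M"
proof -
  define D where "D = bk ` M"
  define b where "b t = card {x \<in> M. bk x = t}" for t
  define c where "c t = card {x \<in> M. kap x = t}" for t
  define R where "R = image_mset b (mset_set (D - {i, j}))"
  have finD: "finite D" using M by (simp add: D_def)
  have jD: "j \<in> D" using E by (auto simp: D_def)
  have finE: "finite E" using E M finite_subset by fastforce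
  have D: "D = insert i (insert j (D - {i, j}))" using i jD by (auto simp: D_def)
  have "mset_set (insert i (insert j (D - {i, j}))) = {#i, j#} + mset_set (D - {i, j})"
    using finD ij by simp
  then have "mset_set D = {#i, j#} + mset_set (D - {i, j})" by (simp only: D[symmetric])
  then have 1: "class_sizes bk M = {#b i, b j#} + R"
    unfolding class_sizes_def D_def[symmetric] b_def[symmetric] R_def by simp
  have bc: "b t = c t" if "t \<in> D - {i, j}" for t
    unfolding b_def c_def using that E by (intro arg_cong[where f = card]) (auto simp: kap)
  have R: "R = image_mset c (mset_set (D - {i, j}))"
    unfolding R_def using bc finD by (intro image_mset_cong) simp
  have kD: "kap ` M - {j} = insert i (D - {i, j})"
    using E i ij by (auto simp: kap D_def image_iff split: if_splits)
  have "\<exists>Z. class_sizes kap M = {#c i#} + Z + R"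
  proof (cases "j \<in> kap ` M")
    case True
    then have "kap ` M = insert j (insert i (D - {i, j}))" using kD by blast
    then have "class_sizes kap M = {#c i#} + {#c j#} + R"
      unfolding class_sizes_def c_def[symmetric] R using finD ij by simp
    then show ?thesis by blast
  next
    case False
    then have "kap ` M = insert i (D - {i, j})" using kD by blast
    then have "class_sizes kap M = {#c i#} + {#} + R"
      unfolding class_sizes_def c_def[symmetric] R using finD ij by simp
    then show ?thesis by blast
  qed
  then obtain Z where Z: "class_sizes kap M = {#c i#} + Z + R" by blast
  have "{x \<in> M. kap x = i} = {x \<in> M. bk x = i} \<union> E" using E by (auto simp: kap)
  moreover have "{x \<in> M. bk x = i} \<inter> E = {}" using E ij by auto
  ultimately have "c i = b i + card E" unfolding c_def b_def using M finE by (simp add: card_Un_disjoint)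
  moreover have "card E > 0" using E finE by (simp add: card_gt_0_iff)
  ultimately have "b i < c i" by simp
  then have "{#b i, b j#} < {#c i#} + Z"
    using le unfolding b_def[symmetric] by (intro ex_gt_imp_less_multiset exI[of _ "c i"]) auto
  then show ?thesis unfolding 1 Z by (rule add_strict_right_mono)
qed

lemma class_sizes_parts:
  assumes "0 \<notin># \<nu>" shows "class_sizes (blk (parts \<nu>)) {1..sum_mset \<nu>} = \<nu>"
proof -
  let ?ps = "parts \<nu>" and ?M = "{1..sum_mset \<nu>}"
  have c: "card {x \<in> ?M. blk ?ps x = t} = ?ps ! t" if "t < length ?ps" for t
    using block_eq[OF that] card_block[OF that] by (simp add: sum_parts)
  have im: "blk ?ps ` ?M = {..<length ?ps}"
  proof (intro subset_antisym subsetI)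
    fix t assume t: "t \<in> {..<length ?ps}"
    then have "?ps ! t \<in># \<nu>" using mset_parts[of \<nu>] by (metis lessThan_iff nth_mem_mset)
    then have "card {x \<in> ?M. blk ?ps x = t} \<noteq> 0" using c[of t] t assms by (metis lessThan_iff)
    then have "{x \<in> ?M. blk ?ps x = t} \<noteq> {}" by (metis card.empty)
    then show "t \<in> blk ?ps ` ?M" by blast
  qed (use blk_in_block(1)[of _ ?ps] in \<open>auto simp: sum_parts\<close>)
  have "class_sizes (blk ?ps) ?M = image_mset (\<lambda>t. ?ps ! t) (mset_set {..<length ?ps})"
    unfolding class_sizes_def im by (intro image_mset_cong, rule c) simp
  also have "\<dots> = mset (map (\<lambda>t. ?ps ! t) [0..<length ?ps])"
    by (simp add: atLeast0LessThan[symmetric] mset_upt)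
  finally show ?thesis by (simp add: map_nth mset_parts)
qed

lemma parts_decreasing: "i \<le> j \<Longrightarrow> j < length (parts \<nu>) \<Longrightarrow> parts \<nu> ! j \<le> parts \<nu> ! i"
  unfolding parts_def using sorted_rev_nth_mono[of "rev (sorted_list_of_multiset \<nu>)" i j] by simp

context schur
begin

abbreviation "bk \<nu> \<equiv> blk (parts \<nu>)"

abbreviation "pts \<nu> \<equiv> {1..sum_mset \<nu>}"

abbreviation "blks \<nu> t \<equiv> {x \<in> pts \<nu>. bk \<nu> x = t}"

definition modulo_idem :: "nat multiset \<Rightarrow> (schur_index \<Rightarrow> 'k::field) set \<Rightarrow> (schur_index \<Rightarrow> 'k) set" where
  "modulo_idem \<nu> J = {x. \<exists>t. (\<lambda>c. x c - t * idem \<nu> c) \<in> J}"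

lemma ideal_add: "ideal J (alg :: (schur_index \<Rightarrow> 'k::field) ring) \<Longrightarrow> x \<in> J \<Longrightarrow> y \<in> J \<Longrightarrow> (\<lambda>c. x c + y c) \<in> J"
proof -
  assume J: "ideal J (alg :: (schur_index \<Rightarrow> 'k) ring)" and xy: "x \<in> J" "y \<in> J"
  interpret ideal J "alg :: (schur_index \<Rightarrow> 'k) ring" by fact
  have "x \<oplus>\<^bsub>alg\<^esub> y \<in> J" using xy by simp
  moreover have "x \<oplus>\<^bsub>alg\<^esub> y = (\<lambda>c. x c + y c)" by (rule ext) (rule alg_add)
  ultimately show ?thesis by simp
qed

lemma ideal_zero: "ideal J (alg :: (schur_index \<Rightarrow> 'k::field) ring) \<Longrightarrow> (\<lambda>c. 0) \<in> J"
proof -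
  assume "ideal J (alg :: (schur_index \<Rightarrow> 'k) ring)"
  then interpret ideal J "alg :: (schur_index \<Rightarrow> 'k) ring" .
  have "\<zero>\<^bsub>alg\<^esub> \<in> J" by simp
  moreover have "\<zero>\<^bsub>alg\<^esub> = (\<lambda>c. 0 :: 'k)" by (rule ext) (rule alg_zero)
  ultimately show ?thesis by simp
qed

context
  fixes J :: "(schur_index \<Rightarrow> 'k::field) set" and \<nu> :: "nat multiset"
  assumes J: "ideal J alg"
begin

lemma modulo_idem_ideal: "x \<in> J \<Longrightarrow> x \<in> modulo_idem \<nu> J"
  unfolding modulo_idem_def by (auto intro!: exI[of _ 0])

lemma modulo_idem_idem: "idem \<nu> \<in> modulo_idem \<nu> J"
  unfolding modulo_idem_def using ideal_zero[OF J] by (auto intro!: exI[of _ 1])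

lemma modulo_idem_add:
  assumes "x \<in> modulo_idem \<nu> J" "y \<in> modulo_idem \<nu> J" shows "(\<lambda>c. x c + y c) \<in> modulo_idem \<nu> J"
proof -
  obtain s t where "(\<lambda>c. x c - s * idem \<nu> c) \<in> J" "(\<lambda>c. y c - t * idem \<nu> c) \<in> J"
    using assms unfolding modulo_idem_def by blast
  then have "(\<lambda>c. (x c + y c) - (s + t) * idem \<nu> c) \<in> J"
    using ideal_add[OF J, of "\<lambda>c. x c - s * idem \<nu> c" "\<lambda>c. y c - t * idem \<nu> c"] by (simp add: algebra_simps)
  then show ?thesis unfolding modulo_idem_def by blast
qed

lemma modulo_idem_scale:
  assumes "x \<in> modulo_idem \<nu> J" shows "(\<lambda>c. a * x c) \<in> modulo_idem \<nu> J"
proof -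
  obtain s where "(\<lambda>c. x c - s * idem \<nu> c) \<in> J"
    using assms unfolding modulo_idem_def by blast
  then have "(\<lambda>c. a * x c - (a * s) * idem \<nu> c) \<in> J"
    using ideal_scale[OF J, of "\<lambda>c. x c - s * idem \<nu> c" a] by (simp add: algebra_simps)
  then show ?thesis unfolding modulo_idem_def by blast
qed

end

lemma permutes_image_mono: "\<rho> permutes {1..m} \<Longrightarrow> m \<le> r \<Longrightarrow> \<rho> permutes {1..r}"
  by (rule permutes_subset) auto

lemma double_coset_eps:
  assumes n: "\<nu> \<in> Par" and w: "w permutes pts \<nu>"
    and s: "\<sigma> permutes pts \<nu>" "\<And>x. x \<in> pts \<nu> \<Longrightarrow> bk \<nu> (\<sigma> x) = bk \<nu> x"
    and t: "\<theta> permutes pts \<nu>" "\<And>x. x \<in> pts \<nu> \<Longrightarrow> bk \<nu> (\<theta> x) = bk \<nu> x"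
  shows "double_coset (hat \<nu>) (\<sigma> \<circ> w \<circ> \<theta> \<circ> eps (sum_mset \<nu>)) (hat \<nu>) = double_coset (hat \<nu>) (w \<circ> eps (sum_mset \<nu>)) (hat \<nu>)"
proof -
  have "\<sigma> \<circ> w \<circ> \<theta> \<circ> eps (sum_mset \<nu>) = \<sigma> \<circ> (w \<circ> eps (sum_mset \<nu>)) \<circ> \<theta>"
    using permutes_eps_commute[OF t(1) Par_sum[OF n]] by (simp add: comp_assoc)
  moreover have "\<sigma> \<in> young_subgroup (hat \<nu>)" "\<theta> \<in> young_subgroup (hat \<nu>)" using s t by (auto simp: young_hat_iff)
  ultimately show ?thesis unfolding double_coset_eq_iff in_double_coset by blast
qed

text \<open>
  Recolouring the part of block \<open>j\<close> inside \<open>w b\<^sub>i\<close> as block \<open>i\<close> gives a larger partition \<open>\<kappa>\<close>,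
  and \<open>w\<close> is a term with coefficient one of a product factoring over \<open>\<kappa>\<close>.  All other terms
  \<open>w'\<close> of that product have a larger overlap of \<open>b\<^sub>i\<close> and \<open>w' b\<^sub>i\<close>.
\<close>

lemma straighten_step:
  fixes J :: "(schur_index \<Rightarrow> 'k::field) set"
  assumes J: "ideal J alg" and n: "\<nu> \<in> Par"
    and gen: "\<And>\<kappa>. \<kappa> \<in> Par \<Longrightarrow> sum_mset \<kappa> = sum_mset \<nu> \<Longrightarrow> \<nu> < \<kappa> \<Longrightarrow> idem \<kappa> \<in> J"
    and w: "w permutes pts \<nu>" and fixed: "\<And>t. t < i \<Longrightarrow> w ` blks \<nu> t = blks \<nu> t"
    and ne: "w ` blks \<nu> i \<noteq> blks \<nu> i"
    and IH: "\<And>w'. w' permutes pts \<nu> \<Longrightarrow> (\<And>t. t < i \<Longrightarrow> w' ` blks \<nu> t = blks \<nu> t) \<Longrightarrow>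
      card (blks \<nu> i \<inter> w ` blks \<nu> i) < card (blks \<nu> i \<inter> w' ` blks \<nu> i) \<Longrightarrow>
      F (hat \<nu>) (w' \<circ> eps (sum_mset \<nu>)) (hat \<nu>) \<in> modulo_idem \<nu> J"
  shows "F (hat \<nu>) (w \<circ> eps (sum_mset \<nu>)) (hat \<nu>) \<in> modulo_idem \<nu> J"
proof -
  interpret J: ideal J "alg :: (schur_index \<Rightarrow> 'k) ring" by fact
  let ?h = "hat \<nu>" and ?m = "sum_mset \<nu>" and ?M = "pts \<nu>" and ?e = "eps (sum_mset \<nu>)"
  define W where "W = w ` blks \<nu> i"
  have mr: "?m \<le> r" using Par_sum n by blast
  have WM: "W \<subseteq> ?M" unfolding W_def using permutes_image[OF w] by blast
  have cardW: "card W = card (blks \<nu> i)" unfolding W_def using permutes_inj_on[OF w] by (rule card_image)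
  have "\<not> W \<subseteq> blks \<nu> i"
  proof
    assume "W \<subseteq> blks \<nu> i"
    then have "W = blks \<nu> i" using cardW by (intro card_subset_eq) auto
    then show False using ne unfolding W_def by blast
  qed
  then obtain x0 where x0: "x0 \<in> W" "bk \<nu> x0 \<noteq> i" using WM by blast
  define j where "j = bk \<nu> x0"
  have ij: "i < j"
  proof (rule ccontr)
    assume "\<not> i < j"
    then have "j < i" using x0 by (simp add: j_def)
    then have "w ` blks \<nu> j = blks \<nu> j" by (rule fixed)
    moreover have "x0 \<in> blks \<nu> j" using x0 WM by (auto simp: j_def)
    ultimately obtain y where y: "y \<in> blks \<nu> j" "x0 = w y" by (metis (no_types, lifting) imageE)
    obtain z where z: "z \<in> blks \<nu> i" "x0 = w z" using x0(1) unfolding W_def by blast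
    have "y = z" using y z permutes_inj[OF w] by (auto dest: injD)
    then show False using y z \<open>j < i\<close> by simp
  qed
  define E where "E = {x \<in> ?M. bk \<nu> x = j \<and> x \<in> W}"
  define kap where "kap x = (if x \<in> E then i else bk \<nu> x)" for x
  have "x0 \<in> E" using x0(1) subsetD[OF WM x0(1)] by (simp add: E_def j_def)
  then have Ene: "E \<noteq> {}" by blast
  define \<kappa> where "\<kappa> = class_sizes kap ?M"
  have fin: "finite ?M" by simp
  note cs = class_sizes_bij[OF fin, of kap, folded \<kappa>_def]
  have sumk: "sum_mset \<kappa> = ?m" using cs(2) by simp
  have kP: "\<kappa> \<in> Par" using cs(1) sumk mr by (simp add: Par_def)
  have j_len: "j < length (parts \<nu>)"
    using blk_in_block(1)[of x0 "parts \<nu>"] x0 WM by (auto simp: j_def sum_parts)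
  have card_blks: "card (blks \<nu> t) = parts \<nu> ! t" if "t < length (parts \<nu>)" for t
    using block_eq[OF that] card_block[OF that] by (simp add: sum_parts)
  have "\<nu> = class_sizes (bk \<nu>) ?M" using class_sizes_parts[of \<nu>] n by (simp add: Par_def)
  also have "\<dots> < \<kappa>" unfolding \<kappa>_def
  proof (rule class_sizes_less[OF fin kap_def])
    show "E \<subseteq> blks \<nu> j" "E \<noteq> {}" "i \<noteq> j" using Ene ij by (auto simp: E_def)
    have "blks \<nu> i \<noteq> {}" using x0 unfolding W_def by blast
    then show "i \<in> bk \<nu> ` ?M" by blast
    show "card (blks \<nu> j) \<le> card (blks \<nu> i)"
      using card_blks[of i] card_blks[of j] j_len ij parts_decreasing[of i j \<nu>] by simp
  qed
  finally have less: "\<nu> < \<kappa>" .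
  have ik: "idem \<kappa> \<in> J" using gen[OF kP sumk less] .
  let ?h' = "hat \<kappa>"
  obtain b where b: "bij_betw b ?M ?M" "\<And>x y. x \<in> ?M \<Longrightarrow> y \<in> ?M \<Longrightarrow> kap (b x) = kap (b y) \<longleftrightarrow> bk \<kappa> x = bk \<kappa> y"
    using cs(3) by auto
  define g where "g x = (if x \<in> ?M then b x else x)" for x
  have "bij_betw g ?M ?M" using b(1) by (rule bij_betw_cong[THEN iffD1, rotated]) (simp add: g_def)
  then have gM: "g permutes ?M" by (rule bij_imp_permutes) (simp only: g_def if_False)
  have gk: "kap (g x) = kap (g y) \<longleftrightarrow> bk \<kappa> x = bk \<kappa> y" if "x \<in> ?M" "y \<in> ?M" for x y
    using b(2)[OF that] that by (simp add: g_def)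
  define g' where "g' = pinv g"
  have g'M: "g' permutes ?M" unfolding g'_def using gM by (rule permutes_inv)
  have gg': "g \<circ> g' = id" "g' \<circ> g = id" unfolding g'_def using permutes_inv_o[OF gM] by auto
  have ggx: "g (g' x) = x" "g' (g x) = x" for x using fun_cong[OF gg'(1), of x] fun_cong[OF gg'(2), of x] by auto
  have comm: "\<rho> \<circ> ?e = ?e \<circ> \<rho>" if "\<rho> permutes ?M" for \<rho> using permutes_eps_commute[OF that mr] .
  have ee: "?e \<circ> ?e = ?e" by (auto simp: eps_def fun_eq_iff)
  have permS: "\<rho> \<in> S" if "\<rho> permutes ?M" for \<rho> using permutes_S permutes_image_mono[OF that mr] by blast
  define \<alpha> where "\<alpha> = g \<circ> ?e"
  define \<beta> where "\<beta> = g' \<circ> w \<circ> ?e"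
  have aS: "\<alpha> \<in> S" unfolding \<alpha>_def using permS[OF gM] eps_S[OF mr] by (rule S_comp)
  have bS: "\<beta> \<in> S" unfolding \<beta>_def using S_comp[OF S_comp[OF permS[OF g'M] permS[OF w]] eps_S[OF mr]] .
  have arb: "\<alpha> \<circ> \<rho> \<circ> \<beta> = (g \<circ> \<rho> \<circ> g' \<circ> w) \<circ> ?e" if "\<rho> permutes ?M" for \<rho>
  proof -
    have p: "\<rho> \<circ> g' \<circ> w permutes ?M" using that g'M w by (intro permutes_compose)
    have "\<alpha> \<circ> \<rho> \<circ> \<beta> = g \<circ> (?e \<circ> (\<rho> \<circ> g' \<circ> w)) \<circ> ?e" by (simp add: \<alpha>_def \<beta>_def comp_assoc)
    also have "\<dots> = (g \<circ> \<rho> \<circ> g' \<circ> w) \<circ> (?e \<circ> ?e)" unfolding comm[OF p, symmetric] by (simp add: comp_assoc)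
    finally show ?thesis by (simp only: ee)
  qed
  have ab: "\<alpha> \<circ> \<beta> = w \<circ> ?e"
  proof -
    have "\<alpha> \<circ> \<beta> = (g \<circ> g') \<circ> w \<circ> ?e" using arb[OF permutes_id] by (simp add: comp_assoc)
    then show ?thesis by (simp only: gg' id_comp)
  qed
  have y': "\<rho> permutes ?M" if "\<rho> \<in> young_subgroup ?h'" for \<rho> using young_hat_permutes[OF that] sumk by simp
  have y: "\<rho> permutes ?M" if "\<rho> \<in> young_subgroup ?h" for \<rho> using young_hat_permutes[OF that] .
  have conj_M: "g \<circ> \<rho> \<circ> g' permutes ?M" if "\<rho> \<in> young_subgroup ?h'" for \<rho>
    using gM g'M y'[OF that] by (intro permutes_compose)
  have conj: "kap ((g \<circ> \<rho> \<circ> g') x) = kap x" if r: "\<rho> \<in> young_subgroup ?h'" and x: "x \<in> ?M" for \<rho> x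
  proof -
    have g'x: "g' x \<in> ?M" using x g'M permutes_in_image by metis
    then have "\<rho> (g' x) \<in> ?M" "bk \<kappa> (\<rho> (g' x)) = bk \<kappa> (g' x)" using r sumk permutes_in_image[OF y'[OF r]] by (auto simp: young_hat_iff)
    then have "kap (g (\<rho> (g' x))) = kap (g (g' x))" using gk g'x by blast
    then show ?thesis by (simp add: ggx)
  qed
  define pr :: "schur_index \<Rightarrow> 'k" where "pr = F ?h \<alpha> ?h' \<otimes>\<^bsub>alg\<^esub> F ?h' \<beta> ?h"
  have Fa: "F ?h \<alpha> ?h' \<in> J"
  proof -
    have "\<alpha> x = 0" if "sum_mset \<kappa> < x" "x \<le> r" for x
      using that sumk permutes_not_in[OF gM, of 0] by (simp add: \<alpha>_def eps_def)
    then have "F ?h \<alpha> ?h' \<otimes>\<^bsub>alg\<^esub> idem \<kappa> = (F ?h \<alpha> ?h' :: schur_index \<Rightarrow> 'k)"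
      by (rule F_idem_right[OF kP hat_L[OF n] aS])
    moreover have "F ?h \<alpha> ?h' \<otimes>\<^bsub>alg\<^esub> idem \<kappa> \<in> J"
      using ik F_carrier[OF hat_L[OF n] hat_L[OF kP] aS] by (rule J.I_l_closed)
    ultimately show ?thesis by metis
  qed
  have prJ: "pr \<in> J" unfolding pr_def
    using Fa F_carrier[OF hat_L[OF kP] hat_L[OF n] bS] by (rule J.I_r_closed)
  have Bin: "(?h, double_coset ?h \<alpha> ?h', ?h') \<in> Bas" "(?h', double_coset ?h' \<beta> ?h, ?h) \<in> Bas"
    using Bas_iff hat_L n kP aS bS by blast+
  have prc: "pr c = (if c \<in> Bas then of_nat (schur_coeff (?h, double_coset ?h \<alpha> ?h', ?h') (?h', double_coset ?h' \<beta> ?h, ?h) c) else 0)" for c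
    unfolding pr_def F_def by (rule basis_elem_mult[OF Bin])
  let ?cw = "(?h, double_coset ?h (w \<circ> ?e) ?h, ?h)"
  have weS: "w \<circ> ?e \<in> S" using permS[OF w] eps_S[OF mr] by (rule S_comp)
  have prw: "pr ?cw = 1"
  proof -
    have "pair_count ?h \<alpha> ?h' \<beta> ?h (\<alpha> \<circ> \<beta>) = n_R ?h \<alpha> ?h' * n_R ?h' \<beta> ?h"
    proof (rule pair_count_one)
      fix \<sigma> \<rho> \<pi> assume a: "\<sigma> \<in> young_subgroup ?h" "\<rho> \<in> young_subgroup ?h'" "\<pi> \<in> young_subgroup ?h"
        and eq: "\<sigma> \<circ> \<alpha> \<circ> \<rho> \<circ> \<beta> = \<alpha> \<circ> \<beta> \<circ> \<pi>"
      define \<rho>' where "\<rho>' = g \<circ> \<rho> \<circ> g'"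
      have r'M: "\<rho>' permutes ?M" unfolding \<rho>'_def using conj_M[OF a(2)] .
      have "\<sigma> \<circ> (\<rho>' \<circ> w \<circ> ?e) = w \<circ> ?e \<circ> \<pi>"
        using eq ab arb[OF y'[OF a(2)]] unfolding \<rho>'_def by (metis comp_assoc)
      then have swe: "\<sigma> \<circ> \<rho>' \<circ> w \<circ> ?e = w \<circ> \<pi> \<circ> ?e" using comm[OF y[OF a(3)]] by (metis comp_assoc)
      have swp: "\<sigma> (\<rho>' (w x)) = w (\<pi> x)" if "x \<in> ?M" for x
      proof -
        have "(\<sigma> \<circ> \<rho>' \<circ> w \<circ> ?e) x = (w \<circ> \<pi> \<circ> ?e) x" by (simp only: swe)
        then show ?thesis using that by (simp add: eps_def)
      qed
      have "\<pi> ` blks \<nu> i = blks \<nu> i"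
      proof (rule endo_inj_surj)
        show "\<pi> ` blks \<nu> i \<subseteq> blks \<nu> i" using a(3) permutes_in_image[OF y[OF a(3)]] by (auto simp: young_hat_iff)
        show "inj_on \<pi> (blks \<nu> i)" using permutes_inj_on[OF y[OF a(3)]] .
      qed simp
      moreover have "(\<lambda>x. \<sigma> (\<rho>' (w x))) ` blks \<nu> i = (\<lambda>x. w (\<pi> x)) ` blks \<nu> i"
        by (rule image_cong[OF refl], rule swp) blast
      moreover have "(\<lambda>x. w (\<pi> x)) ` blks \<nu> i = w ` \<pi> ` blks \<nu> i" by (simp only: image_image)
      ultimately have "(\<lambda>x. \<sigma> (\<rho>' x)) ` W = W" unfolding W_def by (simp only: image_image)
      then have sE: "\<sigma> x \<in> E \<longleftrightarrow> x \<in> E" for x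
        using preserves_class_part[OF fin y[OF a(1)] _ r'M _ kap_def E_def WM, of x] a(1) conj[OF a(2)] ij
        unfolding \<rho>'_def by (auto simp: young_hat_iff)
      have sk: "kap (\<sigma> x) = kap x" if "x \<in> ?M" for x
        using a(1) that sE by (auto simp: kap_def young_hat_iff)
      define \<tau> where "\<tau> = g' \<circ> \<sigma> \<circ> g"
      have tM: "\<tau> permutes ?M" unfolding \<tau>_def using g'M gM y[OF a(1)] by (intro permutes_compose)
      have "bk \<kappa> (\<tau> x) = bk \<kappa> x" if x: "x \<in> ?M" for x
      proof -
        have "\<tau> x \<in> ?M" "g x \<in> ?M" using x permutes_in_image[OF tM] permutes_in_image[OF gM] by auto
        moreover have "kap (g (\<tau> x)) = kap (g x)" using sk[OF \<open>g x \<in> ?M\<close>] by (simp add: \<tau>_def ggx)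
        ultimately show ?thesis using gk x by blast
      qed
      then have "\<tau> \<in> young_subgroup ?h'" using tM sumk by (simp add: young_hat_iff)
      moreover have "\<sigma> \<circ> \<alpha> = \<alpha> \<circ> \<tau>"
      proof -
        have "g \<circ> ?e \<circ> \<tau> = g \<circ> \<tau> \<circ> ?e" using comm[OF tM] by (simp add: comp_assoc)
        also have "\<dots> = (g \<circ> g') \<circ> \<sigma> \<circ> g \<circ> ?e" by (simp add: \<tau>_def comp_assoc)
        finally show ?thesis by (simp add: \<alpha>_def gg' comp_assoc)
      qed
      ultimately show "\<exists>\<rho>'\<in>young_subgroup ?h'. \<sigma> \<circ> \<alpha> = \<alpha> \<circ> \<rho>'" by blast
    next
      fix \<rho> \<pi> assume a: "\<rho> \<in> young_subgroup ?h'" "\<pi> \<in> young_subgroup ?h"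
        and eq: "\<alpha> \<circ> \<rho> \<circ> \<beta> = \<alpha> \<circ> \<beta> \<circ> \<pi>"
      have "g \<circ> (\<rho> \<circ> g' \<circ> w \<circ> ?e) = g \<circ> (g' \<circ> w \<circ> ?e \<circ> \<pi>)"
        using eq arb[OF y'[OF a(1)]] ab gg'(1) by (metis comp_assoc id_comp)
      then have "\<rho> \<circ> g' \<circ> w \<circ> ?e = g' \<circ> w \<circ> ?e \<circ> \<pi>" using gg'(2) by (metis comp_assoc id_comp)
      then have "\<rho> \<circ> \<beta> = \<beta> \<circ> \<pi>" by (simp add: \<beta>_def comp_assoc)
      then show "\<exists>\<pi>'\<in>young_subgroup ?h. \<rho> \<circ> \<beta> = \<beta> \<circ> \<pi>'" using a by blast
    qed
    then have "schur_coeff (?h, double_coset ?h \<alpha> ?h', ?h') (?h', double_coset ?h' \<beta> ?h, ?h) ?cw * (n_R ?h \<alpha> ?h' * n_R ?h' \<beta> ?h)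
        = 1 * (n_R ?h \<alpha> ?h' * n_R ?h' \<beta> ?h)"
      unfolding schur_coeff_mult ab by simp
    then have "schur_coeff (?h, double_coset ?h \<alpha> ?h', ?h') (?h', double_coset ?h' \<beta> ?h, ?h) ?cw = 1"
      using n_R_pos[of ?h \<alpha> ?h'] n_R_pos[of ?h' \<beta> ?h] by (metis mult_cancel2 mult_eq_0_iff less_numeral_extra(3))
    then show ?thesis unfolding prc using Bas_iff[OF hat_L[OF n] hat_L[OF n] weS] by (simp del: schur_coeff.simps)
  qed
  define rest :: "schur_index \<Rightarrow> 'k" where "rest c = pr c - F ?h (w \<circ> ?e) ?h c" for c
  have "rest \<in> modulo_idem \<nu> J"
  proof (rule basis_induct[of rest "\<lambda>x. x \<in> modulo_idem \<nu> J"])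
    show "rest \<in> carrier alg" unfolding alg_carrier rest_def
      using prc Bas_iff[OF hat_L[OF n] hat_L[OF n] weS] by (auto simp: F_def basis_elem_def)
    show "(\<lambda>c. 0) \<in> modulo_idem \<nu> J" using modulo_idem_ideal[OF J ideal_zero[OF J]] .
  next
    fix c assume c: "c \<in> Bas" "rest c \<noteq> 0"
    have cw: "c \<noteq> ?cw" using c(2) prw by (auto simp: rest_def F_def basis_elem_def)
    then have "pr c \<noteq> 0" using c(2) by (auto simp: rest_def F_def basis_elem_def)
    then have nz: "schur_coeff (?h, double_coset ?h \<alpha> ?h', ?h') (?h', double_coset ?h' \<beta> ?h, ?h) c \<noteq> 0"
      unfolding prc by (auto simp del: schur_coeff.simps split: if_splits intro!: Nat.gr0I)
    obtain l \<gamma> m where c': "c = (l, double_coset l \<gamma> m, m)" using c(1) by (rule Bas_cases)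
    have lm: "l = ?h" "m = ?h" using nz schur_coeff_nonzeroD unfolding c' by blast+
    obtain \<rho> where r: "\<rho> \<in> young_subgroup ?h'" "double_coset ?h \<gamma> ?h = double_coset ?h (\<alpha> \<circ> \<rho> \<circ> \<beta>) ?h"
      using schur_coeff_nonzero_rep nz unfolding c' lm by blast
    define \<rho>' where "\<rho>' = g \<circ> \<rho> \<circ> g'"
    have r'M: "\<rho>' permutes ?M" unfolding \<rho>'_def using conj_M[OF r(1)] .
    have r'k: "kap (\<rho>' x) = kap x" if "x \<in> ?M" for x using conj[OF r(1) that] by (simp add: \<rho>'_def)
    define w' where "w' = \<rho>' \<circ> w"
    have w'M: "w' permutes ?M" unfolding w'_def using w r'M by (rule permutes_compose)
    have c'': "c = (?h, double_coset ?h (w' \<circ> ?e) ?h, ?h)"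
      unfolding c' lm r(2) arb[OF y'[OF r(1)]] w'_def \<rho>'_def by (simp add: comp_assoc)
    note cpf = class_part_factor[OF fin r'M r'k kap_def E_def WM _ refl]
    have "w' ` blks \<nu> t = blks \<nu> t" if t: "t < i" for t
    proof -
      have "w' ` blks \<nu> t = \<rho>' ` blks \<nu> t" unfolding w'_def image_comp[symmetric] fixed[OF t] ..
      also have "\<dots> = blks \<nu> t"
      proof (rule endo_inj_surj)
        show "\<rho>' ` blks \<nu> t \<subseteq> blks \<nu> t"
        proof
          fix y assume "y \<in> \<rho>' ` blks \<nu> t"
          then obtain x where x: "x \<in> ?M" "bk \<nu> x = t" "y = \<rho>' x" by blast
          have "kap x = t" using x t ij by (auto simp: kap_def E_def)
          then have "kap y = t" using r'k[OF x(1)] x(3) by simp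
          then have "bk \<nu> y = t" using t by (auto simp: kap_def split: if_splits)
          moreover have "y \<in> ?M" using x permutes_in_image[OF r'M] by simp
          ultimately show "y \<in> blks \<nu> t" by blast
        qed
        show "inj_on \<rho>' (blks \<nu> t)" using permutes_inj_on[OF r'M] .
      qed simp
      finally show ?thesis .
    qed
    moreover have "card (blks \<nu> i \<inter> w ` blks \<nu> i) < card (blks \<nu> i \<inter> w' ` blks \<nu> i)"
    proof (rule ccontr)
      assume "\<not> ?thesis"
      moreover have w'W: "w' ` blks \<nu> i = \<rho>' ` W" unfolding w'_def W_def by (simp add: image_comp)
      moreover have "card (blks \<nu> i \<inter> W) \<le> card (blks \<nu> i \<inter> \<rho>' ` W)" using cpf(1) ij by blast
      ultimately have "card (blks \<nu> i \<inter> \<rho>' ` W) = card (blks \<nu> i \<inter> W)" unfolding W_def[symmetric] w'W by linarith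
      then obtain \<sigma> \<theta> where st: "\<sigma> permutes ?M" "\<theta> permutes W" "\<rho>' = \<sigma> \<circ> \<theta>" "\<And>x. x \<in> ?M \<Longrightarrow> bk \<nu> (\<sigma> x) = bk \<nu> x"
        using cpf(2) ij by blast
      have thM: "\<theta> permutes ?M" using st(2) WM by (rule permutes_subset)
      define \<theta>' where "\<theta>' = pinv w \<circ> \<theta> \<circ> w"
      have th'M: "\<theta>' permutes ?M" unfolding \<theta>'_def using permutes_inv[OF w] w thM by (intro permutes_compose)
      have wth: "w (\<theta>' x) = \<theta> (w x)" for x unfolding \<theta>'_def using permutes_inverses(1)[OF w] by simp
      have "bk \<nu> (\<theta>' x) = bk \<nu> x" if x: "x \<in> ?M" for x
      proof (cases "w x \<in> W")
        case True
        then have "w (\<theta>' x) \<in> W" using permutes_in_image[OF st(2)] wth by simp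
        then have "\<theta>' x \<in> blks \<nu> i" "x \<in> blks \<nu> i"
          using True unfolding W_def inj_image_mem_iff[OF permutes_inj[OF w]] .
        then show ?thesis by simp
      next
        case False
        then have "w (\<theta>' x) = w x" using permutes_not_in[OF st(2)] wth by simp
        then show ?thesis by (simp only: inj_eq[OF permutes_inj[OF w]])
      qed
      moreover have "w' = \<sigma> \<circ> w \<circ> \<theta>'" unfolding w'_def st(3) using wth by (simp add: fun_eq_iff)
      ultimately have "c = ?cw" unfolding c'' using double_coset_eps[OF n w st(1,4) th'M] by simp
      then show False using cw by blast
    qed
    ultimately have "F ?h (w' \<circ> ?e) ?h \<in> modulo_idem \<nu> J" using IH[OF w'M] by blast
    then show "basis_elem c \<in> modulo_idem \<nu> J" unfolding F_def c'' .
  qed (use modulo_idem_add[OF J] modulo_idem_scale[OF J] in blast)+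
  then have "(\<lambda>c. pr c + (-1) * rest c) \<in> modulo_idem \<nu> J"
    using modulo_idem_add[OF J modulo_idem_ideal[OF J prJ] modulo_idem_scale[OF J, of rest \<nu> "-1"]] by blast
  moreover have "(\<lambda>c. pr c + (-1) * rest c) = F ?h (w \<circ> ?e) ?h" by (rule ext) (simp add: rest_def)
  ultimately show ?thesis by simp
qed

lemma straighten:
  fixes J :: "(schur_index \<Rightarrow> 'k::field) set"
  assumes J: "ideal J alg" and n: "\<nu> \<in> Par"
    and gen: "\<And>\<kappa>. \<kappa> \<in> Par \<Longrightarrow> sum_mset \<kappa> = sum_mset \<nu> \<Longrightarrow> \<nu> < \<kappa> \<Longrightarrow> idem \<kappa> \<in> J"
    and w: "w permutes pts \<nu>"
  shows "F (hat \<nu>) (w \<circ> eps (sum_mset \<nu>)) (hat \<nu>) \<in> modulo_idem \<nu> J"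
proof -
  have "F (hat \<nu>) (w \<circ> eps (sum_mset \<nu>)) (hat \<nu>) \<in> modulo_idem \<nu> J"
    if "w permutes pts \<nu>" "\<And>t. t < i \<Longrightarrow> w ` blks \<nu> t = blks \<nu> t" "i + k = length (parts \<nu>)" for i k w
    using that
  proof (induction k arbitrary: i w)
    case 0
    have "bk \<nu> (w x) = bk \<nu> x" if x: "x \<in> pts \<nu>" for x
    proof -
      have "bk \<nu> x < i" using blk_in_block(1)[of x "parts \<nu>"] x 0(3) by (simp add: sum_parts)
      then have "w ` blks \<nu> (bk \<nu> x) = blks \<nu> (bk \<nu> x)" by (rule 0(2))
      then have "w x \<in> blks \<nu> (bk \<nu> x)" using x by blast
      then show ?thesis by simp
    qed
    then have "double_coset (hat \<nu>) (w \<circ> eps (sum_mset \<nu>)) (hat \<nu>) = double_coset (hat \<nu>) (eps (sum_mset \<nu>)) (hat \<nu>)"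
      using double_coset_eps[OF n permutes_id 0(1) _ permutes_id] by simp
    then have "F (hat \<nu>) (w \<circ> eps (sum_mset \<nu>)) (hat \<nu>) = (idem \<nu> :: schur_index \<Rightarrow> 'k)" by (simp add: F_def idem_def)
    then show ?case using modulo_idem_idem[OF J] by (simp only:)
  next
    case (Suc k)
    show ?case
      using Suc.prems
    proof (induction "card (blks \<nu> i) - card (blks \<nu> i \<inter> w ` blks \<nu> i)" arbitrary: w rule: less_induct)
      case less
      show ?case
      proof (cases "w ` blks \<nu> i = blks \<nu> i")
        case True
        have all: "w ` blks \<nu> t = blks \<nu> t" if t: "t < Suc i" for t
        proof (cases "t = i")
          case False
          then have "t < i" using t by simp
          then show ?thesis by (rule less.prems(2))
        qed (simp only: True)
        have "Suc i + k = length (parts \<nu>)" using less.prems(3) unfolding add_Suc_shift .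
        then show ?thesis by (intro Suc.IH[OF less.prems(1), of "Suc i"] all)
      next
        case False
        show ?thesis
        proof (rule straighten_step[OF J n gen less.prems(1,2) False])
          fix w' assume w': "w' permutes pts \<nu>" "\<And>t. t < i \<Longrightarrow> w' ` blks \<nu> t = blks \<nu> t"
            "card (blks \<nu> i \<inter> w ` blks \<nu> i) < card (blks \<nu> i \<inter> w' ` blks \<nu> i)"
          have "card (blks \<nu> i \<inter> w' ` blks \<nu> i) \<le> card (blks \<nu> i)" by (intro card_mono) auto
          then have "card (blks \<nu> i) - card (blks \<nu> i \<inter> w' ` blks \<nu> i) < card (blks \<nu> i) - card (blks \<nu> i \<inter> w ` blks \<nu> i)"
            using w'(3) by linarith
          then show "F (hat \<nu>) (w' \<circ> eps (sum_mset \<nu>)) (hat \<nu>) \<in> modulo_idem \<nu> J"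
            by (rule less.hyps[OF _ w'(1,2) less.prems(3)])
        qed
      qed
    qed
  qed
  from this[of w 0 "length (parts \<nu>)"] w show ?thesis by simp
qed

end

subsection \<open>Dominance\<close>

lemma mset_le_if_dominated:
  assumes "sorted_wrt (\<ge>) P" "0 \<notin> set P" "\<And>k. sum_list (take k P) \<le> sum_list (take k Q)"
  shows "mset P \<le> mset (Q :: nat list)"
  using assms
proof (induction P arbitrary: Q)
  case Nil
  then show ?case by simp
next
  case (Cons p P)
  have p: "p > 0" using Cons.prems(2) by simp
  then obtain q Q' where Q: "Q = q # Q'" using Cons.prems(3)[of 1] by (cases Q) auto
  have "p \<le> q" using Cons.prems(3)[of 1] Q by simp
  show ?case
  proof (cases "p = q")
    case True
    have "sum_list (take k P) \<le> sum_list (take k Q')" for k using Cons.prems(3)[of "Suc k"] Q True by simp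
    then have "mset P \<le> mset Q'" using Cons by auto
    then show ?thesis unfolding Q using True by simp
  next
    case False
    then have "\<forall>x. x \<in># mset (p # P) \<longrightarrow> x < q" using \<open>p \<le> q\<close> Cons.prems(1) by fastforce
    then have "mset (p # P) < mset Q" unfolding Q by (intro ex_gt_imp_less_multiset exI[of _ q]) simp
    then show ?thesis by simp
  qed
qed

definition pos :: "nat multiset \<Rightarrow> nat \<Rightarrow> nat" where
  "pos \<nu> x = x - sum_list (take (blk (parts \<nu>) x) (parts \<nu>))"

lemma pos_props:
  assumes "x \<in> {1..sum_mset \<nu>}"
  shows "blk (parts \<nu>) x < length (parts \<nu>)" "x = sum_list (take (blk (parts \<nu>) x) (parts \<nu>)) + pos \<nu> x"
    "1 \<le> pos \<nu> x" "pos \<nu> x \<le> parts \<nu> ! blk (parts \<nu>) x"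
proof -
  have x: "x \<in> {1..sum_list (parts \<nu>)}" using assms by (simp add: sum_parts)
  show l: "blk (parts \<nu>) x < length (parts \<nu>)" using blk_in_block(1)[OF x] .
  have "x \<in> block (parts \<nu>) (blk (parts \<nu>) x)" using blk_in_block(2)[OF x] .
  then show "x = sum_list (take (blk (parts \<nu>) x) (parts \<nu>)) + pos \<nu> x" "1 \<le> pos \<nu> x" "pos \<nu> x \<le> parts \<nu> ! blk (parts \<nu>) x"
    using l by (auto simp: block_def pos_def take_Suc_conv_app_nth)
qed

lemma pos_inj:
  assumes "x \<in> {1..sum_mset \<nu>}" "y \<in> {1..sum_mset \<nu>}" "blk (parts \<nu>) x = blk (parts \<nu>) y" "pos \<nu> x = pos \<nu> y"
  shows "x = y"
  using pos_props(2)[OF assms(1)] pos_props(2)[OF assms(2)] assms(3,4) by simp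

lemma pos_exists:
  assumes "t < length (parts \<nu>)" "1 \<le> c" "c \<le> parts \<nu> ! t"
  shows "\<exists>x\<in>{1..sum_mset \<nu>}. blk (parts \<nu>) x = t \<and> pos \<nu> x = c"
proof -
  define x where "x = sum_list (take t (parts \<nu>)) + c"
  have b: "x \<in> block (parts \<nu>) t" using assms by (simp add: x_def block_def take_Suc_conv_app_nth)
  then have "blk (parts \<nu>) x = t" by (rule blk_eqI)
  moreover have "x \<in> {1..sum_mset \<nu>}" using b block_subset[of "parts \<nu>" t] unfolding sum_parts by blast
  ultimately show ?thesis by (intro bexI[of _ x]) (auto simp: pos_def x_def)
qed

lemma card_first_blocks: "card {x \<in> {1..sum_mset \<nu>}. blk (parts \<nu>) x < k} = sum_list (take k (parts \<nu>))"
proof -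
  have "{x \<in> {1..sum_mset \<nu>}. blk (parts \<nu>) x < k} = {1..sum_list (take k (parts \<nu>))}"
  proof (intro subset_antisym subsetI)
    fix x assume x: "x \<in> {x \<in> {1..sum_mset \<nu>}. blk (parts \<nu>) x < k}"
    then have "x \<in> block (parts \<nu>) (blk (parts \<nu>) x)" using blk_in_block(2)[of x "parts \<nu>"] by (simp add: sum_parts)
    then show "x \<in> {1..sum_list (take k (parts \<nu>))}"
      using sum_list_take_mono[of "Suc (blk (parts \<nu>) x)" k "parts \<nu>"] x by (auto simp: block_def)
  next
    fix x assume x: "x \<in> {1..sum_list (take k (parts \<nu>))}"
    then have xm: "x \<in> {1..sum_list (parts \<nu>)}" using sum_list_take_mono[of k "length (parts \<nu>)" "parts \<nu>"] sum_list_take_mono[of "length (parts \<nu>)" k "parts \<nu>"]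
      by (cases "k \<le> length (parts \<nu>)") auto
    have "x \<in> block (parts \<nu>) (blk (parts \<nu>) x)" using blk_in_block(2)[OF xm] .
    then have "\<not> k \<le> blk (parts \<nu>) x" using sum_list_take_mono[of k "blk (parts \<nu>) x" "parts \<nu>"] x by (auto simp: block_def)
    then show "x \<in> {x \<in> {1..sum_mset \<nu>}. blk (parts \<nu>) x < k}" using xm by (simp add: sum_parts)
  qed
  then show ?thesis by simp
qed

lemma column_conflict:
  assumes sum: "sum_mset \<kappa> = sum_mset \<nu>" and k0: "0 \<notin># \<kappa>" and less: "\<nu> < \<kappa>"
    and x: "inj_on x {1..sum_mset \<nu>}" "x ` {1..sum_mset \<nu>} \<subseteq> {1..sum_mset \<nu>}"
  shows "\<exists>a\<in>{1..sum_mset \<nu>}. \<exists>b\<in>{1..sum_mset \<nu>}. a \<noteq> b \<and> blk (parts \<kappa>) a = blk (parts \<kappa>) b \<and> pos \<nu> (x a) = pos \<nu> (x b)"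
proof (rule ccontr)
  let ?M = "{1..sum_mset \<nu>}"
  assume neg: "\<not> ?thesis"
  have nc: "a = b" if "a \<in> ?M" "b \<in> ?M" "blk (parts \<kappa>) a = blk (parts \<kappa>) b" "pos \<nu> (x a) = pos \<nu> (x b)" for a b
    using neg that by blast
  have xM: "x a \<in> ?M" if "a \<in> ?M" for a using x(2) that by blast
  have "sum_list (take k (parts \<kappa>)) \<le> sum_list (take k (parts \<nu>))" for k
  proof -
    define A where "A = {a \<in> ?M. blk (parts \<kappa>) a < k}"
    define A' where "A' = {y \<in> ?M. blk (parts \<nu>) y < k}"
    have col: "card {a \<in> A. pos \<nu> (x a) = c} \<le> card {y \<in> A'. pos \<nu> y = c}" for c
    proof (cases "\<exists>y\<in>?M. pos \<nu> y = c \<and> k \<le> blk (parts \<nu>) y")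
      case True
      then obtain y where y: "y \<in> ?M" "pos \<nu> y = c" "k \<le> blk (parts \<nu>) y" by blast
      note yp = pos_props[OF y(1)]
      have "\<exists>z. z \<in> A' \<and> pos \<nu> z = c \<and> blk (parts \<nu>) z = t" if t: "t < k" for t
      proof -
        have "parts \<nu> ! blk (parts \<nu>) y \<le> parts \<nu> ! t" using parts_decreasing t y(3) yp(1) by simp
        then have "c \<le> parts \<nu> ! t" "1 \<le> c" "t < length (parts \<nu>)" using yp y t by auto
        then obtain z where "z \<in> ?M" "blk (parts \<nu>) z = t" "pos \<nu> z = c" using pos_exists by blast
        then show ?thesis using t by (auto simp: A'_def)
      qed
      then have "{..<k} \<subseteq> blk (parts \<nu>) ` {y \<in> A'. pos \<nu> y = c}" by blast
      then have "k \<le> card {y \<in> A'. pos \<nu> y = c}"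
        using surj_card_le[of "{y \<in> A'. pos \<nu> y = c}" "{..<k}" "blk (parts \<nu>)"] by (simp add: A'_def)
      moreover have "card {a \<in> A. pos \<nu> (x a) = c} \<le> card {..<k}"
      proof (rule card_inj_on_le)
        show "inj_on (blk (parts \<kappa>)) {a \<in> A. pos \<nu> (x a) = c}"
          by (rule inj_onI, rule nc) (auto simp: A_def)
      qed (auto simp: A_def)
      ultimately show ?thesis by simp
    next
      case False
      show ?thesis
      proof (rule card_inj_on_le)
        show "inj_on x {a \<in> A. pos \<nu> (x a) = c}" using x(1) by (rule inj_on_subset) (auto simp: A_def)
        show "x ` {a \<in> A. pos \<nu> (x a) = c} \<subseteq> {y \<in> A'. pos \<nu> y = c}"
        proof
          fix y assume "y \<in> x ` {a \<in> A. pos \<nu> (x a) = c}"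
          then obtain a where a: "a \<in> ?M" "pos \<nu> (x a) = c" "y = x a" unfolding A_def by blast
          then have "y \<in> ?M" using xM by blast
          moreover have "\<not> k \<le> blk (parts \<nu>) y" using False calculation a by blast
          ultimately show "y \<in> {y \<in> A'. pos \<nu> y = c}" using a by (simp add: A'_def)
        qed
        show "finite {y \<in> A'. pos \<nu> y = c}" by (simp add: A'_def)
      qed
    qed
    define Cs where "Cs = pos \<nu> ` ?M"
    have "card A = (\<Sum>c\<in>(\<lambda>a. pos \<nu> (x a)) ` A. card {a \<in> A. pos \<nu> (x a) = c})"
      using sum.image_gen[of A "\<lambda>_. 1::nat" "\<lambda>a. pos \<nu> (x a)"] by (simp add: A_def)
    also have "\<dots> \<le> (\<Sum>c\<in>Cs. card {a \<in> A. pos \<nu> (x a) = c})"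
      using xM by (intro sum_mono2) (auto simp: A_def Cs_def)
    also have "\<dots> \<le> (\<Sum>c\<in>Cs. card {y \<in> A'. pos \<nu> y = c})" by (intro sum_mono col)
    also have "\<dots> = (\<Sum>c\<in>pos \<nu> ` A'. card {y \<in> A'. pos \<nu> y = c})"
    proof (rule sum.mono_neutral_right)
      show "\<forall>c\<in>Cs - pos \<nu> ` A'. card {y \<in> A'. pos \<nu> y = c} = 0"
      proof
        fix c assume "c \<in> Cs - pos \<nu> ` A'"
        then have "{y \<in> A'. pos \<nu> y = c} = {}" by blast
        then show "card {y \<in> A'. pos \<nu> y = c} = 0" by (simp only: card.empty)
      qed
    qed (auto simp: Cs_def A'_def)
    also have "\<dots> = card A'" using sum.image_gen[of A' "\<lambda>_. 1::nat" "pos \<nu>"] by (simp add: A'_def)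
    finally show ?thesis using card_first_blocks[of \<kappa> k] card_first_blocks[of \<nu> k] sum unfolding A_def A'_def by simp
  qed
  then have "mset (parts \<kappa>) \<le> mset (parts \<nu>)"
  proof (rule mset_le_if_dominated[rotated 2])
    show "sorted_wrt (\<ge>) (parts \<kappa>)" unfolding parts_def sorted_wrt_rev by simp
    show "0 \<notin> set (parts \<kappa>)" using k0 by (simp add: parts_def)
  qed
  then show False using less by (simp add: mset_parts)
qed

subsection \<open>A functional separating the idempotents\<close>

context schur
begin

definition Col :: "nat multiset \<Rightarrow> (nat \<Rightarrow> nat) set" where
  "Col \<nu> = {\<tau>. \<tau> permutes pts \<nu> \<and> (\<forall>x\<in>pts \<nu>. pos \<nu> (\<tau> x) = pos \<nu> x)}"

lemma finite_Col: "finite (Col \<nu>)"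
  by (rule finite_subset[of _ "{\<tau>. \<tau> permutes pts \<nu>}"]) (auto simp: Col_def finite_permutations)

definition col_index :: "nat multiset \<Rightarrow> (nat \<Rightarrow> nat) \<Rightarrow> schur_index" where
  "col_index \<nu> \<tau> = (hat \<nu>, double_coset (hat \<nu>) (\<tau> \<circ> eps (sum_mset \<nu>)) (hat \<nu>), hat \<nu>)"

definition col_sum :: "nat multiset \<Rightarrow> (schur_index \<Rightarrow> 'k::field) \<Rightarrow> 'k" where
  "col_sum \<nu> x = (\<Sum>\<tau>\<in>Col \<nu>. of_int (sign \<tau>) * x (col_index \<nu> \<tau>))"

lemma col_index_Bas: "\<nu> \<in> Par \<Longrightarrow> \<tau> \<in> Col \<nu> \<Longrightarrow> col_index \<nu> \<tau> \<in> Bas"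
proof -
  assume n: "\<nu> \<in> Par" and "\<tau> \<in> Col \<nu>"
  then have "\<tau> \<in> S" using permutes_S permutes_image_mono[of \<tau> "sum_mset \<nu>"] Par_sum by (auto simp: Col_def)
  then show ?thesis unfolding col_index_def using n hat_L eps_S Par_sum S_comp by (intro Bas_iff) auto
qed

lemma col_sum_idem:
  assumes n: "\<nu> \<in> Par" shows "col_sum \<nu> (idem \<nu>) = (1 :: 'k::field)"
proof -
  let ?e = "eps (sum_mset \<nu>)"
  have "(idem \<nu> :: schur_index \<Rightarrow> 'k) (col_index \<nu> \<tau>) = (if \<tau> = id then 1 else 0)" if t: "\<tau> \<in> Col \<nu>" for \<tau>
  proof (cases "\<tau> = id")
    case True
    then show ?thesis by (simp add: idem_def F_def basis_elem_def col_index_def)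
  next
    case False
    have tp: "\<tau> permutes pts \<nu>" "\<And>x. x \<in> pts \<nu> \<Longrightarrow> pos \<nu> (\<tau> x) = pos \<nu> x" using t by (auto simp: Col_def)
    have "double_coset (hat \<nu>) (\<tau> \<circ> ?e) (hat \<nu>) \<noteq> double_coset (hat \<nu>) ?e (hat \<nu>)"
    proof
      assume "double_coset (hat \<nu>) (\<tau> \<circ> ?e) (hat \<nu>) = double_coset (hat \<nu>) ?e (hat \<nu>)"
      then obtain \<sigma> \<pi> where s: "\<sigma> \<in> young_subgroup (hat \<nu>)" "\<pi> \<in> young_subgroup (hat \<nu>)" "\<tau> \<circ> ?e = \<sigma> \<circ> ?e \<circ> \<pi>"
        unfolding double_coset_eq_iff in_double_coset by blast
      have "\<tau> x = x" if x: "x \<in> pts \<nu>" for x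
      proof -
        have px: "\<pi> x \<in> pts \<nu>" "bk \<nu> (\<pi> x) = bk \<nu> x" using s(2) x permutes_in_image unfolding young_hat_iff by metis+
        have "(\<tau> \<circ> ?e) x = (\<sigma> \<circ> ?e \<circ> \<pi>) x" using s(3) by simp
        then have "\<tau> x = \<sigma> (\<pi> x)" using x px(1) by (simp add: eps_def)
        then have "bk \<nu> (\<tau> x) = bk \<nu> x" using s(1) px unfolding young_hat_iff by metis
        moreover have "\<tau> x \<in> pts \<nu>" using x permutes_in_image[OF tp(1)] by blast
        ultimately show ?thesis using pos_inj[of "\<tau> x" \<nu> x] x tp(2)[OF x] by blast
      qed
      then have "\<tau> = id" using permutes_not_in[OF tp(1)] by (metis eq_id_iff)
      then show False using False by blast
    qed
    then show ?thesis using False by (simp add: idem_def F_def basis_elem_def col_index_def)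
  qed
  then have "col_sum \<nu> (idem \<nu>) = (\<Sum>\<tau>\<in>Col \<nu>. if \<tau> = id then (1::'k) else 0)"
    unfolding col_sum_def by (intro sum.cong refl) (simp add: sign_id)
  moreover have "id \<in> Col \<nu>" by (simp add: Col_def permutes_id)
  ultimately show ?thesis using finite_Col by simp
qed

text \<open>
  If \<open>x\<close> has a conflict between columns of \<open>\<nu>\<close> and blocks of \<open>\<kappa>\<close>, a transposition \<open>t\<close> of the
  column group satisfies \<open>t x = x s\<close> with \<open>s\<close> in the Young subgroup of \<open>\<kappa>\<close>, and
  \<open>(\<tau>, \<rho>) \<mapsto> (t \<tau>, s \<rho>)\<close> is a sign reversing involution.  Without a conflict the rank is too small.
\<close>

lemma signed_pair_sum_zero:
  assumes n: "\<nu> \<in> Par" and k: "\<kappa> \<in> Par"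
    and less: "sum_mset \<kappa> < sum_mset \<nu> \<or> sum_mset \<kappa> = sum_mset \<nu> \<and> \<nu> < \<kappa>"
    and xS: "x \<in> S" and kill: "\<And>y. sum_mset \<kappa> < y \<Longrightarrow> y \<le> r \<Longrightarrow> x y = 0" and bS: "\<beta> \<in> S"
  shows "(\<Sum>\<tau>\<in>Col \<nu>. \<Sum>\<rho>\<in>young_subgroup (hat \<kappa>). sign \<tau> *
     (if \<exists>\<pi>\<in>young_subgroup (hat \<nu>). x \<circ> \<rho> \<circ> \<beta> = \<tau> \<circ> eps (sum_mset \<nu>) \<circ> \<pi> then 1 else 0)) = 0"
proof -
  let ?e = "eps (sum_mset \<nu>)"
  define P where "P \<tau> \<rho> \<longleftrightarrow> (\<exists>\<pi>\<in>young_subgroup (hat \<nu>). x \<circ> \<rho> \<circ> \<beta> = \<tau> \<circ> ?e \<circ> \<pi>)" for \<tau> \<rho>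
  show ?thesis unfolding P_def[symmetric]
  proof (cases "\<exists>\<tau>\<in>Col \<nu>. \<exists>\<rho>\<in>young_subgroup (hat \<kappa>). P \<tau> \<rho>")
    case False
    then show "(\<Sum>\<tau>\<in>Col \<nu>. \<Sum>\<rho>\<in>young_subgroup (hat \<kappa>). sign \<tau> * (if P \<tau> \<rho> then 1 else 0)) = 0" by simp
  next
    case True
    then obtain \<tau>0 \<rho>0 \<pi>0 where t0: "\<tau>0 \<in> Col \<nu>" "\<rho>0 \<in> young_subgroup (hat \<kappa>)" "\<pi>0 \<in> young_subgroup (hat \<nu>)"
      "x \<circ> \<rho>0 \<circ> \<beta> = \<tau>0 \<circ> ?e \<circ> \<pi>0" unfolding P_def by blast
    have t0p: "\<tau>0 permutes pts \<nu>" "\<pi>0 permutes pts \<nu>" using t0 young_hat_permutes by (auto simp: Col_def)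
    have "pts \<nu> \<subseteq> x ` pts \<kappa>"
    proof
      fix y assume y: "y \<in> pts \<nu>"
      define z where "z = pinv \<pi>0 (pinv \<tau>0 y)"
      have t: "pinv \<tau>0 y \<in> pts \<nu>" using y permutes_in_image[OF permutes_inv[OF t0p(1)]] by blast
      have "(\<tau>0 \<circ> ?e \<circ> \<pi>0) z = \<tau>0 (?e (pinv \<tau>0 y))" by (simp add: z_def permutes_inverses(1)[OF t0p(2)])
      also have "\<dots> = y" using t by (simp add: eps_def permutes_inverses(1)[OF t0p(1)])
      finally have "x (\<rho>0 (\<beta> z)) = y" using fun_cong[OF t0(4), of z] by simp
      moreover define u where "u = \<rho>0 (\<beta> z)"
      ultimately have u: "x u = y" by simp
      have "u \<le> r" using u y S_tau(3)[OF xS, of u] Par_sum[OF n] by (cases "u \<le> r") auto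
      moreover have "u \<noteq> 0" using u y S_tau(1)[OF xS] by (cases "u = 0") auto
      moreover have "\<not> sum_mset \<kappa> < u" using kill[of u] u y \<open>u \<le> r\<close> by auto
      ultimately have "u \<in> pts \<kappa>" by simp
      then show "y \<in> x ` pts \<kappa>" using u by blast
    qed
    then have "card (pts \<nu>) \<le> card (x ` pts \<kappa>)" by (intro card_mono) auto
    also have cle: "\<dots> \<le> card (pts \<kappa>)" by (rule card_image_le) simp
    finally have "sum_mset \<nu> \<le> sum_mset \<kappa>" by simp
    then have sum: "sum_mset \<kappa> = sum_mset \<nu>" and lt: "\<nu> < \<kappa>" using less by auto
    have xsub: "pts \<nu> \<subseteq> x ` pts \<nu>" using \<open>pts \<nu> \<subseteq> x ` pts \<kappa>\<close> sum by simp
    have "card (x ` pts \<nu>) = card (pts \<nu>)"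
      using card_mono[OF _ xsub] card_image_le[of "pts \<nu>" x] by simp
    then have inj: "inj_on x (pts \<nu>)" by (intro eq_card_imp_inj_on) simp
    have xeq: "x ` pts \<nu> = pts \<nu>"
      using card_subset_eq[OF _ xsub] \<open>card (x ` pts \<nu>) = card (pts \<nu>)\<close> by simp
    obtain a b where ab: "a \<in> pts \<nu>" "b \<in> pts \<nu>" "a \<noteq> b" "bk \<kappa> a = bk \<kappa> b" "pos \<nu> (x a) = pos \<nu> (x b)"
      using column_conflict[OF sum _ lt inj] xeq k by (auto simp: Par_def)
    define t where "t = transpose (x a) (x b)"
    define s where "s = transpose a b"
    have xab: "x a \<in> pts \<nu>" "x b \<in> pts \<nu>" "x a \<noteq> x b" using ab xeq inj by (blast, blast, metis inj_onD)
    have tP: "t permutes pts \<nu>" unfolding t_def using xab by (intro permutes_swap_id) auto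
    have sP: "s permutes pts \<nu>" unfolding s_def using ab by (intro permutes_swap_id) auto
    have tpos: "pos \<nu> (t y) = pos \<nu> y" for y unfolding t_def using ab(5) by (auto simp: transpose_def)
    have sG: "s \<in> young_subgroup (hat \<kappa>)" unfolding young_hat_iff sum using sP ab(4) by (auto simp: s_def transpose_def)
    have tx: "t \<circ> x = x \<circ> s"
    proof
      fix y
      show "(t \<circ> x) y = (x \<circ> s) y"
      proof (cases "y = a \<or> y = b")
        case True then show ?thesis by (auto simp: t_def s_def)
      next
        case False
        have "x y \<noteq> x a \<and> x y \<noteq> x b"
        proof (cases "y \<in> pts \<nu>")
          case True then show ?thesis using False inj ab by (metis inj_onD)
        next
          case y: False
          then have "x y \<notin> pts \<nu>" using kill[of y] S_tau(1)[OF xS] S_tau(3)[OF xS, of y] sum Par_sum[OF n] by (cases "y = 0"; cases "y \<le> r") auto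
          then show ?thesis using xab by metis
        qed
        then show ?thesis using False by (simp add: t_def s_def transpose_def)
      qed
    qed
    have ss: "s \<circ> s = id" "t \<circ> t = id" by (simp_all add: s_def t_def)
    have tCol: "t \<circ> \<tau> \<in> Col \<nu>" if "\<tau> \<in> Col \<nu>" for \<tau> using that tP tpos by (auto simp: Col_def intro: permutes_compose)
    have P_iff: "P (t \<circ> \<tau>) (s \<circ> \<rho>) \<longleftrightarrow> P \<tau> \<rho>" for \<tau> \<rho>
    proof -
      have e1: "x \<circ> (s \<circ> \<rho>) \<circ> \<beta> = t \<circ> (x \<circ> \<rho> \<circ> \<beta>)" using tx by (metis comp_assoc)
      have e2: "(t \<circ> \<tau>) \<circ> ?e \<circ> \<pi> = t \<circ> (\<tau> \<circ> ?e \<circ> \<pi>)" for \<pi> by (simp add: comp_assoc)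
      have e3: "t \<circ> f = t \<circ> g \<longleftrightarrow> f = g" for f g :: "nat \<Rightarrow> nat" using ss(2) by (metis comp_assoc id_comp)
      show ?thesis unfolding P_def e1 e2 e3 ..
    qed
    have sgn: "sign (t \<circ> \<tau>) = - sign \<tau>" if "\<tau> \<in> Col \<nu>" for \<tau>
    proof -
      have "\<tau> permutes pts \<nu>" using that by (simp add: Col_def)
      then have "permutation \<tau>" "permutation t" using tP permutation_permutes by blast+
      then have "sign (t \<circ> \<tau>) = sign t * sign \<tau>" by (intro sign_compose)
      moreover have "sign t = -1" unfolding t_def using xab(3) by (simp add: sign_swap_id)
      ultimately show ?thesis by simp
    qed
    let ?A = "Col \<nu> \<times> young_subgroup (hat \<kappa>)"
    let ?f = "\<lambda>(\<tau>, \<rho>). sign \<tau> * (if P \<tau> \<rho> then 1 else 0)"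
    have "(\<Sum>p\<in>?A. ?f p) = (\<Sum>p\<in>?A. - ?f p)"
    proof (rule sum.reindex_bij_witness[where i = "\<lambda>(\<tau>, \<rho>). (t \<circ> \<tau>, s \<circ> \<rho>)" and j = "\<lambda>(\<tau>, \<rho>). (t \<circ> \<tau>, s \<circ> \<rho>)"])
      fix p assume "p \<in> ?A"
      then show "- ?f (case p of (\<tau>, \<rho>) \<Rightarrow> (t \<circ> \<tau>, s \<circ> \<rho>)) = ?f p"
        using P_iff sgn by (auto split: prod.splits)
    qed (use tCol sG young_comp ss in \<open>auto simp: comp_assoc[symmetric]\<close>)
    then have "(\<Sum>p\<in>?A. ?f p) = 0" by (simp add: sum_negf)
    then show "(\<Sum>\<tau>\<in>Col \<nu>. \<Sum>\<rho>\<in>young_subgroup (hat \<kappa>). sign \<tau> * (if P \<tau> \<rho> then 1 else 0)) = 0"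
      by (simp add: sum.cartesian_product)
  qed
qed

lemma signed_schur_coeff_sum_zero:
  assumes n: "\<nu> \<in> Par" and k: "\<kappa> \<in> Par"
    and less: "sum_mset \<kappa> < sum_mset \<nu> \<or> sum_mset \<kappa> = sum_mset \<nu> \<and> \<nu> < \<kappa>"
    and aS: "\<alpha> \<in> S" and kill: "\<And>y. sum_mset \<kappa> < y \<Longrightarrow> y \<le> r \<Longrightarrow> \<alpha> y = 0" and bS: "\<beta> \<in> S"
  shows "(\<Sum>\<tau>\<in>Col \<nu>. sign \<tau> * int (schur_coeff (l, double_coset l \<alpha> (hat \<kappa>), hat \<kappa>) (v, double_coset v \<beta> m, m) (col_index \<nu> \<tau>))) = 0"
proof (cases "l = hat \<nu> \<and> v = hat \<kappa> \<and> m = hat \<nu>")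
  case False
  then have "schur_coeff (l, double_coset l \<alpha> (hat \<kappa>), hat \<kappa>) (v, double_coset v \<beta> m, m) (col_index \<nu> \<tau>) = 0" for \<tau>
    using schur_coeff_nonzeroD unfolding col_index_def by metis
  then show ?thesis by (simp only: of_nat_0 mult_zero_right sum.neutral_const)
next
  case True
  let ?h = "hat \<nu>" and ?h' = "hat \<kappa>" and ?e = "eps (sum_mset \<nu>)"
  let ?N = "n_R ?h \<alpha> ?h' * n_R ?h' \<beta> ?h"
  let ?C = "\<lambda>\<tau>. schur_coeff (?h, double_coset ?h \<alpha> ?h', ?h') (?h', double_coset ?h' \<beta> ?h, ?h) (col_index \<nu> \<tau>)"
  have "(\<Sum>\<tau>\<in>Col \<nu>. sign \<tau> * int (?C \<tau>)) * int ?N = (\<Sum>\<tau>\<in>Col \<nu>. sign \<tau> * int (?C \<tau> * ?N))"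
    by (simp only: sum_distrib_right of_nat_mult mult.assoc)
  also have "\<dots> = (\<Sum>\<tau>\<in>Col \<nu>. sign \<tau> * int (pair_count ?h \<alpha> ?h' \<beta> ?h (\<tau> \<circ> ?e)))"
    unfolding col_index_def schur_coeff_mult ..
  also have "\<dots> = (\<Sum>\<tau>\<in>Col \<nu>. \<Sum>\<sigma>\<in>young_subgroup ?h. \<Sum>\<rho>\<in>young_subgroup ?h'. sign \<tau> *
     (if \<exists>\<pi>\<in>young_subgroup ?h. \<sigma> \<circ> \<alpha> \<circ> \<rho> \<circ> \<beta> = \<tau> \<circ> ?e \<circ> \<pi> then 1 else 0))"
    unfolding pair_count_sum_left card_filter_sum[OF finite_young]
    by (simp only: of_nat_sum sum_distrib_left of_nat_1 of_nat_0 if_distrib[of int])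
  also have "\<dots> = (\<Sum>\<sigma>\<in>young_subgroup ?h. \<Sum>\<tau>\<in>Col \<nu>. \<Sum>\<rho>\<in>young_subgroup ?h'. sign \<tau> *
     (if \<exists>\<pi>\<in>young_subgroup ?h. \<sigma> \<circ> \<alpha> \<circ> \<rho> \<circ> \<beta> = \<tau> \<circ> ?e \<circ> \<pi> then 1 else 0))"
    by (rule sum.swap)
  also have "\<dots> = (\<Sum>\<sigma>\<in>young_subgroup ?h. 0)"
  proof (rule sum.cong[OF refl], rule signed_pair_sum_zero[OF n k less])
    fix \<sigma> assume s: "\<sigma> \<in> young_subgroup ?h"
    then have sS: "\<sigma> \<in> S" using young_S hat_L n by blast
    then show "\<sigma> \<circ> \<alpha> \<in> S" using aS by (rule S_comp)
    show "(\<sigma> \<circ> \<alpha>) y = 0" if "sum_mset \<kappa> < y" "y \<le> r" for y using kill[OF that] S_tau(1)[OF sS] by simp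
  qed (rule bS)
  finally have "(\<Sum>\<tau>\<in>Col \<nu>. sign \<tau> * int (?C \<tau>)) * int ?N = 0" by simp
  moreover have "int ?N \<noteq> 0" using n_R_pos[of ?h \<alpha> ?h'] n_R_pos[of ?h' \<beta> ?h] by simp
  ultimately have "(\<Sum>\<tau>\<in>Col \<nu>. sign \<tau> * int (?C \<tau>)) = 0" by (simp only: mult_eq_0_iff simp_thms)
  then show ?thesis using True by (simp only:)
qed

lemma col_sum_mult_idem_zero:
  fixes a b :: "schur_index \<Rightarrow> 'k::field"
  assumes n: "\<nu> \<in> Par" and k: "\<kappa> \<in> Par"
    and less: "sum_mset \<kappa> < sum_mset \<nu> \<or> sum_mset \<kappa> = sum_mset \<nu> \<and> \<nu> < \<kappa>"
  shows "col_sum \<nu> ((a \<otimes>\<^bsub>alg\<^esub> idem \<kappa>) \<otimes>\<^bsub>alg\<^esub> b) = 0"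
proof -
  define y where "y = a \<otimes>\<^bsub>alg\<^esub> idem \<kappa>"
  let ?f = "\<lambda>\<tau> p q. of_int (sign \<tau>) * (y p * b q * of_nat (schur_coeff p q (col_index \<nu> \<tau>)))"
  have "col_sum \<nu> (y \<otimes>\<^bsub>alg\<^esub> b) = (\<Sum>\<tau>\<in>Col \<nu>. \<Sum>p\<in>Bas. \<Sum>q\<in>Bas. ?f \<tau> p q)"
    unfolding col_sum_def alg_mult using col_index_Bas[OF n]
    by (intro sum.cong refl) (simp del: schur_coeff.simps add: sum_distrib_left)
  also have "\<dots> = (\<Sum>p\<in>Bas. \<Sum>\<tau>\<in>Col \<nu>. \<Sum>q\<in>Bas. ?f \<tau> p q)" by (rule sum.swap)
  also have "\<dots> = (\<Sum>p\<in>Bas. \<Sum>q\<in>Bas. \<Sum>\<tau>\<in>Col \<nu>. ?f \<tau> p q)"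
    by (rule sum.cong[OF refl], rule sum.swap)
  also have "\<dots> = (\<Sum>p\<in>Bas. \<Sum>q\<in>Bas. y p * b q * of_int (\<Sum>\<tau>\<in>Col \<nu>. sign \<tau> * int (schur_coeff p q (col_index \<nu> \<tau>))))"
    by (simp del: schur_coeff.simps add: sum_distrib_left mult_ac)
  also have "\<dots> = (\<Sum>p\<in>Bas. \<Sum>q\<in>Bas. 0)"
  proof (intro sum.cong refl)
    fix p q assume "p \<in> Bas" "q \<in> Bas"
    show "y p * b q * of_int (\<Sum>\<tau>\<in>Col \<nu>. sign \<tau> * int (schur_coeff p q (col_index \<nu> \<tau>))) = 0"
    proof (cases "y p = 0")
      case False
      obtain l \<alpha> where p: "\<alpha> \<in> S" "p = (l, double_coset l \<alpha> (hat \<kappa>), hat \<kappa>)"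
        "\<And>x. sum_mset \<kappa> < x \<Longrightarrow> x \<le> r \<Longrightarrow> \<alpha> x = 0"
        using mult_idem_support[OF k False[unfolded y_def]] by blast
      obtain v \<beta> m where q: "\<beta> \<in> S" "q = (v, double_coset v \<beta> m, m)" using \<open>q \<in> Bas\<close> by (rule Bas_cases)
      have "(\<Sum>\<tau>\<in>Col \<nu>. sign \<tau> * int (schur_coeff p q (col_index \<nu> \<tau>))) = 0"
        unfolding p(2) q(2) using signed_schur_coeff_sum_zero[OF n k less p(1) p(3) q(1)] by blast
      then show ?thesis by (simp only: of_int_0 mult_zero_right)
    qed simp
  qed
  finally show ?thesis by (simp add: y_def)
qed

lemma col_sum_add: "col_sum \<nu> (x \<oplus>\<^bsub>alg\<^esub> y) = col_sum \<nu> x + col_sum \<nu> (y :: schur_index \<Rightarrow> 'k::field)"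
  unfolding col_sum_def alg_add by (simp add: distrib_left sum.distrib)

lemma idem_notin_ideal:
  fixes T :: "nat multiset set"
  assumes n: "\<nu> \<in> Par" and T: "T \<subseteq> Par"
    and less: "\<And>\<kappa>. \<kappa> \<in> T \<Longrightarrow> sum_mset \<kappa> < sum_mset \<nu> \<or> sum_mset \<kappa> = sum_mset \<nu> \<and> \<nu> < \<kappa>"
  shows "(idem \<nu> :: schur_index \<Rightarrow> 'k::field) \<notin> genideal alg (idem ` T)"
proof
  interpret R: ring "alg :: (schur_index \<Rightarrow> 'k) ring" by (rule alg_ring)
  define N where "N = {x \<in> carrier alg. \<forall>a\<in>carrier alg. \<forall>b\<in>carrier alg. col_sum \<nu> (a \<otimes>\<^bsub>alg\<^esub> x \<otimes>\<^bsub>alg\<^esub> b) = (0::'k)}"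
  have cz: "col_sum \<nu> \<zero>\<^bsub>alg\<^esub> = (0::'k)" unfolding col_sum_def alg_zero by simp
  have "ideal N alg"
  proof (rule idealI[OF R.ring_axioms])
    show "subgroup N (add_monoid alg)"
    proof (rule group.subgroupI[OF R.a_group])
      show "N \<noteq> {}" unfolding N_def using cz by (auto intro!: exI[of _ "\<zero>\<^bsub>alg\<^esub>"])
      fix x assume x: "x \<in> N"
      then have xc: "x \<in> carrier alg" by (simp add: N_def)
      have "col_sum \<nu> (a \<otimes>\<^bsub>alg\<^esub> (\<ominus>\<^bsub>alg\<^esub> x) \<otimes>\<^bsub>alg\<^esub> b) = (0::'k)" if "a \<in> carrier alg" "b \<in> carrier alg" for a b
      proof -
        have "a \<otimes>\<^bsub>alg\<^esub> (\<ominus>\<^bsub>alg\<^esub> x) \<otimes>\<^bsub>alg\<^esub> b \<oplus>\<^bsub>alg\<^esub> a \<otimes>\<^bsub>alg\<^esub> x \<otimes>\<^bsub>alg\<^esub> b = \<zero>\<^bsub>alg\<^esub>"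
          using that xc by (simp add: R.r_minus R.l_minus R.l_neg)
        then have "col_sum \<nu> (a \<otimes>\<^bsub>alg\<^esub> (\<ominus>\<^bsub>alg\<^esub> x) \<otimes>\<^bsub>alg\<^esub> b) + col_sum \<nu> (a \<otimes>\<^bsub>alg\<^esub> x \<otimes>\<^bsub>alg\<^esub> b) = (0::'k)"
          using col_sum_add[of \<nu> "a \<otimes>\<^bsub>alg\<^esub> (\<ominus>\<^bsub>alg\<^esub> x) \<otimes>\<^bsub>alg\<^esub> b" "a \<otimes>\<^bsub>alg\<^esub> x \<otimes>\<^bsub>alg\<^esub> b"] cz
          by (simp only:)
        then show ?thesis using x that by (simp add: N_def)
      qed
      then have "\<ominus>\<^bsub>alg\<^esub> x \<in> N" using xc by (simp add: N_def)
      then show "inv\<^bsub>add_monoid alg\<^esub> x \<in> N" unfolding a_inv_def .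
      fix y assume y: "y \<in> N"
      show "x \<otimes>\<^bsub>add_monoid alg\<^esub> y \<in> N" using x y
        by (auto simp: N_def R.r_distr R.l_distr col_sum_add)
    qed (auto simp: N_def)
    fix x c :: "schur_index \<Rightarrow> 'k" assume x: "x \<in> N" "c \<in> carrier alg"
    then have xc: "x \<in> carrier alg" by (simp add: N_def)
    have "col_sum \<nu> (a \<otimes>\<^bsub>alg\<^esub> (c \<otimes>\<^bsub>alg\<^esub> x) \<otimes>\<^bsub>alg\<^esub> b) = 0" if "a \<in> carrier alg" "b \<in> carrier alg" for a b
    proof -
      have "col_sum \<nu> ((a \<otimes>\<^bsub>alg\<^esub> c) \<otimes>\<^bsub>alg\<^esub> x \<otimes>\<^bsub>alg\<^esub> b) = 0" using x that unfolding N_def by blast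
      then show ?thesis using that x xc by (simp add: R.m_assoc)
    qed
    then show "c \<otimes>\<^bsub>alg\<^esub> x \<in> N" using xc x by (simp add: N_def)
    have "col_sum \<nu> (a \<otimes>\<^bsub>alg\<^esub> (x \<otimes>\<^bsub>alg\<^esub> c) \<otimes>\<^bsub>alg\<^esub> b) = 0" if "a \<in> carrier alg" "b \<in> carrier alg" for a b
    proof -
      have "col_sum \<nu> (a \<otimes>\<^bsub>alg\<^esub> x \<otimes>\<^bsub>alg\<^esub> (c \<otimes>\<^bsub>alg\<^esub> b)) = 0" using x that unfolding N_def by blast
      then show ?thesis using that x xc by (simp add: R.m_assoc)
    qed
    then show "x \<otimes>\<^bsub>alg\<^esub> c \<in> N" using xc x by (simp add: N_def)
  qed
  moreover have "idem ` T \<subseteq> N"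
    using col_sum_mult_idem_zero[OF n] less T idem_carrier unfolding N_def by blast
  ultimately have "genideal alg (idem ` T) \<subseteq> N" by (rule R.genideal_minimal)
  moreover assume "(idem \<nu> :: schur_index \<Rightarrow> 'k) \<in> genideal alg (idem ` T)"
  ultimately have "(idem \<nu> :: schur_index \<Rightarrow> 'k) \<in> N" by blast
  then have "col_sum \<nu> (idem \<nu> \<otimes>\<^bsub>alg\<^esub> idem \<nu> \<otimes>\<^bsub>alg\<^esub> idem \<nu>) = (0::'k)"
    unfolding N_def using idem_carrier[OF n] by blast
  then have "col_sum \<nu> (idem \<nu>) = (0::'k)" by (simp only: idem_idem[OF n])
  moreover have "col_sum \<nu> (idem \<nu>) = (1::'k)" by (rule col_sum_idem[OF n])
  ultimately show False by simp
qed

end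

subsection \<open>The chain of idempotents\<close>

context schur
begin

definition before :: "nat multiset \<Rightarrow> nat multiset \<Rightarrow> bool" where
  "before \<kappa> \<nu> \<longleftrightarrow> sum_mset \<kappa> < sum_mset \<nu> \<or> sum_mset \<kappa> = sum_mset \<nu> \<and> \<nu> < \<kappa>"

lemma finite_Par: "finite Par"
proof (rule finite_subset)
  show "Par \<subseteq> mset ` {xs. set xs \<subseteq> {0..r} \<and> length xs \<le> r}"
  proof
    fix \<nu> assume n: "\<nu> \<in> Par"
    have "set (parts \<nu>) \<subseteq> {0..r}"
      using member_le_sum_list[of _ "parts \<nu>"] n by (fastforce simp: sum_parts Par_def)
    moreover have "length (parts \<nu>) \<le> r"
      using size_le_sum[of \<nu>] n by (simp add: Par_def length_parts)
    ultimately show "\<nu> \<in> mset ` {xs. set xs \<subseteq> {0..r} \<and> length xs \<le> r}"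
      using mset_parts[of \<nu>] by (intro image_eqI[of _ _ "parts \<nu>"]) auto
  qed
qed (simp add: finite_lists_length_le)

lemma alg_minus:
  fixes x y :: "schur_index \<Rightarrow> 'k::field"
  assumes "x \<in> carrier alg" "y \<in> carrier alg" shows "x \<ominus>\<^bsub>alg\<^esub> y = (\<lambda>c. x c - y c)"
proof -
  interpret R: ring "alg :: (schur_index \<Rightarrow> 'k) ring" by (rule alg_ring)
  have c: "(\<lambda>c. - y c) \<in> carrier alg" using assms(2) by (simp add: alg_carrier)
  have "(\<lambda>c. - y c) \<oplus>\<^bsub>alg\<^esub> y = \<zero>\<^bsub>alg\<^esub>" by (rule ext) (simp add: alg_add alg_zero)
  then have "\<ominus>\<^bsub>alg\<^esub> y = (\<lambda>c. - y c)" using R.minus_equality[OF _ assms(2) c] by blast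
  then show ?thesis by (intro ext) (simp add: R.minus_eq alg_add)
qed

lemma rank_cases:
  assumes a: "\<alpha> \<in> S" and kill: "\<And>x. m < x \<Longrightarrow> x \<le> r \<Longrightarrow> \<alpha> x = 0" and im: "\<And>x. x \<le> r \<Longrightarrow> \<alpha> x \<le> m" and m: "m \<le> r"
  shows "rank \<alpha> < m \<or> (\<exists>w. w permutes {1..m} \<and> \<alpha> = w \<circ> eps m)"
proof -
  define I where "I = {i \<in> {1..r}. \<exists>x\<in>{1..r}. \<alpha> x = i}"
  have I: "I \<subseteq> {1..m}" using im by (fastforce simp: I_def)
  then have "card I \<le> m" using card_mono[OF _ I] by simp
  moreover have "\<exists>w. w permutes {1..m} \<and> \<alpha> = w \<circ> eps m" if "card I = m"
  proof -
    have Im: "I = {1..m}" using card_subset_eq[OF _ I] that by simp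
    have sub: "{1..m} \<subseteq> \<alpha> ` {1..m}"
    proof
      fix i assume i: "i \<in> {1..m}"
      then obtain x where x: "x \<in> {1..r}" "\<alpha> x = i" using Im unfolding I_def by blast
      then have "\<not> m < x" using kill[of x] i by auto
      then show "i \<in> \<alpha> ` {1..m}" using x by (intro image_eqI[of _ _ x]) auto
    qed
    have "card (\<alpha> ` {1..m}) = m" using card_mono[OF _ sub] card_image_le[of "{1..m}" \<alpha>] by simp
    then have inj: "inj_on \<alpha> {1..m}" and eq: "\<alpha> ` {1..m} = {1..m}"
      using card_subset_eq[OF _ sub] by (auto intro!: eq_card_imp_inj_on)
    define w where "w x = (if x \<in> {1..m} then \<alpha> x else x)" for x
    have "bij_betw \<alpha> {1..m} {1..m}" using inj eq by (simp add: bij_betw_def)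
    then have "bij_betw w {1..m} {1..m}" by (rule bij_betw_cong[THEN iffD1, rotated]) (simp add: w_def)
    then have "w permutes {1..m}" by (rule bij_imp_permutes) (simp only: w_def if_False)
    moreover have "\<alpha> x = (w \<circ> eps m) x" for x
    proof -
      consider "x = 0" | "x \<in> {1..m}" | "m < x" "x \<le> r" | "r < x" by fastforce
      then show ?thesis
        using S_tau(1)[OF a] S_tau(3)[OF a, of x] kill[of x] m by cases (auto simp: w_def eps_def)
    qed
    ultimately show ?thesis by blast
  qed
  ultimately show ?thesis unfolding rank_def I_def[symmetric] by (metis le_neq_implies_less)
qed

lemma idem_local:
  fixes x :: "schur_index \<Rightarrow> 'k::field"
  assumes n: "\<nu> \<in> Par" and x: "x \<in> carrier alg" and J: "ideal J alg"
    and gen: "\<And>\<kappa>. \<kappa> \<in> Par \<Longrightarrow> before \<kappa> \<nu> \<Longrightarrow> idem \<kappa> \<in> J"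
  shows "idem \<nu> \<otimes>\<^bsub>alg\<^esub> (x \<otimes>\<^bsub>alg\<^esub> idem \<nu>) \<in> modulo_idem \<nu> J"
proof -
  interpret R: ring "alg :: (schur_index \<Rightarrow> 'k) ring" by (rule alg_ring)
  let ?y = "idem \<nu> \<otimes>\<^bsub>alg\<^esub> (x \<otimes>\<^bsub>alg\<^esub> idem \<nu>)"
  have "?y \<in> carrier alg" by (intro R.m_closed idem_carrier n x)
  then show ?thesis
  proof (induction rule: basis_induct)
    case zero
    show ?case using modulo_idem_ideal[OF J ideal_zero[OF J]] .
  next
    case (basis c)
    obtain \<alpha> where a: "\<alpha> \<in> S" "c = (hat \<nu>, double_coset (hat \<nu>) \<alpha> (hat \<nu>), hat \<nu>)"
      "\<And>x. sum_mset \<nu> < x \<Longrightarrow> x \<le> r \<Longrightarrow> \<alpha> x = 0" "\<And>x. x \<le> r \<Longrightarrow> \<alpha> x \<le> sum_mset \<nu>"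
      by (rule idem_mult_idem_support[OF n basis(2)]) blast
    have "(F (hat \<nu>) \<alpha> (hat \<nu>) :: schur_index \<Rightarrow> 'k) \<in> modulo_idem \<nu> J"
      using rank_cases[OF a(1,3,4) Par_sum[OF n]]
    proof
      assume rk: "rank \<alpha> < sum_mset \<nu>"
      have "(F (hat \<nu>) \<alpha> (hat \<nu>) :: schur_index \<Rightarrow> 'k) \<in> J"
        by (rule F_in_ideal[OF hat_L[OF n] hat_L[OF n] a(1) J], rule gen) (use rk in \<open>auto simp: before_def\<close>)
      then show ?thesis by (rule modulo_idem_ideal[OF J])
    next
      assume "\<exists>w. w permutes pts \<nu> \<and> \<alpha> = w \<circ> eps (sum_mset \<nu>)"
      then obtain w where w: "w permutes pts \<nu>" "\<alpha> = w \<circ> eps (sum_mset \<nu>)" by blast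
      show ?thesis unfolding w(2)
        by (rule straighten[OF J n _ w(1)], rule gen) (auto simp: before_def)
    qed
    then show ?case unfolding a(2) F_def .
  qed (use modulo_idem_add[OF J] modulo_idem_scale[OF J] in blast)+
qed

lemma chain: "idempotent_chain (alg :: (schur_index \<Rightarrow> 'k::field) ring) Par before idem"
proof -
  interpret R: ring "alg :: (schur_index \<Rightarrow> 'k) ring" by (rule alg_ring)
  have idl: "ideal (genideal alg (idem ` T)) (alg :: (schur_index \<Rightarrow> 'k) ring)" if "T \<subseteq> Par" for T
    using that idem_carrier by (intro R.genideal_ideal) auto
  have self: "(idem \<kappa> :: schur_index \<Rightarrow> 'k) \<in> genideal alg (idem ` T)" if "T \<subseteq> Par" "\<kappa> \<in> T" for T \<kappa>
    using R.genideal_self[of "idem ` T"] that idem_carrier by auto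
  show ?thesis
  proof (intro idempotent_chain.intro idempotent_chain_axioms.intro R.ring_axioms finite_Par)
    show "\<not> before i i" "before i j \<Longrightarrow> before j k \<Longrightarrow> before i k" for i j k
      by (auto simp: before_def)
    show "before i j \<or> before j i" if "i \<noteq> j" for i j using that by (auto simp: before_def)
    show "genideal alg (idem ` Par) = carrier (alg :: (schur_index \<Rightarrow> 'k) ring)"
    proof
      let ?J = "genideal alg (idem ` Par) :: (schur_index \<Rightarrow> 'k) set"
      have J: "ideal ?J alg" by (rule idl) simp
      then interpret J: ideal ?J "alg :: (schur_index \<Rightarrow> 'k) ring" .
      show "?J \<subseteq> carrier alg" by (rule J.a_subset)
      show "carrier alg \<subseteq> ?J"
      proof
        fix x :: "schur_index \<Rightarrow> 'k" assume "x \<in> carrier alg"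
        then show "x \<in> ?J"
        proof (induction rule: basis_induct)
          case (basis c)
          obtain l \<alpha> m where c: "l \<in> L" "m \<in> L" "\<alpha> \<in> S" "c = (l, double_coset l \<alpha> m, m)"
            using basis(1) by (rule Bas_cases)
          have "F l \<alpha> m \<in> ?J" using c(1-3) J by (rule F_in_ideal) (rule self, auto)
          then show ?case unfolding c(4) F_def .
        qed (use ideal_zero[OF J] ideal_add[OF J] ideal_scale[OF J] in blast)+
      qed
    qed
    fix \<nu> assume n: "\<nu> \<in> Par"
    show "(idem \<nu> :: schur_index \<Rightarrow> 'k) \<in> carrier alg" using idem_carrier[OF n] .
    show "idem \<nu> \<otimes>\<^bsub>alg\<^esub> idem \<nu> = (idem \<nu> :: schur_index \<Rightarrow> 'k)" using idem_idem[OF n] .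
    let ?T = "{\<kappa> \<in> Par. before \<kappa> \<nu>}"
    let ?J = "genideal alg (idem ` ?T) :: (schur_index \<Rightarrow> 'k) set"
    show "idem \<nu> \<notin> ?J" by (rule idem_notin_ideal[OF n]) (auto simp: before_def)
    have J: "ideal ?J alg" by (rule idl) auto
    interpret J: ideal ?J "alg :: (schur_index \<Rightarrow> 'k) ring" by (rule J)
    fix x :: "schur_index \<Rightarrow> 'k" assume x: "x \<in> carrier alg"
    define y where "y = idem \<nu> \<otimes>\<^bsub>alg\<^esub> x \<otimes>\<^bsub>alg\<^esub> idem \<nu>"
    have yc: "y \<in> carrier alg" unfolding y_def by (intro R.m_closed idem_carrier n x)
    have "y \<in> modulo_idem \<nu> ?J"
      unfolding y_def R.m_assoc[OF idem_carrier[OF n] x idem_carrier[OF n]]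
      by (rule idem_local[OF n x J], rule self) auto
    then obtain t where t: "(\<lambda>c. y c - t * idem \<nu> c) \<in> ?J" unfolding modulo_idem_def by blast
    show "y \<in> ?J \<or> (\<exists>z\<in>carrier alg. z \<otimes>\<^bsub>alg\<^esub> y \<ominus>\<^bsub>alg\<^esub> idem \<nu> \<in> ?J)"
    proof (cases "t = 0")
      case True
      then show ?thesis using t by simp
    next
      case False
      define z :: "schur_index \<Rightarrow> 'k" where "z = (\<lambda>c. inverse t * \<one>\<^bsub>alg\<^esub> c)"
      have zc: "z \<in> carrier alg" using R.one_closed by (simp add: z_def alg_carrier)
      have zy: "z \<otimes>\<^bsub>alg\<^esub> y = (\<lambda>c. inverse t * y c)"
        unfolding z_def scale_eq_mult[OF yc, symmetric] ..
      have "z \<otimes>\<^bsub>alg\<^esub> y \<ominus>\<^bsub>alg\<^esub> idem \<nu> = (\<lambda>c. inverse t * (y c - t * idem \<nu> c))"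
        unfolding alg_minus[OF R.m_closed[OF zc yc] idem_carrier[OF n]]
        unfolding zy using False by (intro ext) (simp add: right_diff_distrib)
      then have "z \<otimes>\<^bsub>alg\<^esub> y \<ominus>\<^bsub>alg\<^esub> idem \<nu> \<in> ?J" using ideal_scale[OF J t, of "inverse t"] by simp
      then show ?thesis using zc by blast
    qed
  qed
qed

end

subsection \<open>Digits of multiplicities\<close>

lemma sum_digits_div_mod:
  fixes p :: nat
  assumes "0 < p" "\<And>i. i < N \<Longrightarrow> d i < p" "k < N"
  shows "(\<Sum>i<N. p ^ i * d i) div p ^ k mod p = d k"
  using assms(2,3)
proof (induction k arbitrary: N d)
  case 0
  then obtain N' where N: "N = Suc N'" by (cases N) auto
  have "(\<Sum>i<N. p ^ i * d i) = d 0 + p * (\<Sum>i<N'. p ^ i * d (Suc i))"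
    unfolding N sum.lessThan_Suc_shift by (simp add: sum_distrib_left mult.assoc)
  then show ?case using 0 by simp
next
  case (Suc k)
  then obtain N' where N: "N = Suc N'" by (cases N) auto
  have "(\<Sum>i<N. p ^ i * d i) = d 0 + p * (\<Sum>i<N'. p ^ i * d (Suc i))"
    unfolding N sum.lessThan_Suc_shift by (simp add: sum_distrib_left mult.assoc)
  then have "(\<Sum>i<N. p ^ i * d i) div p = (\<Sum>i<N'. p ^ i * d (Suc i))" using Suc.prems(1)[of 0] N assms(1) by simp
  then have "(\<Sum>i<N. p ^ i * d i) div p ^ Suc k = (\<Sum>i<N'. p ^ i * d (Suc i)) div p ^ k"
    by (simp add: div_mult2_eq)
  then show ?case using Suc.IH[of N' "\<lambda>i. d (Suc i)"] Suc.prems N by simp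
qed

lemma sum_digits:
  fixes p c :: nat
  assumes "c < p ^ N" shows "(\<Sum>i<N. p ^ i * (c div p ^ i mod p)) = c"
  using assms
proof (induction N arbitrary: c)
  case (Suc N)
  have "c div p < p ^ N" using Suc.prems by (simp add: less_mult_imp_div_less mult.commute)
  have "(\<Sum>i<Suc N. p ^ i * (c div p ^ i mod p)) = c mod p + p * (\<Sum>i<N. p ^ i * (c div p div p ^ i mod p))"
    unfolding sum.lessThan_Suc_shift by (simp add: sum_distrib_left mult.assoc div_mult2_eq)
  also have "\<dots> = c mod p + p * (c div p)" by (simp only: Suc.IH[OF \<open>c div p < p ^ N\<close>])
  finally show ?case by simp
qed simp

definition digit_mset :: "nat \<Rightarrow> nat multiset \<Rightarrow> nat \<Rightarrow> nat multiset" where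
  "digit_mset p \<nu> i = (\<Sum>x\<in>set_mset \<nu>. replicate_mset (count \<nu> x div p ^ i mod p) x)"

lemma count_digit_mset: "count (digit_mset p \<nu> i) x = count \<nu> x div p ^ i mod p"
proof -
  have "count (digit_mset p \<nu> i) x = (\<Sum>y\<in>set_mset \<nu>. if y = x then count \<nu> x div p ^ i mod p else 0)"
    unfolding digit_mset_def count_sum by (intro sum.cong refl) simp
  then show ?thesis by (simp add: not_in_iff)
qed

definition label_mset :: "(nat \<rightharpoonup> nat multiset) \<times> nat multiset option \<Rightarrow> nat \<Rightarrow> nat multiset" where
  "label_mset = (\<lambda>(P, Q) i. case (if i = 0 then Q else P i) of None \<Rightarrow> {#} | Some \<pi> \<Rightarrow> \<pi>)"

definition label_partition ::
  "nat \<Rightarrow> nat \<Rightarrow> (nat \<Rightarrow> nat) \<times> (nat \<rightharpoonup> nat multiset) \<times> nat \<times> nat multiset option \<Rightarrow> nat multiset" where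
  "label_partition p r = (\<lambda>(s, P, j, Q). \<Sum>i<Suc r. repeat_mset (p ^ i) (label_mset (P, Q) i))"

lemma sum_mset_repeat: "sum_mset (repeat_mset k \<pi>) = k * sum_mset (\<pi> :: nat multiset)"
  by (induction k) auto

lemma sum_mset_sum: "finite A \<Longrightarrow> sum_mset (\<Sum>i\<in>A. f i) = (\<Sum>i\<in>A. sum_mset (f i :: nat multiset))"
  by (induction A rule: finite_induct) auto

lemma less_power_Suc: "2 \<le> p \<Longrightarrow> r < p ^ Suc r" for p r :: nat
proof -
  assume "2 \<le> p"
  have "r < 2 ^ r" by simp
  also have "\<dots> \<le> 2 ^ Suc r" by simp
  also have "\<dots> \<le> p ^ Suc r" using \<open>2 \<le> p\<close> by (rule power_mono) simp
  finally show ?thesis .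
qed

lemma label_props:
  assumes p: "2 \<le> p" and lab: "(s, P, j, Q) \<in> irreducible_labels p r"
  shows "\<And>i. 0 \<notin># label_mset (P, Q) i" "\<And>i x. count (label_mset (P, Q) i) x < p"
    "\<And>i. 0 < i \<Longrightarrow> sum_mset (label_mset (P, Q) i) = s i" "sum_mset (label_mset (P, Q) 0) = j"
    "\<And>i. r < i \<Longrightarrow> s i = 0" "(\<Sum>i<Suc r. p ^ i * s i) = r" "j \<le> s 0"
    "P = (\<lambda>i. if 0 < i \<and> 0 < sum_mset (label_mset (P, Q) i) then Some (label_mset (P, Q) i) else None)"
    "Q = (if 0 < j then Some (label_mset (P, Q) 0) else None)"
proof -
  have l: "finite {i. s i \<noteq> 0}" "(\<Sum>i | s i \<noteq> 0. s i * p ^ i) = r" "dom P = {i. 0 < i \<and> 0 < s i}"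
    "\<And>i \<pi>. P i = Some \<pi> \<Longrightarrow> is_partition (s i) \<pi> \<and> p_regular p \<pi>" "j \<le> s 0" "Q \<noteq> None \<longleftrightarrow> 0 < j"
    "\<And>\<pi>. Q = Some \<pi> \<Longrightarrow> is_partition j \<pi> \<and> p_regular p \<pi>"
    using lab by (auto simp: irreducible_labels_def)
  have reg: "count \<pi> x < p" if "0 \<notin># \<pi>" "p_regular p \<pi>" for \<pi> x
    using that p by (cases "x = 0") (auto simp: p_regular_def not_in_iff)
  show "0 \<notin># label_mset (P, Q) i" for i
    using l(4)[of i] l(7) by (auto simp: label_mset_def is_partition_def split: option.splits)
  then show "count (label_mset (P, Q) i) x < p" for i x
    using l(4)[of i] l(7) p by (auto simp: label_mset_def is_partition_def split: option.splits intro!: reg)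
  have Pn: "P i = None \<longleftrightarrow> \<not> (0 < i \<and> 0 < s i)" for i using l(3) by (metis (mono_tags, lifting) domIff mem_Collect_eq)
  show si: "sum_mset (label_mset (P, Q) i) = s i" if "0 < i" for i
    using l(4)[of i] Pn[of i] that by (auto simp: label_mset_def is_partition_def split: option.splits)
  show s0: "sum_mset (label_mset (P, Q) 0) = j"
    using l(6,7) by (auto simp: label_mset_def is_partition_def split: option.splits)
  show "P = (\<lambda>i. if 0 < i \<and> 0 < sum_mset (label_mset (P, Q) i) then Some (label_mset (P, Q) i) else None)"
  proof
    fix i show "P i = (if 0 < i \<and> 0 < sum_mset (label_mset (P, Q) i) then Some (label_mset (P, Q) i) else None)"
      using Pn[of i] si[of i] by (cases "P i") (auto simp: label_mset_def)
  qed
  show "Q = (if 0 < j then Some (label_mset (P, Q) 0) else None)"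
    using l(6) by (cases Q) (auto simp: label_mset_def)
  show "j \<le> s 0" by fact
  show big: "s i = 0" if "r < i" for i
  proof (rule ccontr)
    assume ne: "s i \<noteq> 0"
    then have "s i * p ^ i \<le> r" using member_le_sum[of i "{i. s i \<noteq> 0}" "\<lambda>i. s i * p ^ i"] l(1,2) by simp
    moreover have "p ^ Suc r \<le> p ^ i" using that p by (intro power_increasing) auto
    moreover have "p ^ i \<le> s i * p ^ i" using ne by simp
    ultimately show False using less_power_Suc[OF p, of r] by linarith
  qed
  have "(\<Sum>i | s i \<noteq> 0. s i * p ^ i) = (\<Sum>i<Suc r. s i * p ^ i)"
  proof (rule sum.mono_neutral_left)
    show "{i. s i \<noteq> 0} \<subseteq> {..<Suc r}"
    proof
      fix i assume "i \<in> {i. s i \<noteq> 0}"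
      then have "\<not> r < i" using big[of i] by auto
      then show "i \<in> {..<Suc r}" by simp
    qed
  qed auto
  then show "(\<Sum>i<Suc r. p ^ i * s i) = r" using l(2) by (simp add: mult.commute)
qed

lemma label_partition_bij:
  assumes p: "2 \<le> p"
  shows "bij_betw (label_partition p r) (irreducible_labels p r) {\<nu>. 0 \<notin># \<nu> \<and> sum_mset \<nu> \<le> r}"
proof (rule bij_betw_imageI)
  have digit: "digit_mset p (label_partition p r (s, P, j, Q)) i = label_mset (P, Q) i"
    if lab: "(s, P, j, Q) \<in> irreducible_labels p r" and i: "i < Suc r" for s P j Q i
  proof (rule multiset_eqI)
    fix x
    have "count (label_partition p r (s, P, j, Q)) x = (\<Sum>i<Suc r. p ^ i * count (label_mset (P, Q) i) x)"
      by (simp only: label_partition_def prod.case count_sum count_repeat_mset)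
    then show "count (digit_mset p (label_partition p r (s, P, j, Q)) i) x = count (label_mset (P, Q) i) x"
      unfolding count_digit_mset using sum_digits_div_mod[of p "Suc r" "\<lambda>i. count (label_mset (P, Q) i) x" i]
        label_props(2)[OF p lab] i p by simp
  qed
  show "inj_on (label_partition p r) (irreducible_labels p r)"
  proof (rule inj_onI)
    fix a b assume ab: "a \<in> irreducible_labels p r" "b \<in> irreducible_labels p r"
      "label_partition p r a = label_partition p r b"
    obtain s P j Q where a: "a = (s, P, j, Q)" by (cases a) auto
    obtain s' P' j' Q' where b: "b = (s', P', j', Q')" by (cases b) auto
    note lab = ab(1)[unfolded a] and lab' = ab(2)[unfolded b] and eq = ab(3)[unfolded a b]
    note lp = label_props[OF p lab] and lp' = label_props[OF p lab']
    have M: "label_mset (P, Q) i = label_mset (P', Q') i" for i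
    proof (cases "i < Suc r")
      case True
      then show ?thesis using digit[OF lab] digit[OF lab'] eq by simp
    next
      case False
      then have "sum_mset (label_mset (P, Q) i) = 0" "sum_mset (label_mset (P', Q') i) = 0"
        using lp(3)[of i] lp(5)[of i] lp'(3)[of i] lp'(5)[of i] by auto
      then have "set_mset (label_mset (P, Q) i) \<subseteq> {0}" "set_mset (label_mset (P', Q') i) \<subseteq> {0}" by auto
      then have "label_mset (P, Q) i = {#}" "label_mset (P', Q') i = {#}"
        using lp(1)[of i] lp'(1)[of i] by (auto simp: subset_singleton_iff)
      then show ?thesis by simp
    qed
    have jj: "j = j'" using lp(4) lp'(4) M[of 0] by simp
    have ss: "s i = s' i" if "0 < i" for i using lp(3)[OF that] lp'(3)[OF that] M[of i] by simp
    have "(\<Sum>i<Suc r. p ^ i * s i) = (\<Sum>i<Suc r. p ^ i * s' i)" using lp(6) lp'(6) by simp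
    then have "s 0 = s' 0" unfolding sum.lessThan_Suc_shift using ss by simp
    then have "s = s'" using ss by (intro ext) (metis gr0I)
    moreover have "P = P'" by (subst lp(8), subst lp'(8)) (simp only: M)
    moreover have "Q = Q'" by (subst lp(9), subst lp'(9)) (simp only: M jj)
    ultimately show "a = b" unfolding a b using jj by blast
  qed
  show "label_partition p r ` irreducible_labels p r = {\<nu>. 0 \<notin># \<nu> \<and> sum_mset \<nu> \<le> r}"
  proof (intro subset_antisym subsetI)
    fix \<nu> assume "\<nu> \<in> label_partition p r ` irreducible_labels p r"
    then obtain s P j Q where lab: "(s, P, j, Q) \<in> irreducible_labels p r" "\<nu> = label_partition p r (s, P, j, Q)" by auto
    note lp = label_props[OF p lab(1)]
    have nu: "\<nu> = (\<Sum>i<Suc r. repeat_mset (p ^ i) (label_mset (P, Q) i))" using lab(2) by (simp only: label_partition_def prod.case)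
    have "count \<nu> 0 = 0"
      unfolding nu count_sum count_repeat_mset using lp(1) by (simp only: not_in_iff mult_zero_right sum.neutral_const)
    then have "0 \<notin># \<nu>" by (simp add: not_in_iff)
    moreover have "sum_mset \<nu> = (\<Sum>i<Suc r. p ^ i * sum_mset (label_mset (P, Q) i))"
      unfolding nu by (simp only: sum_mset_sum[OF finite_lessThan] sum_mset_repeat)
    then have "sum_mset \<nu> \<le> (\<Sum>i<Suc r. p ^ i * s i)"
      using lp(3,4,7) by (auto intro!: sum_mono simp del: sum.lessThan_Suc) (metis gr0I order_refl)
    ultimately show "\<nu> \<in> {\<nu>. 0 \<notin># \<nu> \<and> sum_mset \<nu> \<le> r}" using lp(6) by simp
  next
    fix \<nu> assume "\<nu> \<in> {\<nu>. 0 \<notin># \<nu> \<and> sum_mset \<nu> \<le> r}"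
    then have nu: "0 \<notin># \<nu>" "sum_mset \<nu> \<le> r" by auto
    define M where "M = digit_mset p \<nu>"
    have M0: "0 \<notin># M i" for i using nu(1) by (simp add: M_def not_in_iff count_digit_mset)
    have cr: "count \<nu> x < p ^ Suc r" for x
    proof (cases "x = 0")
      case True then show ?thesis using nu(1) p by (simp add: not_in_iff)
    next
      case False
      have "count \<nu> x \<le> size \<nu>" by (rule count_le_size)
      also have "\<dots> \<le> sum_mset \<nu>" using nu(1)
      proof (induction \<nu>)
        case (add x \<nu>)
        then have "size \<nu> \<le> sum_mset \<nu>" "0 < x" by auto
        then show ?case by simp
      qed simp
      finally show ?thesis using nu(2) less_power_Suc[OF p, of r] by linarith
    qed
    have Mbig: "M i = {#}" if "r < i" for i
    proof (rule multiset_eqI)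
      fix x
      have "p ^ Suc r \<le> p ^ i" using that p by (intro power_increasing) auto
      then have "count \<nu> x < p ^ i" using cr[of x] by linarith
      then show "count (M i) x = count {#} x" by (simp add: M_def count_digit_mset)
    qed
    have sumM: "(\<Sum>i<Suc r. repeat_mset (p ^ i) (M i)) = \<nu>"
    proof (rule multiset_eqI)
      fix x show "count (\<Sum>i<Suc r. repeat_mset (p ^ i) (M i)) x = count \<nu> x"
        unfolding count_sum count_repeat_mset M_def count_digit_mset by (rule sum_digits[OF cr])
    qed
    have "(\<Sum>i<Suc r. p ^ i * sum_mset (M i)) = sum_mset \<nu>"
      by (subst sumM[symmetric]) (simp only: sum_mset_sum[OF finite_lessThan] sum_mset_repeat)
    then have tot: "sum_mset (M 0) + (\<Sum>i<r. p ^ Suc i * sum_mset (M (Suc i))) \<le> r"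
      unfolding sum.lessThan_Suc_shift using nu(2) by simp
    define s where "s i = (if i = 0 then r - (\<Sum>i<r. p ^ Suc i * sum_mset (M (Suc i))) else sum_mset (M i))" for i
    define P where "P i = (if 0 < i \<and> 0 < s i then Some (M i) else None)" for i
    define j where "j = sum_mset (M 0)"
    define Q where "Q = (if 0 < j then Some (M 0) else None)"
    have reg: "p_regular p (M i)" for i using p by (simp add: p_regular_def M_def count_digit_mset)
    have fin: "{i. s i \<noteq> 0} \<subseteq> {..<Suc r}"
    proof
      fix i assume i: "i \<in> {i. s i \<noteq> 0}"
      show "i \<in> {..<Suc r}" using i Mbig[of i] by (cases "r < i") (auto simp: s_def)
    qed
    have "(\<Sum>i | s i \<noteq> 0. s i * p ^ i) = (\<Sum>i<Suc r. s i * p ^ i)"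
      using fin by (intro sum.mono_neutral_left) auto
    also have "\<dots> = s 0 + (\<Sum>i<r. s (Suc i) * p ^ Suc i)" unfolding sum.lessThan_Suc_shift by simp
    also have "\<dots> = r" using tot by (simp add: s_def mult.commute)
    finally have "(s, P, j, Q) \<in> irreducible_labels p r"
      using finite_subset[OF fin] tot M0 reg
      unfolding irreducible_labels_def
      by (auto simp: P_def Q_def j_def is_partition_def s_def split: if_splits)
    moreover have "label_mset (P, Q) i = M i" for i
    proof -
      have "M i = {#}" if "sum_mset (M i) = 0"
      proof -
        have "set_mset (M i) \<subseteq> {0}" using that by auto
        then show ?thesis using M0[of i] by (auto simp: subset_singleton_iff)
      qed
      then show ?thesis by (auto simp: label_mset_def P_def Q_def j_def s_def)
    qed
    then have "label_partition p r (s, P, j, Q) = \<nu>" using sumM by (simp add: label_partition_def)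
    ultimately show "\<nu> \<in> label_partition p r ` irreducible_labels p r" by (metis image_eqI)
  qed
qed

theorem mainTheorem5:
  fixes r n p :: nat
    and S :: "(nat \<Rightarrow> nat) set"
    and B :: "(schur_index \<Rightarrow> 'k::field) ring"
  assumes "1 \<le> r" and "r \<le> n"
    and "submonoid S (tau_bar r)" and "rook_monoid r \<subseteq> S"
    and "CHAR('k) = p" and "0 < p"
    and "B = schur_algebra S n r"
  shows "(\<exists>\<Phi>. bij_betw \<Phi> (irreducible_labels p r)
            (irreducible_classes B
              :: (schur_index \<Rightarrow> 'k, (schur_index \<Rightarrow> 'k) set) module set set))
       \<and> (\<forall>V :: (schur_index \<Rightarrow> 'k, 'v) module. irreducible_module B V \<longrightarrow>
            (\<exists>W :: (schur_index \<Rightarrow> 'k, (schur_index \<Rightarrow> 'k) set) module.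
               irreducible_module B W \<and> module_isomorphic B V W))"
proof -
  interpret schur r n S using assms(2-4) by (intro schur.intro)
  have B: "B = alg" using assms(7) schur_algebra_eq by simp
  interpret C: idempotent_chain B Par before idem unfolding B by (rule chain)
  have "2 \<le> p" using prime_ge_2_nat[OF prime_CHAR_semidom[where ?'a = 'k]] assms(5,6) by simp
  then have "bij_betw (label_partition p r) (irreducible_labels p r) Par"
    unfolding Par_def by (rule label_partition_bij)
  from bij_betw_trans[OF this C.irreducible_classes_bij] show ?thesis
    using C.irreducible_isomorphic_to_quotient by blast
qed

end
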